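(* Let $R$ be a ring, $M$ an $R$-bimodule, $n\ge1$. If $[Y,g]$ is a left $R\ltimes_n M$-module such that $\mathrm{Ext}^i_{R\ltimes_n M}(\mathbf{Z}(R),[Y,g])=0$ for any $i\ge1$, then $id({}_{R\ltimes_n M}[Y,g])=id({}_R\ker(g))$.
   Context: All rings are nonzero, associative, with identity; all modules are unitary. $M^{\otimes_R 0}=R$, $M^{\otimes_R 1}=M$, $M^{\otimes_R (i+1)}=M\otimes_R M^{\otimes_R i}$. The $n$-trivial extension $R\ltimes_n M$ is the abelian group $\coprod_{i=0}^n M^{\otimes_R i}$ with multiplication $(m_0,\dots,m_n)(m_0',\dots,m_n')=\big(\sum_{i+j=k}m_i\otimes m_j'\big)_{0\le k\le n}$ (using the canonical identifications $R\otimes_R N=N=N\otimes_R R$). For a left $R$-module $Y$, $\mathrm{Hom}_R(M,Y)$ denotes left $R$-homomorphisms, a left $R$-module via $(r\varphi)(m)=\varphi(mr)$; $\mathrm{Hom}_R^0(M,Y)=Y$ and $\mathrm{Hom}_R^{i}(M,Y)=\mathrm{Hom}_R(M,\mathrm{Hom}_R^{i-1}(M,Y))$. Left $R\ltimes_n M$-modules are identified with pairs $[Y,g]$, where $Y$ is a left $R$-module and $g:Y\to\mathrm{Hom}_R(M,Y)$ is a left $R$-homomorphism such that the composite $\mathrm{Hom}_R^n(M,g)\cdots\mathrm{Hom}_R(M,g)\,g:Y\to\mathrm{Hom}_R^{n+1}(M,Y)$ is zero; explicitly $g(y)(m)=(0,m,0,\dots,0)y$. $\mathbf{Z}(R)$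 is the left $R\ltimes_n M$-module with underlying $R$-module $R$ on which $(m_0,\dots,m_n)$ acts as left multiplication by $m_0$. $id$ denotes injective dimension. *)

theory Defs
  imports "HOL-Algebra.Module" "HOL-Algebra.Free_Abelian_Groups" "HOL-Library.Extended_Nat"
begin

section \<open>Modules over a noncommutative ring\<close>

text \<open>The locale \<^locale>\<open>module\<close> of the library presupposes a commutative ring, so only its record
  type is reused. The ring fields \<open>mult\<close> and \<open>one\<close> of a module record play no role for modules.\<close>

locale left_module = R?: ring R + X?: abelian_group X
  for R (structure) and X (structure) +
  assumes smult_closed:
      "\<lbrakk>r \<in> carrier R; x \<in> carrier X\<rbrakk> \<Longrightarrow> r \<odot>\<^bsub>X\<^esub> x \<in> carrier X"
    and smult_l_distr:
      "\<lbrakk>r \<in> carrier R; s \<in> carrier R; x \<in> carrier X\<rbrakk> \<Longrightarrow>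
        (r \<oplus>\<^bsub>R\<^esub> s) \<odot>\<^bsub>X\<^esub> x = (r \<odot>\<^bsub>X\<^esub> x) \<oplus>\<^bsub>X\<^esub> (s \<odot>\<^bsub>X\<^esub> x)"
    and smult_r_distr:
      "\<lbrakk>r \<in> carrier R; x \<in> carrier X; y \<in> carrier X\<rbrakk> \<Longrightarrow>
        r \<odot>\<^bsub>X\<^esub> (x \<oplus>\<^bsub>X\<^esub> y) = (r \<odot>\<^bsub>X\<^esub> x) \<oplus>\<^bsub>X\<^esub> (r \<odot>\<^bsub>X\<^esub> y)"
    and smult_assoc:
      "\<lbrakk>r \<in> carrier R; s \<in> carrier R; x \<in> carrier X\<rbrakk> \<Longrightarrow>
        (r \<otimes>\<^bsub>R\<^esub> s) \<odot>\<^bsub>X\<^esub> x = r \<odot>\<^bsub>X\<^esub> (s \<odot>\<^bsub>X\<^esub> x)"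
    and smult_one:
      "x \<in> carrier X \<Longrightarrow> \<one>\<^bsub>R\<^esub> \<odot>\<^bsub>X\<^esub> x = x"

record ('a, 'm) bimodule = "('a, 'm) module" +
  rsmult :: "'m \<Rightarrow> 'a \<Rightarrow> 'm"  (infixl \<open>\<odot>r\<index>\<close> 70)

locale bimodule = left_module R M for R (structure) and M (structure) +
  assumes rsmult_closed:
      "\<lbrakk>m \<in> carrier M; r \<in> carrier R\<rbrakk> \<Longrightarrow> m \<odot>r\<^bsub>M\<^esub> r \<in> carrier M"
    and rsmult_r_distr:
      "\<lbrakk>m \<in> carrier M; r \<in> carrier R; s \<in> carrier R\<rbrakk> \<Longrightarrow>
        m \<odot>r\<^bsub>M\<^esub> (r \<oplus>\<^bsub>R\<^esub> s) = (m \<odot>r\<^bsub>M\<^esub> r) \<oplus>\<^bsub>M\<^esub> (m \<odot>r\<^bsub>M\<^esub> s)"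
    and rsmult_l_distr:
      "\<lbrakk>m \<in> carrier M; m' \<in> carrier M; r \<in> carrier R\<rbrakk> \<Longrightarrow>
        (m \<oplus>\<^bsub>M\<^esub> m') \<odot>r\<^bsub>M\<^esub> r = (m \<odot>r\<^bsub>M\<^esub> r) \<oplus>\<^bsub>M\<^esub> (m' \<odot>r\<^bsub>M\<^esub> r)"
    and rsmult_assoc:
      "\<lbrakk>m \<in> carrier M; r \<in> carrier R; s \<in> carrier R\<rbrakk> \<Longrightarrow>
        m \<odot>r\<^bsub>M\<^esub> (r \<otimes>\<^bsub>R\<^esub> s) = (m \<odot>r\<^bsub>M\<^esub> r) \<odot>r\<^bsub>M\<^esub> s"
    and rsmult_one:
      "m \<in> carrier M \<Longrightarrow> m \<odot>r\<^bsub>M\<^esub> \<one>\<^bsub>R\<^esub> = m"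
    and smult_rsmult:
      "\<lbrakk>r \<in> carrier R; m \<in> carrier M; s \<in> carrier R\<rbrakk> \<Longrightarrow>
        (r \<odot>\<^bsub>M\<^esub> m) \<odot>r\<^bsub>M\<^esub> s = r \<odot>\<^bsub>M\<^esub> (m \<odot>r\<^bsub>M\<^esub> s)"

text \<open>Homomorphisms are taken extensional, so that equality of homomorphisms is equality of
  functions.\<close>

definition module_hom ::
  "('a, 'c) ring_scheme \<Rightarrow> ('a, 'x, 'd) module_scheme \<Rightarrow> ('a, 'y, 'e) module_scheme \<Rightarrow> ('x \<Rightarrow> 'y) set" where
  "module_hom R X Y = {f \<in> carrier X \<rightarrow>\<^sub>E carrier Y.
     (\<forall>x\<in>carrier X. \<forall>x'\<in>carrier X. f (x \<oplus>\<^bsub>X\<^esub> x') = f x \<oplus>\<^bsub>Y\<^esub> f x') \<and>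
     (\<forall>r\<in>carrier R. \<forall>x\<in>carrier X. f (r \<odot>\<^bsub>X\<^esub> x) = r \<odot>\<^bsub>Y\<^esub> f x)}"

definition hom_module ::
  "'a ring \<Rightarrow> ('a, 'm) bimodule \<Rightarrow> ('a, 'y) module \<Rightarrow> ('a, 'm \<Rightarrow> 'y) module" where
  "hom_module R M Y =
    \<lparr>carrier = module_hom R M Y,
     mult = undefined, one = undefined,
     ring.zero = (\<lambda>m\<in>carrier M. \<zero>\<^bsub>Y\<^esub>),
     ring.add = (\<lambda>\<phi> \<psi>. \<lambda>m\<in>carrier M. \<phi> m \<oplus>\<^bsub>Y\<^esub> \<psi> m),
     smult = (\<lambda>r \<phi>. \<lambda>m\<in>carrier M. \<phi> (m \<odot>r\<^bsub>M\<^esub> r))\<rparr>"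

definition regular_module :: "'a ring \<Rightarrow> ('a, 'a) module" where
  "regular_module R =
    \<lparr>carrier = carrier R, mult = undefined, one = undefined, ring.zero = \<zero>\<^bsub>R\<^esub>,
     ring.add = (\<lambda>x y. x \<oplus>\<^bsub>R\<^esub> y), smult = (\<lambda>r x. r \<otimes>\<^bsub>R\<^esub> x)\<rparr>"

text \<open>The left module on the image of \<open>f\<close> that makes \<open>f\<close> an isomorphism, for \<open>f\<close> injective on the
  carrier.\<close>

definition transport ::
  "('x \<Rightarrow> 'y) \<Rightarrow> ('a, 'x, 'd) module_scheme \<Rightarrow> ('a, 'y) module" where
  "transport f X =
    (let h = inv_into (carrier X) f in
    \<lparr>carrier = f ` carrier X, mult = undefined, one = undefined, ring.zero = f \<zero>\<^bsub>X\<^esub>,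
     ring.add = (\<lambda>x y. f (h x \<oplus>\<^bsub>X\<^esub> h y)), smult = (\<lambda>r x. f (r \<odot>\<^bsub>X\<^esub> h x))\<rparr>)"


section \<open>Tensor products and tensor powers\<close>

definition tensor_free ::
  "('a, 'm) bimodule \<Rightarrow> ('a, 't) module \<Rightarrow> ('m \<times> 't \<Rightarrow>\<^sub>0 int) monoid" where
  "tensor_free M N = free_Abelian_group (carrier M \<times> carrier N)"

definition tensor_relations ::
  "'a ring \<Rightarrow> ('a, 'm) bimodule \<Rightarrow> ('a, 't) module \<Rightarrow> ('m \<times> 't \<Rightarrow>\<^sub>0 int) set" where
  "tensor_relations R M N =
     {frag_of (m \<oplus>\<^bsub>M\<^esub> m', x) - frag_of (m, x) - frag_of (m', x) | m m' x.
        m \<in> carrier M \<and> m' \<in> carrier M \<and> x \<in> carrier N} \<union>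
     {frag_of (m, x \<oplus>\<^bsub>N\<^esub> x') - frag_of (m, x) - frag_of (m, x') | m x x'.
        m \<in> carrier M \<and> x \<in> carrier N \<and> x' \<in> carrier N} \<union>
     {frag_of (m \<odot>r\<^bsub>M\<^esub> r, x) - frag_of (m, r \<odot>\<^bsub>N\<^esub> x) | m r x.
        m \<in> carrier M \<and> r \<in> carrier R \<and> x \<in> carrier N}"

definition tensor_kernel ::
  "'a ring \<Rightarrow> ('a, 'm) bimodule \<Rightarrow> ('a, 't) module \<Rightarrow> ('m \<times> 't \<Rightarrow>\<^sub>0 int) set" where
  "tensor_kernel R M N = generate (tensor_free M N) (tensor_relations R M N)"

definition pure_tensor ::
  "'a ring \<Rightarrow> ('a, 'm) bimodule \<Rightarrow> ('a, 't) module \<Rightarrow> 'm \<Rightarrow> 't \<Rightarrow> ('m \<times> 't \<Rightarrow>\<^sub>0 int) set" where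
  "pure_tensor R M N m x = tensor_kernel R M N #>\<^bsub>tensor_free M N\<^esub> frag_of (m, x)"

text \<open>The scalar \<open>r\<close> sends the class of a formal sum of pairs \<open>(m, x)\<close> to the class of the
  corresponding sum of the pairs \<open>(r m, x)\<close>; the union is over representatives of the class.\<close>

definition tensor_product ::
  "'a ring \<Rightarrow> ('a, 'm) bimodule \<Rightarrow> ('a, 't) module \<Rightarrow> ('a, ('m \<times> 't \<Rightarrow>\<^sub>0 int) set) module" where
  "tensor_product R M N =
    (let Q = tensor_free M N Mod tensor_kernel R M N in
    \<lparr>carrier = carrier Q, mult = undefined, one = undefined, ring.zero = \<one>\<^bsub>Q\<^esub>,
     ring.add = (\<lambda>C D. C \<otimes>\<^bsub>Q\<^esub> D),
     smult = (\<lambda>r C. \<Union>c\<in>C. tensor_kernel R M N #>\<^bsub>tensor_free M N\<^esub>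
       frag_extend (\<lambda>(m, x). frag_of (r \<odot>\<^bsub>M\<^esub> m, x)) c)\<rparr>)"

text \<open>The carrier type of the iterated tensor product grows with the number of factors. To have all
  tensor powers on one type, an element of \<open>M \<otimes> N\<close> is coded by a chosen formal sum
  (a list of triples \<open>(k, m, t)\<close>, standing for the sum of the \<open>k (m \<otimes> t)\<close>) representing it.\<close>

datatype ('a, 'm) tensor =
    Scal (the_Scal: 'a)
  | Vec (the_Vec: 'm)
  | FSum (the_FSum: "(int \<times> 'm \<times> ('a, 'm) tensor) list")

definition formal_sum :: "(int \<times> 'm \<times> 't) list \<Rightarrow> ('m \<times> 't \<Rightarrow>\<^sub>0 int)" where
  "formal_sum xs = (\<Sum>(k, m, t)\<leftarrow>xs. frag_cmul k (frag_of (m, t)))"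

definition tensor_code ::
  "('a, 'm) bimodule \<Rightarrow> ('a, ('a, 'm) tensor) module \<Rightarrow>
   ('m \<times> ('a, 'm) tensor \<Rightarrow>\<^sub>0 int) set \<Rightarrow> ('a, 'm) tensor" where
  "tensor_code M N C =
     FSum (SOME xs. (\<forall>(k, m, t)\<in>set xs. m \<in> carrier M \<and> t \<in> carrier N) \<and> formal_sum xs \<in> C)"

fun tensor_power :: "'a ring \<Rightarrow> ('a, 'm) bimodule \<Rightarrow> nat \<Rightarrow> ('a, ('a, 'm) tensor) module" where
  "tensor_power R M 0 = transport Scal (regular_module R)"
| "tensor_power R M (Suc 0) = transport Vec M"
| "tensor_power R M (Suc (Suc i)) =
     (let N = tensor_power R M (Suc i)
      in transport (tensor_code M N) (tensor_product R M N))"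

text \<open>The pairing \<open>M \<times> M\<^sup>j \<rightarrow> M\<^sup>j\<^sup>+\<^sup>1\<close> of tensor powers; for \<open>j = 0\<close> this uses \<open>M \<otimes> R = M\<close>.\<close>

fun tensor_cons ::
  "'a ring \<Rightarrow> ('a, 'm) bimodule \<Rightarrow> nat \<Rightarrow> 'm \<Rightarrow> ('a, 'm) tensor \<Rightarrow> ('a, 'm) tensor" where
  "tensor_cons R M 0 m t = Vec (m \<odot>r\<^bsub>M\<^esub> the_Scal t)"
| "tensor_cons R M (Suc j) m t =
     (let N = tensor_power R M (Suc j) in tensor_code M N (pure_tensor R M N m t))"

text \<open>The evaluation of a list of triples \<open>(k, m, t)\<close> as the sum of the elements \<open>k (\<beta> m t)\<close>.\<close>

definition eval_sum ::
  "('a, 'y, 'd) module_scheme \<Rightarrow> ('m \<Rightarrow> 't \<Rightarrow> 'y) \<Rightarrow> (int \<times> 'm \<times> 't) list \<Rightarrow> 'y" where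
  "eval_sum Y \<beta> xs = foldr (\<lambda>(k, m, t) y. ([k] \<cdot>\<^bsub>Y\<^esub> \<beta> m t) \<oplus>\<^bsub>Y\<^esub> y) xs \<zero>\<^bsub>Y\<^esub>"

text \<open>The canonical pairing \<open>(x, y) \<mapsto> x \<otimes> y\<close> of the \<open>i\<close>-th and the \<open>j\<close>-th tensor power into
  the \<open>(i+j)\<close>-th one, with \<open>R \<otimes> N = N = N \<otimes> R\<close> and
  \<open>(m \<otimes> t) \<otimes> y = m \<otimes> (t \<otimes> y)\<close>.\<close>

fun tensor_mult ::
  "'a ring \<Rightarrow> ('a, 'm) bimodule \<Rightarrow> nat \<Rightarrow> nat \<Rightarrow> ('a, 'm) tensor \<Rightarrow> ('a, 'm) tensor \<Rightarrow> ('a, 'm) tensor" where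
  "tensor_mult R M 0 j x y = the_Scal x \<odot>\<^bsub>tensor_power R M j\<^esub> y"
| "tensor_mult R M (Suc 0) j x y = tensor_cons R M j (the_Vec x) y"
| "tensor_mult R M (Suc (Suc i)) j x y =
     eval_sum (tensor_power R M (Suc (Suc i) + j))
       (\<lambda>m t. tensor_cons R M (Suc i + j) m (tensor_mult R M (Suc i) j t y)) (the_FSum x)"


section \<open>The \<open>n\<close>-trivial extension and its modules\<close>

definition trivial_extension ::
  "'a ring \<Rightarrow> ('a, 'm) bimodule \<Rightarrow> nat \<Rightarrow> (nat \<Rightarrow> ('a, 'm) tensor) ring" where
  "trivial_extension R M n =
    \<lparr>carrier = (\<Pi>\<^sub>E i\<in>{..n}. carrier (tensor_power R M i)),
     mult = (\<lambda>x y. \<lambda>k\<in>{..n}. \<Oplus>\<^bsub>tensor_power R M k\<^esub>i\<in>{..k}. tensor_mult R M i (k - i) (x i) (y (k - i))),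
     one = (\<lambda>i\<in>{..n}. if i = 0 then Scal \<one>\<^bsub>R\<^esub> else \<zero>\<^bsub>tensor_power R M i\<^esub>),
     ring.zero = (\<lambda>i\<in>{..n}. \<zero>\<^bsub>tensor_power R M i\<^esub>),
     ring.add = (\<lambda>x y. \<lambda>i\<in>{..n}. x i \<oplus>\<^bsub>tensor_power R M i\<^esub> y i)\<rparr>"

text \<open>The composite of \<open>g\<close>, \<open>Hom(M, g)\<close>, \dots, \<open>Hom\<^sup>n(M, g)\<close> sends \<open>y\<close> to the
  iterated homomorphism whose value at \<open>m\<^sub>1, \<dots>, m\<^sub>n\<^sub>+\<^sub>1\<close> is
  \<open>g (\<dots> (g (g y m\<^sub>1) m\<^sub>2) \<dots>) m\<^sub>n\<^sub>+\<^sub>1\<close>.\<close>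

definition extension_pair ::
  "'a ring \<Rightarrow> ('a, 'm) bimodule \<Rightarrow> nat \<Rightarrow> ('a, 'y) module \<Rightarrow> ('y \<Rightarrow> 'm \<Rightarrow> 'y) \<Rightarrow> bool" where
  "extension_pair R M n Y g \<longleftrightarrow>
     left_module R Y \<and> g \<in> module_hom R Y (hom_module R M Y) \<and>
     (\<forall>y\<in>carrier Y. \<forall>ms. set ms \<subseteq> carrier M \<and> length ms = n + 1 \<longrightarrow> foldl g y ms = \<zero>\<^bsub>Y\<^esub>)"

text \<open>The action of the \<open>i\<close>-th tensor power on \<open>Y\<close>: on a product
  \<open>m\<^sub>1 \<otimes> \<dots> \<otimes> m\<^sub>i\<close> it is the action of \<open>m\<^sub>i\<close>, \dots, \<open>m\<^sub>1\<close> in turn, where \<open>m\<close> acts by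
  \<open>y \<mapsto> g y m\<close>.\<close>

fun tensor_act ::
  "('a, 'y) module \<Rightarrow> ('y \<Rightarrow> 'm \<Rightarrow> 'y) \<Rightarrow> nat \<Rightarrow> ('a, 'm) tensor \<Rightarrow> 'y \<Rightarrow> 'y" where
  "tensor_act Y g 0 x y = the_Scal x \<odot>\<^bsub>Y\<^esub> y"
| "tensor_act Y g (Suc 0) x y = g y (the_Vec x)"
| "tensor_act Y g (Suc (Suc i)) x y =
     eval_sum Y (\<lambda>m t. g (tensor_act Y g (Suc i) t y) m) (the_FSum x)"

definition pair_module ::
  "nat \<Rightarrow> ('a, 'y) module \<Rightarrow> ('y \<Rightarrow> 'm \<Rightarrow> 'y) \<Rightarrow> (nat \<Rightarrow> ('a, 'm) tensor, 'y) module" where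
  "pair_module n Y g =
    \<lparr>carrier = carrier Y, mult = undefined, one = undefined, ring.zero = \<zero>\<^bsub>Y\<^esub>,
     ring.add = (\<lambda>y y'. y \<oplus>\<^bsub>Y\<^esub> y'),
     smult = (\<lambda>x y. \<Oplus>\<^bsub>Y\<^esub>i\<in>{..n}. tensor_act Y g i (x i) y)\<rparr>"

definition Z_module :: "'a ring \<Rightarrow> (nat \<Rightarrow> ('a, 'm) tensor, 'a) module" where
  "Z_module R =
    \<lparr>carrier = carrier R, mult = undefined, one = undefined, ring.zero = \<zero>\<^bsub>R\<^esub>,
     ring.add = (\<lambda>r s. r \<oplus>\<^bsub>R\<^esub> s),
     smult = (\<lambda>x r. the_Scal (x 0) \<otimes>\<^bsub>R\<^esub> r)\<rparr>"

definition ker_module ::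
  "'a ring \<Rightarrow> ('a, 'm) bimodule \<Rightarrow> ('a, 'y) module \<Rightarrow> ('y \<Rightarrow> 'm \<Rightarrow> 'y) \<Rightarrow> ('a, 'y) module" where
  "ker_module R M Y g = Y\<lparr>carrier := {y \<in> carrier Y. g y = \<zero>\<^bsub>hom_module R M Y\<^esub>}\<rparr>"


section \<open>Injective dimension and Ext\<close>

text \<open>HOL cannot quantify over types, so a type playing the role of a universe for modules over a
  ring on \<open>'s\<close> is needed. The following type contains \<open>'y\<close> and is closed under finite sequences and
  \<open>'s\<close>-indexed families. It therefore contains \<open>'s\<close>, and every \<open>S\<close>-module \<open>X\<close> on it embeds into an
  injective one on it: map \<open>X\<close> into the group of additive maps from \<open>S\<close> to \<open>D\<close>, where the divisible
  group \<open>D \<supseteq> X\<close> is a quotient of a direct sum of copies of the rationals indexed by \<open>X\<close>. Quotients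
  are realised on the same type by choosing representatives, so every \<open>S\<close>-module on \<open>'y\<close> has an
  injective resolution on it. Admitting larger carriers would change neither injectivity (by Baer's
  criterion) nor, as a consequence, the injective dimension or Ext.\<close>

datatype ('s, 'y) universe =
    Elem 'y
  | Tuple "('s, 'y) universe list"
  | Family "'s \<Rightarrow> ('s, 'y) universe"

definition injective_module :: "'s ring \<Rightarrow> ('s, 'e) module \<Rightarrow> bool" where
  "injective_module S E \<longleftrightarrow> left_module S E \<and>
     (\<forall>(A :: ('s, ('s, 'e) universe) module) (B :: ('s, ('s, 'e) universe) module).
        \<forall>f \<in> module_hom S A B. \<forall>h \<in> module_hom S A E.
          left_module S A \<and> left_module S B \<and> inj_on f (carrier A) \<longrightarrow>
          (\<exists>k \<in> module_hom S B E. \<forall>a\<in>carrier A. k (f a) = h a))"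

definition injective_resolution ::
  "'s ring \<Rightarrow> ('s, 'y) module \<Rightarrow> (nat \<Rightarrow> ('s, 'e) module) \<Rightarrow> ('y \<Rightarrow> 'e) \<Rightarrow> (nat \<Rightarrow> 'e \<Rightarrow> 'e) \<Rightarrow> bool" where
  "injective_resolution S Y E \<epsilon> d \<longleftrightarrow>
     (\<forall>i. injective_module S (E i)) \<and>
     \<epsilon> \<in> module_hom S Y (E 0) \<and> inj_on \<epsilon> (carrier Y) \<and>
     (\<forall>i. d i \<in> module_hom S (E i) (E (Suc i))) \<and>
     \<epsilon> ` carrier Y = {x \<in> carrier (E 0). d 0 x = \<zero>\<^bsub>E 1\<^esub>} \<and>
     (\<forall>i. d i ` carrier (E i) = {x \<in> carrier (E (Suc i)). d (Suc i) x = \<zero>\<^bsub>E (Suc (Suc i))\<^esub>})"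

definition inj_dim :: "'s ring \<Rightarrow> ('s, 'y) module \<Rightarrow> enat" where
  "inj_dim S Y = Inf {enat k | k.
     \<exists>(E :: nat \<Rightarrow> ('s, ('s, 'y) universe) module) \<epsilon> d.
       injective_resolution S Y E \<epsilon> d \<and> (\<forall>i>k. carrier (E i) = {\<zero>\<^bsub>E i\<^esub>})}"

definition hom_group ::
  "'s ring \<Rightarrow> ('s, 'x) module \<Rightarrow> ('s, 'e) module \<Rightarrow> ('x \<Rightarrow> 'e) monoid" where
  "hom_group S X E =
    \<lparr>carrier = module_hom S X E,
     mult = (\<lambda>\<phi> \<psi>. \<lambda>x\<in>carrier X. \<phi> x \<oplus>\<^bsub>E\<^esub> \<psi> x),
     one = (\<lambda>x\<in>carrier X. \<zero>\<^bsub>E\<^esub>)\<rparr>"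

text \<open>The group of \<open>i\<close>-cocycles of the complex \<open>Hom(X, E)\<close>, and its subgroup of \<open>i\<close>-coboundaries.\<close>

definition cocycles ::
  "'s ring \<Rightarrow> ('s, 'x) module \<Rightarrow> (nat \<Rightarrow> ('s, 'e) module) \<Rightarrow> (nat \<Rightarrow> 'e \<Rightarrow> 'e) \<Rightarrow> nat \<Rightarrow> ('x \<Rightarrow> 'e) monoid" where
  "cocycles S X E d i = (hom_group S X (E i))
     \<lparr>carrier := kernel (hom_group S X (E i)) (hom_group S X (E (Suc i))) (compose (carrier X) (d i))\<rparr>"

fun coboundaries ::
  "'s ring \<Rightarrow> ('s, 'x) module \<Rightarrow> (nat \<Rightarrow> ('s, 'e) module) \<Rightarrow> (nat \<Rightarrow> 'e \<Rightarrow> 'e) \<Rightarrow> nat \<Rightarrow> ('x \<Rightarrow> 'e) set" where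
  "coboundaries S X E d 0 = {\<one>\<^bsub>hom_group S X (E 0)\<^esub>}"
| "coboundaries S X E d (Suc i) = compose (carrier X) (d i) ` module_hom S X (E i)"

definition Ext ::
  "'s ring \<Rightarrow> nat \<Rightarrow> ('s, 'x) module \<Rightarrow> ('s, 'y) module \<Rightarrow> ('x \<Rightarrow> ('s, 'y) universe) set monoid" where
  "Ext S i X Y =
    (let (E, \<epsilon>, d) = (SOME (E, \<epsilon>, d). injective_resolution S Y E \<epsilon> d)
     in cocycles S X E d i Mod coboundaries S X E d i)"

end

theory Submission
  imports Defs "HOL-Algebra.IntRing"
begin

text \<open>Let \<open>\<pi> : S \<rightarrow> R\<close> be a surjective ring homomorphism with nilpotent kernel \<open>J\<close>, and for an
  \<open>S\<close>-module \<open>E\<close> let \<open>K E = Hom(R, E)\<close> be the \<open>R\<close>-module of the elements annihilated by \<open>J\<close>. The functor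
  \<open>K\<close> preserves injectives, and if \<open>Ext\<^sup>i(R, Y) = 0\<close> for \<open>i \<ge> 1\<close>, it turns an injective resolution
  \<open>E\<close> of \<open>Y\<close> into one of \<open>K Y\<close>, with cosyzygies \<open>K Z\<^sub>k\<close> for the cosyzygies \<open>Z\<^sub>k\<close> of \<open>E\<close>. A module has
  injective dimension at most \<open>k\<close> if and only if the \<open>k\<close>-th cosyzygy of any of its injective
  resolutions is injective, so it remains to see that \<open>Z\<^sub>k\<close> is injective if \<open>K Z\<^sub>k\<close> is.
  Let \<open>h\<close> be a homomorphism from a left ideal \<open>A\<close> to \<open>Z\<^sub>k\<close>, and \<open>B\<close> the left ideal of all \<open>b\<close> with
  \<open>J b \<subseteq> A\<close>. An extension of \<open>h\<close> to \<open>B\<close> with values in \<open>E\<^sub>k\<close> has its differential in \<open>K Z\<^sub>k\<^sub>+\<^sub>1\<close>, and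
  since \<open>K E\<^sub>k \<rightarrow> K Z\<^sub>k\<^sub>+\<^sub>1\<close> splits, it can be corrected to have values in \<open>Z\<^sub>k\<close>. As \<open>J\<close> is nilpotent,
  finitely many such steps reach \<open>S\<close>.\<close>

section \<open>Linear maps and submodules\<close>

text \<open>The obstacle is that the notions involved are tied to different types.
  \<open>inj_dim\<close> over the trivial extension and over \<open>R\<close> quantify over
  resolutions on two different universes, \<open>Ext\<close> is computed from one resolution picked
  by choice, and the annihilated elements of that resolution do not lie on the universe belonging to
  \<open>R\<close>. Hence injectivity is rewritten by Baer's criterion, and two resolutions of a
  module on arbitrary types are compared directly: each \<open>k\<close>-th cosyzygy is a direct
  summand of the other plus an injective module. No long exact sequence is used; the Ext hypothesis
  enters only as exactness of the complex of annihilated elements in positive degrees, because a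
  homomorphism from \<open>R\<close> is determined by its value at 1. The nilpotency comes from the
  grading: the kernel of the augmentation raises degrees, and nothing is left beyond degree
  \<open>n\<close>. Since \<open>n\<close> is at least 1, the elements \<open>(0, m, 0, ...)\<close>
  are available, and they show that an element of \<open>[Y, g]\<close> annihilated by that kernel
  lies in \<open>ker g\<close>.\<close>

lemma (in abelian_group) diff_eq_zero_iff:
  assumes "x \<in> carrier G" "y \<in> carrier G"
  shows "x \<ominus> y = \<zero> \<longleftrightarrow> x = y"
proof
  assume "x \<ominus> y = \<zero>"
  then have "\<ominus> (\<ominus> y) = x" using assms by (intro minus_equality) (auto simp: a_minus_def)
  then show "x = y" using assms by simp
qed (use assms in \<open>simp add: a_minus_def r_neg\<close>)

lemma left_moduleI:
  fixes S (structure) and X (structure)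
  assumes "ring S"
    and "\<And>x y. \<lbrakk>x \<in> carrier X; y \<in> carrier X\<rbrakk> \<Longrightarrow> x \<oplus>\<^bsub>X\<^esub> y \<in> carrier X"
    and "\<zero>\<^bsub>X\<^esub> \<in> carrier X"
    and "\<And>x y z. \<lbrakk>x \<in> carrier X; y \<in> carrier X; z \<in> carrier X\<rbrakk> \<Longrightarrow> (x \<oplus>\<^bsub>X\<^esub> y) \<oplus>\<^bsub>X\<^esub> z = x \<oplus>\<^bsub>X\<^esub> (y \<oplus>\<^bsub>X\<^esub> z)"
    and "\<And>x y. \<lbrakk>x \<in> carrier X; y \<in> carrier X\<rbrakk> \<Longrightarrow> x \<oplus>\<^bsub>X\<^esub> y = y \<oplus>\<^bsub>X\<^esub> x"
    and "\<And>x. x \<in> carrier X \<Longrightarrow> \<zero>\<^bsub>X\<^esub> \<oplus>\<^bsub>X\<^esub> x = x"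
    and "\<And>x. x \<in> carrier X \<Longrightarrow> \<exists>y\<in>carrier X. y \<oplus>\<^bsub>X\<^esub> x = \<zero>\<^bsub>X\<^esub>"
    and "\<And>r x. \<lbrakk>r \<in> carrier S; x \<in> carrier X\<rbrakk> \<Longrightarrow> r \<odot>\<^bsub>X\<^esub> x \<in> carrier X"
    and "\<And>r s x. \<lbrakk>r \<in> carrier S; s \<in> carrier S; x \<in> carrier X\<rbrakk> \<Longrightarrow> (r \<oplus>\<^bsub>S\<^esub> s) \<odot>\<^bsub>X\<^esub> x = (r \<odot>\<^bsub>X\<^esub> x) \<oplus>\<^bsub>X\<^esub> (s \<odot>\<^bsub>X\<^esub> x)"
    and "\<And>r x y. \<lbrakk>r \<in> carrier S; x \<in> carrier X; y \<in> carrier X\<rbrakk> \<Longrightarrow> r \<odot>\<^bsub>X\<^esub> (x \<oplus>\<^bsub>X\<^esub> y) = (r \<odot>\<^bsub>X\<^esub> x) \<oplus>\<^bsub>X\<^esub> (r \<odot>\<^bsub>X\<^esub> y)"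
    and "\<And>r s x. \<lbrakk>r \<in> carrier S; s \<in> carrier S; x \<in> carrier X\<rbrakk> \<Longrightarrow> (r \<otimes>\<^bsub>S\<^esub> s) \<odot>\<^bsub>X\<^esub> x = r \<odot>\<^bsub>X\<^esub> (s \<odot>\<^bsub>X\<^esub> x)"
    and "\<And>x. x \<in> carrier X \<Longrightarrow> \<one>\<^bsub>S\<^esub> \<odot>\<^bsub>X\<^esub> x = x"
  shows "left_module S X"
  by (intro left_module.intro abelian_groupI left_module_axioms.intro) (assumption | rule assms)+

text \<open>The axioms are equations and the existence of negatives, so they pass along
  \<open>f\<close> onto its image without prior knowledge of \<open>Y\<close>. Quotients and
  transported structures are checked this way, since their operations are defined through chosen
  preimages.\<close>

lemma left_module_image:
  assumes X: "left_module S X"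
    and car: "carrier Y = f ` carrier X" and zero: "f \<zero>\<^bsub>X\<^esub> = \<zero>\<^bsub>Y\<^esub>"
    and add: "\<And>x x'. \<lbrakk>x \<in> carrier X; x' \<in> carrier X\<rbrakk> \<Longrightarrow> f (x \<oplus>\<^bsub>X\<^esub> x') = f x \<oplus>\<^bsub>Y\<^esub> f x'"
    and smult: "\<And>r x. \<lbrakk>r \<in> carrier S; x \<in> carrier X\<rbrakk> \<Longrightarrow> f (r \<odot>\<^bsub>X\<^esub> x) = r \<odot>\<^bsub>Y\<^esub> f x"
  shows "left_module S Y"
proof -
  interpret X: left_module S X by (rule X)
  show ?thesis
  proof (rule left_moduleI)
    show "ring S" by (rule X.R.ring_axioms)
    show "\<zero>\<^bsub>Y\<^esub> \<in> carrier Y" unfolding car zero[symmetric] by simp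
    show "\<exists>y\<in>carrier Y. y \<oplus>\<^bsub>Y\<^esub> x = \<zero>\<^bsub>Y\<^esub>" if "x \<in> carrier Y" for x
    proof -
      obtain x' where "x' \<in> carrier X" "x = f x'" using \<open>x \<in> carrier Y\<close> by (auto simp: car)
      then show ?thesis
        by (intro bexI[of _ "f (\<ominus>\<^bsub>X\<^esub> x')"]) (auto simp: car X.X.l_neg simp flip: zero add)
    qed
  next
    fix x y z assume "x \<in> carrier Y" "y \<in> carrier Y" "z \<in> carrier Y"
    then show "x \<oplus>\<^bsub>Y\<^esub> y \<oplus>\<^bsub>Y\<^esub> z = x \<oplus>\<^bsub>Y\<^esub> (y \<oplus>\<^bsub>Y\<^esub> z)"
      by (auto simp: car X.X.a_assoc simp flip: add)
  next
    fix x y assume "x \<in> carrier Y" "y \<in> carrier Y"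
    then show "x \<oplus>\<^bsub>Y\<^esub> y = y \<oplus>\<^bsub>Y\<^esub> x"
      by (auto simp: car X.X.a_comm simp flip: add)
  next
    fix x assume "x \<in> carrier Y"
    then show "\<zero>\<^bsub>Y\<^esub> \<oplus>\<^bsub>Y\<^esub> x = x" "\<one>\<^bsub>S\<^esub> \<odot>\<^bsub>Y\<^esub> x = x"
      by (auto simp: car X.smult_one simp flip: zero add smult)
  next
    fix x y assume "x \<in> carrier Y" "y \<in> carrier Y"
    then show "x \<oplus>\<^bsub>Y\<^esub> y \<in> carrier Y"
      by (auto simp: car simp flip: add)
  next
    fix r x assume "r \<in> carrier S" "x \<in> carrier Y"
    then show "r \<odot>\<^bsub>Y\<^esub> x \<in> carrier Y"
      by (auto simp: car X.smult_closed simp flip: smult)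
  next
    fix r s x assume "r \<in> carrier S" "s \<in> carrier S" "x \<in> carrier Y"
    then show "(r \<oplus>\<^bsub>S\<^esub> s) \<odot>\<^bsub>Y\<^esub> x = (r \<odot>\<^bsub>Y\<^esub> x) \<oplus>\<^bsub>Y\<^esub> (s \<odot>\<^bsub>Y\<^esub> x)"
      "(r \<otimes>\<^bsub>S\<^esub> s) \<odot>\<^bsub>Y\<^esub> x = r \<odot>\<^bsub>Y\<^esub> (s \<odot>\<^bsub>Y\<^esub> x)"
      by (auto simp: car X.smult_closed X.smult_l_distr X.smult_assoc simp flip: smult add)
  next
    fix r x y assume "r \<in> carrier S" "x \<in> carrier Y" "y \<in> carrier Y"
    then show "r \<odot>\<^bsub>Y\<^esub> (x \<oplus>\<^bsub>Y\<^esub> y) = (r \<odot>\<^bsub>Y\<^esub> x) \<oplus>\<^bsub>Y\<^esub> (r \<odot>\<^bsub>Y\<^esub> y)"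
      by (auto simp: car X.smult_closed X.smult_r_distr simp flip: smult add)
  qed
qed

text \<open>Kept apart from \<open>lin_map\<close> because the products of tensor powers and their
  actions, taken as maps in the second argument, preserve sums but in general not left
  scalars.\<close>

definition additive :: "('x, 'c) ring_scheme \<Rightarrow> ('y, 'd) ring_scheme \<Rightarrow> ('x \<Rightarrow> 'y) \<Rightarrow> bool" where
  "additive X Y h \<longleftrightarrow> (\<forall>x\<in>carrier X. h x \<in> carrier Y) \<and>
     (\<forall>x\<in>carrier X. \<forall>y\<in>carrier X. h (x \<oplus>\<^bsub>X\<^esub> y) = h x \<oplus>\<^bsub>Y\<^esub> h y)"

lemma left_module_group: "left_module R X \<Longrightarrow> abelian_group X"
  by (rule left_module.axioms)

lemma additive_closed: "\<lbrakk>additive X Y h; x \<in> carrier X\<rbrakk> \<Longrightarrow> h x \<in> carrier Y"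
  and additive_add: "\<lbrakk>additive X Y h; x \<in> carrier X; y \<in> carrier X\<rbrakk> \<Longrightarrow> h (x \<oplus>\<^bsub>X\<^esub> y) = h x \<oplus>\<^bsub>Y\<^esub> h y"
  by (auto simp: additive_def)

lemma additive_zero:
  assumes X: "abelian_group X" and Y: "abelian_group Y" and h: "additive X Y h"
  shows "h \<zero>\<^bsub>X\<^esub> = \<zero>\<^bsub>Y\<^esub>"
proof -
  interpret X: abelian_group X by (rule X)
  interpret Y: abelian_group Y by (rule Y)
  have "h \<zero>\<^bsub>X\<^esub> \<oplus>\<^bsub>Y\<^esub> h \<zero>\<^bsub>X\<^esub> = h \<zero>\<^bsub>X\<^esub>" using additive_add[OF h, of "\<zero>\<^bsub>X\<^esub>" "\<zero>\<^bsub>X\<^esub>"] by simp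
  then show ?thesis using additive_closed[OF h, of "\<zero>\<^bsub>X\<^esub>"] by simp
qed

lemma additive_diff:
  assumes X: "abelian_group X" and Y: "abelian_group Y" and h: "additive X Y h"
    and xy: "x \<in> carrier X" "y \<in> carrier X"
  shows "h (x \<ominus>\<^bsub>X\<^esub> y) = h x \<ominus>\<^bsub>Y\<^esub> h y"
proof -
  interpret X: abelian_group X by (rule X)
  interpret Y: abelian_group Y by (rule Y)
  have "h (\<ominus>\<^bsub>X\<^esub> y) \<oplus>\<^bsub>Y\<^esub> h y = \<zero>\<^bsub>Y\<^esub>"
    using additive_add[OF h, of "\<ominus>\<^bsub>X\<^esub> y" y] additive_zero[OF X Y h] xy by (simp add: X.l_neg)
  then have "\<ominus>\<^bsub>Y\<^esub> h y = h (\<ominus>\<^bsub>X\<^esub> y)" using xy additive_closed[OF h] by (intro Y.minus_equality) auto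
  then show ?thesis using xy additive_add[OF h, of x "\<ominus>\<^bsub>X\<^esub> y"] by (simp add: a_minus_def)
qed

definition submod :: "('s, 'c) ring_scheme \<Rightarrow> ('s, 'x, 'd) module_scheme \<Rightarrow> 'x set \<Rightarrow> bool" where
  "submod S X A \<longleftrightarrow> A \<subseteq> carrier X \<and> \<zero>\<^bsub>X\<^esub> \<in> A \<and> (\<forall>x\<in>A. \<forall>y\<in>A. x \<oplus>\<^bsub>X\<^esub> y \<in> A) \<and>
     (\<forall>r\<in>carrier S. \<forall>x\<in>A. r \<odot>\<^bsub>X\<^esub> x \<in> A)"

text \<open>\<open>module_hom\<close> without extensionality: composites and restrictions to
  submodules remain of this kind with no \<open>restrict\<close> in between.\<close>

definition lin_map ::
  "('s, 'c) ring_scheme \<Rightarrow> ('s, 'x, 'd) module_scheme \<Rightarrow> ('s, 'y, 'e) module_scheme \<Rightarrow> ('x \<Rightarrow> 'y) \<Rightarrow> bool" where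
  "lin_map S X Y f \<longleftrightarrow> (\<forall>x\<in>carrier X. f x \<in> carrier Y) \<and>
     (\<forall>x\<in>carrier X. \<forall>x'\<in>carrier X. f (x \<oplus>\<^bsub>X\<^esub> x') = f x \<oplus>\<^bsub>Y\<^esub> f x') \<and>
     (\<forall>r\<in>carrier S. \<forall>x\<in>carrier X. f (r \<odot>\<^bsub>X\<^esub> x) = r \<odot>\<^bsub>Y\<^esub> f x)"

lemma module_hom_iff: "f \<in> module_hom S X Y \<longleftrightarrow> lin_map S X Y f \<and> f \<in> extensional (carrier X)"
  by (auto simp: module_hom_def lin_map_def PiE_def)

context left_module begin

lemma smult_zero_l [simp]:
  assumes "x \<in> carrier X" shows "\<zero>\<^bsub>R\<^esub> \<odot>\<^bsub>X\<^esub> x = \<zero>\<^bsub>X\<^esub>"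
proof -
  have "\<zero>\<^bsub>R\<^esub> \<odot>\<^bsub>X\<^esub> x \<oplus>\<^bsub>X\<^esub> \<zero>\<^bsub>R\<^esub> \<odot>\<^bsub>X\<^esub> x = \<zero>\<^bsub>R\<^esub> \<odot>\<^bsub>X\<^esub> x"
    using smult_l_distr[of "\<zero>\<^bsub>R\<^esub>" "\<zero>\<^bsub>R\<^esub>" x] assms by simp
  then show ?thesis using smult_closed[of "\<zero>\<^bsub>R\<^esub>" x] assms by simp
qed

lemma smult_zero_r [simp]:
  assumes "r \<in> carrier R" shows "r \<odot>\<^bsub>X\<^esub> \<zero>\<^bsub>X\<^esub> = \<zero>\<^bsub>X\<^esub>"
proof -
  have "r \<odot>\<^bsub>X\<^esub> \<zero>\<^bsub>X\<^esub> \<oplus>\<^bsub>X\<^esub> r \<odot>\<^bsub>X\<^esub> \<zero>\<^bsub>X\<^esub> = r \<odot>\<^bsub>X\<^esub> \<zero>\<^bsub>X\<^esub>"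
    using smult_r_distr[of r "\<zero>\<^bsub>X\<^esub>" "\<zero>\<^bsub>X\<^esub>"] assms by simp
  then show ?thesis using smult_closed[of r "\<zero>\<^bsub>X\<^esub>"] assms by simp
qed

lemma smult_minus_l:
  assumes "r \<in> carrier R" "x \<in> carrier X" shows "(\<ominus>\<^bsub>R\<^esub> r) \<odot>\<^bsub>X\<^esub> x = \<ominus>\<^bsub>X\<^esub> (r \<odot>\<^bsub>X\<^esub> x)"
  using smult_l_distr[of "\<ominus>\<^bsub>R\<^esub> r" r x] assms
  by (simp add: R.l_neg smult_closed X.minus_equality)

lemma smult_minus_r:
  assumes "r \<in> carrier R" "x \<in> carrier X" shows "r \<odot>\<^bsub>X\<^esub> (\<ominus>\<^bsub>X\<^esub> x) = \<ominus>\<^bsub>X\<^esub> (r \<odot>\<^bsub>X\<^esub> x)"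
  using smult_r_distr[of r "\<ominus>\<^bsub>X\<^esub> x" x] assms
  by (simp add: X.l_neg smult_closed X.minus_equality)

text \<open>Negation is the action of the scalar -1.\<close>

lemma submod_minus:
  assumes "submod R X A" "x \<in> A" shows "\<ominus>\<^bsub>X\<^esub> x \<in> A"
proof -
  have x: "x \<in> carrier X" using assms by (auto simp: submod_def)
  have "(\<ominus>\<^bsub>R\<^esub> \<one>\<^bsub>R\<^esub>) \<odot>\<^bsub>X\<^esub> x \<in> A" using assms by (auto simp: submod_def)
  then show ?thesis using x by (simp add: smult_minus_l smult_one)
qed

lemma submod_diff: "\<lbrakk>submod R X A; x \<in> A; y \<in> A\<rbrakk> \<Longrightarrow> x \<ominus>\<^bsub>X\<^esub> y \<in> A"
  using submod_minus[of A y] by (auto simp: submod_def a_minus_def)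

lemma left_module_submod:
  assumes A: "submod R X A"
  shows "left_module R (X\<lparr>carrier := A\<rparr>)"
proof -
  have A': "\<And>x. x \<in> A \<Longrightarrow> x \<in> carrier X" using A by (auto simp: submod_def)
  have "\<exists>y\<in>A. y \<oplus>\<^bsub>X\<^esub> x = \<zero>\<^bsub>X\<^esub>" if "x \<in> A" for x
    using submod_minus[OF A that] X.l_neg A' that by blast
  then show ?thesis
    using A A' R.ring_axioms
    by (intro left_moduleI)
       (simp_all add: submod_def X.a_ac smult_closed smult_l_distr smult_r_distr smult_assoc smult_one)
qed

lemma submod_carrier: "submod R X (carrier X)"
  by (auto simp: submod_def smult_closed)

lemma submod_zero: "submod R X {\<zero>\<^bsub>X\<^esub>}"
  by (auto simp: submod_def)

end

lemma left_module_regular: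
  assumes "ring S" shows "left_module S (regular_module S)"
proof -
  interpret ring S by fact
  have "\<exists>y\<in>carrier S. y \<oplus>\<^bsub>S\<^esub> x = \<zero>\<^bsub>S\<^esub>" if "x \<in> carrier S" for x
    using that l_neg by blast
  then show ?thesis
    by (intro left_moduleI)
       (simp_all add: regular_module_def ring_axioms a_ac l_distr r_distr m_assoc)
qed

context
  fixes S X Y f
  assumes X: "left_module S X" and Y: "left_module S Y" and f: "lin_map S X Y f"
begin

interpretation X: left_module S X by (rule X)
interpretation Y: left_module S Y by (rule Y)

lemma lin_closed: "x \<in> carrier X \<Longrightarrow> f x \<in> carrier Y"
  and lin_add: "x \<in> carrier X \<Longrightarrow> x' \<in> carrier X \<Longrightarrow> f (x \<oplus>\<^bsub>X\<^esub> x') = f x \<oplus>\<^bsub>Y\<^esub> f x'"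
  and lin_smult: "r \<in> carrier S \<Longrightarrow> x \<in> carrier X \<Longrightarrow> f (r \<odot>\<^bsub>X\<^esub> x) = r \<odot>\<^bsub>Y\<^esub> f x"
  using f by (auto simp: lin_map_def)

lemma lin_additive: "additive X Y f"
  using f by (simp add: lin_map_def additive_def)

lemma lin_zero: "f \<zero>\<^bsub>X\<^esub> = \<zero>\<^bsub>Y\<^esub>"
  by (rule additive_zero[OF X.X.abelian_group_axioms Y.X.abelian_group_axioms lin_additive])

lemma lin_diff: "x \<in> carrier X \<Longrightarrow> x' \<in> carrier X \<Longrightarrow> f (x \<ominus>\<^bsub>X\<^esub> x') = f x \<ominus>\<^bsub>Y\<^esub> f x'"
  by (rule additive_diff[OF X.X.abelian_group_axioms Y.X.abelian_group_axioms lin_additive])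

lemma lin_inj: "inj_on f (carrier X) \<longleftrightarrow> (\<forall>x\<in>carrier X. f x = \<zero>\<^bsub>Y\<^esub> \<longrightarrow> x = \<zero>\<^bsub>X\<^esub>)"
proof
  assume "inj_on f (carrier X)"
  then show "\<forall>x\<in>carrier X. f x = \<zero>\<^bsub>Y\<^esub> \<longrightarrow> x = \<zero>\<^bsub>X\<^esub>"
    using lin_zero by (metis X.X.zero_closed inj_onD)
next
  assume *: "\<forall>x\<in>carrier X. f x = \<zero>\<^bsub>Y\<^esub> \<longrightarrow> x = \<zero>\<^bsub>X\<^esub>"
  show "inj_on f (carrier X)"
  proof (rule inj_onI)
    fix x y assume xy: "x \<in> carrier X" "y \<in> carrier X" "f x = f y"
    then have "f (x \<ominus>\<^bsub>X\<^esub> y) = \<zero>\<^bsub>Y\<^esub>"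
      using lin_diff[of x y] by (simp add: lin_closed Y.X.r_neg a_minus_def)
    then have "x \<ominus>\<^bsub>X\<^esub> y = \<zero>\<^bsub>X\<^esub>" using * xy by blast
    then show "x = y" using xy by (simp add: X.X.diff_eq_zero_iff)
  qed
qed

lemma submod_kernel: "submod S X {x \<in> carrier X. f x = \<zero>\<^bsub>Y\<^esub>}"
  by (auto simp: submod_def lin_zero lin_add lin_smult X.smult_closed)

lemma submod_image: "submod S Y (f ` carrier X)"
  by (auto simp: submod_def lin_closed X.smult_closed simp flip: lin_zero lin_add lin_smult intro!: imageI)

end

lemma lin_compose: "lin_map S X Y f \<Longrightarrow> lin_map S Y Z g \<Longrightarrow> lin_map S X Z (\<lambda>x. g (f x))"
  by (auto simp: lin_map_def)

lemma lin_zero_map: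
  assumes "left_module S Y" shows "lin_map S X Y (\<lambda>_. \<zero>\<^bsub>Y\<^esub>)"
proof -
  interpret left_module S Y by fact
  show ?thesis by (simp add: lin_map_def)
qed

lemma lin_restrict [simp]:
  "left_module S X \<Longrightarrow> restrict f (carrier X) \<in> module_hom S X Y \<longleftrightarrow> lin_map S X Y f"
  by (auto simp: module_hom_iff lin_map_def left_module.smult_closed abelian_monoid.a_closed
    left_module.axioms abelian_group.axioms)

section \<open>Quotients and Baer's criterion\<close>

lemma (in abelian_group) add_diff_add:
  "\<lbrakk>x \<in> carrier G; y \<in> carrier G; x' \<in> carrier G; y' \<in> carrier G\<rbrakk> \<Longrightarrow>
    (x \<oplus> y) \<ominus> (x' \<oplus> y') = (x \<ominus> x') \<oplus> (y \<ominus> y')"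
  by (simp add: a_minus_def minus_add a_ac)

lemma (in abelian_group) diff_diff_cancel:
  assumes "x \<in> carrier G" "y \<in> carrier G" "z \<in> carrier G"
  shows "(x \<ominus> y) \<ominus> (z \<ominus> y) = x \<ominus> z"
proof -
  have "(x \<ominus> y) \<ominus> (z \<ominus> y) = (x \<ominus> z) \<oplus> (y \<ominus> y)"
    using assms by (simp add: a_minus_def minus_add a_ac)
  then show ?thesis using assms by (simp add: a_minus_def r_neg)
qed

lemma (in abelian_group) diff_add_cancel:
  assumes "x \<in> carrier G" "y \<in> carrier G"
  shows "(x \<ominus> y) \<oplus> y = x" "y \<oplus> (x \<ominus> y) = x"
  using assms by (simp_all add: a_minus_def a_assoc l_neg a_comm[of y] )

lemma (in left_module) smult_diff:
  "\<lbrakk>r \<in> carrier R; x \<in> carrier X; y \<in> carrier X\<rbrakk> \<Longrightarrow> r \<odot>\<^bsub>X\<^esub> (x \<ominus>\<^bsub>X\<^esub> y) = r \<odot>\<^bsub>X\<^esub> x \<ominus>\<^bsub>X\<^esub> r \<odot>\<^bsub>X\<^esub> y"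
  by (simp add: a_minus_def smult_r_distr smult_minus_r)

lemma submodD:
  assumes "submod S X A"
  shows "A \<subseteq> carrier X" "\<And>x. x \<in> A \<Longrightarrow> x \<in> carrier X" "\<zero>\<^bsub>X\<^esub> \<in> A" "\<And>x y. \<lbrakk>x \<in> A; y \<in> A\<rbrakk> \<Longrightarrow> x \<oplus>\<^bsub>X\<^esub> y \<in> A"
    "\<And>r x. \<lbrakk>r \<in> carrier S; x \<in> A\<rbrakk> \<Longrightarrow> r \<odot>\<^bsub>X\<^esub> x \<in> A"
  using assms by (auto simp: submod_def)

text \<open>Cosets would raise the type at each use. Here every coset is represented by a chosen
  element, coded by \<open>c\<close> into a prescribed type; with the identity as \<open>c\<close>
  the quotient stays on the type of \<open>X\<close>, which lets a resolution be built on one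
  type.\<close>

lemma exists_quotient:
  fixes X :: "('s, 'x, 'd) module_scheme" and c :: "'x \<Rightarrow> 'z"
  assumes X: "left_module S X" and H: "submod S X H" and c: "inj_on c (carrier X)"
  obtains Q :: "('s, 'z) module" and q where
    "left_module S Q" "lin_map S X Q q" "carrier Q = q ` carrier X"
    "\<And>x. x \<in> carrier X \<Longrightarrow> q x = \<zero>\<^bsub>Q\<^esub> \<longleftrightarrow> x \<in> H"
proof -
  interpret X: left_module S X by (rule X)
  note HD = submodD[OF H]
  \<comment> \<open>The chosen element depends only on the coset of \<open>x\<close>, since
    congruent elements satisfy the same predicate.\<close>
  define rep where "rep x = (SOME y. y \<in> carrier X \<and> y \<ominus>\<^bsub>X\<^esub> x \<in> H)" for x
  have rep: "rep x \<in> carrier X" "rep x \<ominus>\<^bsub>X\<^esub> x \<in> H" if "x \<in> carrier X" for x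
  proof -
    have "x \<in> carrier X \<and> x \<ominus>\<^bsub>X\<^esub> x \<in> H" using that HD by (simp add: X.X.diff_eq_zero_iff[THEN iffD2])
    then have "rep x \<in> carrier X \<and> rep x \<ominus>\<^bsub>X\<^esub> x \<in> H" unfolding rep_def by (rule someI)
    then show "rep x \<in> carrier X" "rep x \<ominus>\<^bsub>X\<^esub> x \<in> H" by auto
  qed
  have swap: "y \<ominus>\<^bsub>X\<^esub> x \<in> H" if "x \<ominus>\<^bsub>X\<^esub> y \<in> H" "x \<in> carrier X" "y \<in> carrier X" for x y
  proof -
    have "\<ominus>\<^bsub>X\<^esub> (x \<ominus>\<^bsub>X\<^esub> y) = y \<ominus>\<^bsub>X\<^esub> x" using that by (simp add: a_minus_def X.X.minus_add X.X.a_comm)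
    then show ?thesis using X.submod_minus[OF H that(1)] by simp
  qed
  have tr: "x \<ominus>\<^bsub>X\<^esub> z \<in> H" if "x \<ominus>\<^bsub>X\<^esub> y \<in> H" "z \<ominus>\<^bsub>X\<^esub> y \<in> H" "x \<in> carrier X" "y \<in> carrier X" "z \<in> carrier X" for x y z
    using X.submod_diff[OF H that(1,2)] that by (simp add: X.X.diff_diff_cancel)
  have rep_eq: "rep x = rep y \<longleftrightarrow> x \<ominus>\<^bsub>X\<^esub> y \<in> H" if xy: "x \<in> carrier X" "y \<in> carrier X" for x y
  proof
    assume eq: "rep x = rep y"
    show "x \<ominus>\<^bsub>X\<^esub> y \<in> H"
      using tr[of x "rep x" y] swap[OF rep(2)] rep xy eq by metis
  next
    assume H': "x \<ominus>\<^bsub>X\<^esub> y \<in> H"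
    have "z \<ominus>\<^bsub>X\<^esub> x \<in> H \<longleftrightarrow> z \<ominus>\<^bsub>X\<^esub> y \<in> H" if "z \<in> carrier X" for z
      using that xy H' tr[of z x y] tr[of z y x] swap[of x y] by blast
    then have "(\<lambda>z. z \<in> carrier X \<and> z \<ominus>\<^bsub>X\<^esub> x \<in> H) = (\<lambda>z. z \<in> carrier X \<and> z \<ominus>\<^bsub>X\<^esub> y \<in> H)" by auto
    then show "rep x = rep y" unfolding rep_def by simp
  qed
  define q where "q x = c (rep x)" for x
  define u where "u = inv_into (carrier X) c"
  have uq: "u (q x) = rep x" if "x \<in> carrier X" for x
    using that c rep by (simp add: u_def q_def)
  have q_eq: "q x = q y \<longleftrightarrow> x \<ominus>\<^bsub>X\<^esub> y \<in> H" if "x \<in> carrier X" "y \<in> carrier X" for x y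
    using that rep_eq inj_on_eq_iff[OF c rep(1) rep(1)] by (simp add: q_def)
  define Q :: "('s, 'z) module" where
    "Q = \<lparr>carrier = q ` carrier X, monoid.mult = undefined, one = undefined, ring.zero = q \<zero>\<^bsub>X\<^esub>,
          ring.add = (\<lambda>x y. q (u x \<oplus>\<^bsub>X\<^esub> u y)), smult = (\<lambda>r x. q (r \<odot>\<^bsub>X\<^esub> u x))\<rparr>"
  have add: "q (x \<oplus>\<^bsub>X\<^esub> y) = q x \<oplus>\<^bsub>Q\<^esub> q y" if "x \<in> carrier X" "y \<in> carrier X" for x y
  proof -
    have "(x \<oplus>\<^bsub>X\<^esub> y) \<ominus>\<^bsub>X\<^esub> (rep x \<oplus>\<^bsub>X\<^esub> rep y) \<in> H"
      using that rep swap[OF rep(2)] HD by (simp add: X.X.add_diff_add)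
    then show ?thesis using that rep by (simp add: Q_def uq q_eq)
  qed
  have smult: "q (r \<odot>\<^bsub>X\<^esub> x) = r \<odot>\<^bsub>Q\<^esub> q x" if "r \<in> carrier S" "x \<in> carrier X" for r x
  proof -
    have "r \<odot>\<^bsub>X\<^esub> x \<ominus>\<^bsub>X\<^esub> r \<odot>\<^bsub>X\<^esub> rep x \<in> H"
      using that rep swap[OF rep(2)] HD by (simp flip: X.smult_diff)
    then show ?thesis using that rep by (simp add: Q_def uq q_eq X.smult_closed)
  qed
  have car: "carrier Q = q ` carrier X" by (simp add: Q_def)
  have "left_module S Q"
    by (rule left_module_image[OF X car _ add smult]) (auto simp: Q_def)
  moreover have "lin_map S X Q q" using add smult by (auto simp: lin_map_def car)
  moreover have "q x = \<zero>\<^bsub>Q\<^esub> \<longleftrightarrow> x \<in> H" if "x \<in> carrier X" for x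
    using q_eq[of x "\<zero>\<^bsub>X\<^esub>"] X.X.diff_add_cancel(1)[of x "\<zero>\<^bsub>X\<^esub>"] that by (simp add: Q_def)
  ultimately show thesis using car that by blast
qed

text \<open>The quotient by the zero submodule is the module itself on the type of the codes;
  \<open>u\<close> undoes the coding.\<close>

lemma exists_copy:
  fixes X :: "('s, 'x, 'd) module_scheme" and c :: "'x \<Rightarrow> 'z"
  assumes X: "left_module S X" and c: "inj_on c (carrier X)"
  obtains X' :: "('s, 'z) module" and f u where
    "left_module S X'" "lin_map S X X' f" "lin_map S X' X u" "inj_on f (carrier X)"
    "\<And>x. x \<in> carrier X \<Longrightarrow> u (f x) = x" "\<And>x. x \<in> carrier X' \<Longrightarrow> f (u x) = x"
proof -
  interpret X: left_module S X by (rule X)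
  obtain Q :: "('s, 'z) module" and q where Q: "left_module S Q" and q: "lin_map S X Q q"
    and car: "carrier Q = q ` carrier X" and ker: "\<And>x. x \<in> carrier X \<Longrightarrow> q x = \<zero>\<^bsub>Q\<^esub> \<longleftrightarrow> x \<in> {\<zero>\<^bsub>X\<^esub>}"
    by (rule exists_quotient[OF X X.submod_zero c]) blast
  have inj: "inj_on q (carrier X)" using ker by (simp add: lin_inj[OF X Q q])
  define u where "u = inv_into (carrier X) q"
  have uq: "u (q x) = x" if "x \<in> carrier X" for x
    using that inj by (simp add: u_def)
  have "lin_map S Q X u"
    unfolding lin_map_def car
    by (auto simp: uq X.smult_closed simp flip: lin_add[OF X Q q] lin_smult[OF X Q q])
  moreover have "\<And>x. x \<in> carrier Q \<Longrightarrow> q (u x) = x" using uq by (auto simp: car)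
  ultimately show thesis using that[OF Q q _ inj uq] by blast
qed

section \<open>Injectivity tested on left ideals\<close>

lemma regular_module_simps [simp]:
  "carrier (regular_module S) = carrier S" "\<zero>\<^bsub>regular_module S\<^esub> = \<zero>\<^bsub>S\<^esub>"
  "x \<oplus>\<^bsub>regular_module S\<^esub> y = x \<oplus>\<^bsub>S\<^esub> y" "r \<odot>\<^bsub>regular_module S\<^esub> x = r \<otimes>\<^bsub>S\<^esub> x"
  by (simp_all add: regular_module_def)

text \<open>Baer's criterion involves no universe of modules. In this form injectivity can be compared
  between carriers on different types.\<close>

definition baer :: "'s ring \<Rightarrow> ('s, 'e, 'd) module_scheme \<Rightarrow> bool" where
  "baer S E \<longleftrightarrow> left_module S E \<and>
     (\<forall>I h. submod S (regular_module S) I \<and> lin_map S (regular_module S\<lparr>carrier := I\<rparr>) E h \<longrightarrow>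
       (\<exists>e\<in>carrier E. \<forall>x\<in>I. h x = x \<odot>\<^bsub>E\<^esub> e))"

text \<open>Zorn's lemma on partial extensions of \<open>h\<close> along \<open>f\<close>, given by
  their graphs in the product of \<open>B\<close> and \<open>E\<close>, so that the union of a chain
  is again a candidate. All types are independent, in contrast to \<open>injective_module\<close>,
  which tests modules on one universe.\<close>

lemma baer_extend:
  assumes E: "baer S E" and A: "left_module S A" and B: "left_module S B"
    and f: "lin_map S A B f" and inj: "inj_on f (carrier A)" and h: "lin_map S A E h"
  obtains k where "lin_map S B E k" "\<And>a. a \<in> carrier A \<Longrightarrow> k (f a) = h a"
proof -
  have E': "left_module S E" using E by (simp add: baer_def)
  interpret A: left_module S A by (rule A)
  interpret B: left_module S B by (rule B)
  interpret E: left_module S E by (rule E')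
  \<comment> \<open>For a graph closed under sums and scalars, being single-valued amounts to
    containing no pair \<open>(0, e)\<close> with \<open>e \<noteq> 0\<close>.\<close>
  define GG where "GG = {G. G \<subseteq> carrier B \<times> carrier E \<and>
      (\<forall>x e y e'. (x, e) \<in> G \<and> (y, e') \<in> G \<longrightarrow> (x \<oplus>\<^bsub>B\<^esub> y, e \<oplus>\<^bsub>E\<^esub> e') \<in> G) \<and>
      (\<forall>r\<in>carrier S. \<forall>x e. (x, e) \<in> G \<longrightarrow> (r \<odot>\<^bsub>B\<^esub> x, r \<odot>\<^bsub>E\<^esub> e) \<in> G) \<and>
      (\<forall>e. (\<zero>\<^bsub>B\<^esub>, e) \<in> G \<longrightarrow> e = \<zero>\<^bsub>E\<^esub>) \<and>
      (\<forall>a\<in>carrier A. (f a, h a) \<in> G)}"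
  have GGI: "G \<in> GG" if "G \<subseteq> carrier B \<times> carrier E"
      "\<And>x e y e'. \<lbrakk>(x, e) \<in> G; (y, e') \<in> G\<rbrakk> \<Longrightarrow> (x \<oplus>\<^bsub>B\<^esub> y, e \<oplus>\<^bsub>E\<^esub> e') \<in> G"
      "\<And>r x e. \<lbrakk>r \<in> carrier S; (x, e) \<in> G\<rbrakk> \<Longrightarrow> (r \<odot>\<^bsub>B\<^esub> x, r \<odot>\<^bsub>E\<^esub> e) \<in> G"
      "\<And>e. (\<zero>\<^bsub>B\<^esub>, e) \<in> G \<Longrightarrow> e = \<zero>\<^bsub>E\<^esub>"
      "\<And>a. a \<in> carrier A \<Longrightarrow> (f a, h a) \<in> G" for G
    unfolding GG_def using that by blast
  have "\<exists>M\<in>GG. \<forall>X\<in>GG. M \<subseteq> X \<longrightarrow> X = M"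
  proof (rule subset_Zorn_nonempty)
    have "(\<lambda>a. (f a, h a)) ` carrier A \<in> GG"
    proof (rule GGI)
      fix e assume "(\<zero>\<^bsub>B\<^esub>, e) \<in> (\<lambda>a. (f a, h a)) ` carrier A"
      then obtain a where a: "a \<in> carrier A" "f a = \<zero>\<^bsub>B\<^esub>" "e = h a" by force
      then have "a = \<zero>\<^bsub>A\<^esub>" using inj lin_inj[OF A B f] by blast
      then show "e = \<zero>\<^bsub>E\<^esub>" using a lin_zero[OF A E' h] by simp
    next
      fix x e y e' assume "(x, e) \<in> (\<lambda>a. (f a, h a)) ` carrier A" "(y, e') \<in> (\<lambda>a. (f a, h a)) ` carrier A"
      then obtain a b where ab: "a \<in> carrier A" "b \<in> carrier A" "x = f a" "e = h a" "y = f b" "e' = h b" by blast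
      show "(x \<oplus>\<^bsub>B\<^esub> y, e \<oplus>\<^bsub>E\<^esub> e') \<in> (\<lambda>a. (f a, h a)) ` carrier A"
        by (rule image_eqI[of _ _ "a \<oplus>\<^bsub>A\<^esub> b"]) (simp_all add: ab lin_add[OF A B f] lin_add[OF A E' h])
    next
      fix r x e assume r: "r \<in> carrier S" and "(x, e) \<in> (\<lambda>a. (f a, h a)) ` carrier A"
      then obtain a where a: "a \<in> carrier A" "x = f a" "e = h a" by blast
      show "(r \<odot>\<^bsub>B\<^esub> x, r \<odot>\<^bsub>E\<^esub> e) \<in> (\<lambda>a. (f a, h a)) ` carrier A"
        by (rule image_eqI[of _ _ "r \<odot>\<^bsub>A\<^esub> a"])
           (simp_all add: r a A.smult_closed lin_smult[OF A B f] lin_smult[OF A E' h])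
    qed (auto simp: lin_closed[OF A B f] lin_closed[OF A E' h])
    then show "GG \<noteq> {}" by auto
  next
    fix C assume C: "C \<noteq> {}" "subset.chain GG C"
    have CG: "\<And>G. G \<in> C \<Longrightarrow> G \<in> GG" using C by (auto simp: subset.chain_def)
    show "\<Union> C \<in> GG"
    proof (rule GGI)
      fix x e y e' assume "(x, e) \<in> \<Union> C" "(y, e') \<in> \<Union> C"
      then obtain G G' where G: "G \<in> C" "G' \<in> C" "(x, e) \<in> G" "(y, e') \<in> G'" by auto
      then have "G \<subseteq> G' \<or> G' \<subseteq> G" using C by (auto simp: subset.chain_def)
      then obtain G'' where "G'' \<in> C" "(x, e) \<in> G''" "(y, e') \<in> G''" using G by blast
      then show "(x \<oplus>\<^bsub>B\<^esub> y, e \<oplus>\<^bsub>E\<^esub> e') \<in> \<Union> C" using CG[of G''] unfolding GG_def by blast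
    next
      show "\<Union> C \<subseteq> carrier B \<times> carrier E" using CG unfolding GG_def by blast
    next
      fix r x e assume "r \<in> carrier S" "(x, e) \<in> \<Union> C"
      then obtain G where "G \<in> C" "(x, e) \<in> G" "r \<in> carrier S" by blast
      then show "(r \<odot>\<^bsub>B\<^esub> x, r \<odot>\<^bsub>E\<^esub> e) \<in> \<Union> C" using CG[of G] unfolding GG_def by blast
    next
      fix e assume "(\<zero>\<^bsub>B\<^esub>, e) \<in> \<Union> C"
      then obtain G where "G \<in> C" "(\<zero>\<^bsub>B\<^esub>, e) \<in> G" by blast
      then show "e = \<zero>\<^bsub>E\<^esub>" using CG[of G] unfolding GG_def by blast
    next
      fix a assume a: "a \<in> carrier A"
      obtain G where "G \<in> C" using C by blast
      then show "(f a, h a) \<in> \<Union> C" using CG[of G] a unfolding GG_def by blast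
    qed
  qed
  then obtain M where M: "M \<in> GG" and max: "\<And>X. X \<in> GG \<Longrightarrow> M \<subseteq> X \<Longrightarrow> X = M" by blast
  have Mc: "x \<in> carrier B" "e \<in> carrier E" if "(x, e) \<in> M" for x e using M that by (auto simp: GG_def)
  have Madd: "(x \<oplus>\<^bsub>B\<^esub> y, e \<oplus>\<^bsub>E\<^esub> e') \<in> M" if "(x, e) \<in> M" "(y, e') \<in> M" for x e y e'
    using M that by (auto simp: GG_def)
  have Msm: "(r \<odot>\<^bsub>B\<^esub> x, r \<odot>\<^bsub>E\<^esub> e) \<in> M" if "r \<in> carrier S" "(x, e) \<in> M" for r x e
    using M that by (auto simp: GG_def)
  have Mz: "e = \<zero>\<^bsub>E\<^esub>" if "(\<zero>\<^bsub>B\<^esub>, e) \<in> M" for e using M that by (auto simp: GG_def)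
  have Mf: "(f a, h a) \<in> M" if "a \<in> carrier A" for a using M that by (auto simp: GG_def)
  have M0: "(\<zero>\<^bsub>B\<^esub>, \<zero>\<^bsub>E\<^esub>) \<in> M" using Mf[of "\<zero>\<^bsub>A\<^esub>"] lin_zero[OF A B f] lin_zero[OF A E' h] by simp
  have Mfun: "e = e'" if 1: "(x, e) \<in> M" "(x, e') \<in> M" for x e e'
  proof -
    have "((\<ominus>\<^bsub>S\<^esub> \<one>\<^bsub>S\<^esub>) \<odot>\<^bsub>B\<^esub> x, (\<ominus>\<^bsub>S\<^esub> \<one>\<^bsub>S\<^esub>) \<odot>\<^bsub>E\<^esub> e') \<in> M" using Msm[OF _ 1(2)] by simp
    then have "(x \<oplus>\<^bsub>B\<^esub> (\<ominus>\<^bsub>B\<^esub> x), e \<oplus>\<^bsub>E\<^esub> (\<ominus>\<^bsub>E\<^esub> e')) \<in> M" using Madd[OF 1(1)] Mc 1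
      by (metis B.smult_minus_l A.R.one_closed B.smult_one E.smult_minus_l E.smult_one)
    then have "(\<zero>\<^bsub>B\<^esub>, e \<ominus>\<^bsub>E\<^esub> e') \<in> M" using Mc 1 by (simp add: B.X.r_neg a_minus_def)
    then show ?thesis using Mz[of "e \<ominus>\<^bsub>E\<^esub> e'"] Mc 1 E.X.diff_eq_zero_iff by blast
  qed
  have dom: "\<exists>e. (b, e) \<in> M" if b: "b \<in> carrier B" for b
  proof -
    \<comment> \<open>The scalars that carry \<open>b\<close> into the domain of the maximal graph
      form a left ideal, and \<open>t\<close> sends such a scalar \<open>s\<close> to the value
      prescribed at \<open>s b\<close>. Baer's criterion turns \<open>t\<close> into multiplication
      by some \<open>e0\<close>, the candidate value at \<open>b\<close>.\<close>
    define I where "I = {s \<in> carrier S. \<exists>e. (s \<odot>\<^bsub>B\<^esub> b, e) \<in> M}"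
    define t where "t s = (THE e. (s \<odot>\<^bsub>B\<^esub> b, e) \<in> M)" for s
    have t: "t s = e" if "(s \<odot>\<^bsub>B\<^esub> b, e) \<in> M" for s e unfolding t_def using that Mfun by blast
    have tM: "(s \<odot>\<^bsub>B\<^esub> b, t s) \<in> M" if "s \<in> I" for s using that t by (auto simp: I_def)
    have Iadd: "(s \<oplus>\<^bsub>S\<^esub> s') \<odot>\<^bsub>B\<^esub> b = s \<odot>\<^bsub>B\<^esub> b \<oplus>\<^bsub>B\<^esub> s' \<odot>\<^bsub>B\<^esub> b" if "s \<in> I" "s' \<in> I" for s s'
      using that b by (auto simp: I_def B.smult_l_distr)
    have Ism: "(r \<otimes>\<^bsub>S\<^esub> s) \<odot>\<^bsub>B\<^esub> b = r \<odot>\<^bsub>B\<^esub> (s \<odot>\<^bsub>B\<^esub> b)" if "r \<in> carrier S" "s \<in> I" for r s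
      using that b by (auto simp: I_def B.smult_assoc)
    have "submod S (regular_module S) I"
      unfolding submod_def using Iadd Ism Madd Msm M0 b
      by (auto simp: I_def B.smult_l_distr B.smult_assoc) metis+
    moreover have "lin_map S (regular_module S\<lparr>carrier := I\<rparr>) E t"
      unfolding lin_map_def using tM Mc(2) Madd[OF tM tM] Msm[OF _ tM]
      by (auto simp flip: Iadd Ism intro!: t)
    ultimately obtain e0 where e0: "e0 \<in> carrier E" "\<And>s. s \<in> I \<Longrightarrow> t s = s \<odot>\<^bsub>E\<^esub> e0"
      using E unfolding baer_def by blast
    define M' where "M' = {(x \<oplus>\<^bsub>B\<^esub> s \<odot>\<^bsub>B\<^esub> b, e \<oplus>\<^bsub>E\<^esub> s \<odot>\<^bsub>E\<^esub> e0) | x e s. (x, e) \<in> M \<and> s \<in> carrier S}"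
    have M'I: "p \<in> M'" if "p = (x \<oplus>\<^bsub>B\<^esub> s \<odot>\<^bsub>B\<^esub> b, e \<oplus>\<^bsub>E\<^esub> s \<odot>\<^bsub>E\<^esub> e0)" "(x, e) \<in> M" "s \<in> carrier S" for p x e s
      using that by (auto simp: M'_def)
    have MM': "M \<subseteq> M'"
    proof
      fix p assume p: "p \<in> M"
      then show "p \<in> M'" using b e0 Mc
        by (cases p) (auto intro!: M'I[of _ "fst p" "\<zero>\<^bsub>S\<^esub>" "snd p"] )
    qed
    have "M' \<in> GG"
    proof (rule GGI)
      show "M' \<subseteq> carrier B \<times> carrier E" using Mc b e0 by (auto simp: M'_def B.smult_closed E.smult_closed)
    next
      fix x e y e' assume "(x, e) \<in> M'" "(y, e') \<in> M'"
      then obtain x1 e1 s1 x2 e2 s2 where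
        1: "x = x1 \<oplus>\<^bsub>B\<^esub> s1 \<odot>\<^bsub>B\<^esub> b" "e = e1 \<oplus>\<^bsub>E\<^esub> s1 \<odot>\<^bsub>E\<^esub> e0" "(x1, e1) \<in> M" "s1 \<in> carrier S" and
        2: "y = x2 \<oplus>\<^bsub>B\<^esub> s2 \<odot>\<^bsub>B\<^esub> b" "e' = e2 \<oplus>\<^bsub>E\<^esub> s2 \<odot>\<^bsub>E\<^esub> e0" "(x2, e2) \<in> M" "s2 \<in> carrier S"
        by (auto simp: M'_def)
      show "(x \<oplus>\<^bsub>B\<^esub> y, e \<oplus>\<^bsub>E\<^esub> e') \<in> M'"
        by (rule M'I[of _ "x1 \<oplus>\<^bsub>B\<^esub> x2" "s1 \<oplus>\<^bsub>S\<^esub> s2" "e1 \<oplus>\<^bsub>E\<^esub> e2"])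
           (use 1 2 Mc b e0 Madd in \<open>simp_all add: B.smult_l_distr E.smult_l_distr B.smult_closed E.smult_closed B.X.a_ac E.X.a_ac\<close>)
    next
      fix r x e assume r: "r \<in> carrier S" and "(x, e) \<in> M'"
      then obtain x1 e1 s1 where
        1: "x = x1 \<oplus>\<^bsub>B\<^esub> s1 \<odot>\<^bsub>B\<^esub> b" "e = e1 \<oplus>\<^bsub>E\<^esub> s1 \<odot>\<^bsub>E\<^esub> e0" "(x1, e1) \<in> M" "s1 \<in> carrier S"
        by (auto simp: M'_def)
      show "(r \<odot>\<^bsub>B\<^esub> x, r \<odot>\<^bsub>E\<^esub> e) \<in> M'"
        by (rule M'I[of _ "r \<odot>\<^bsub>B\<^esub> x1" "r \<otimes>\<^bsub>S\<^esub> s1" "r \<odot>\<^bsub>E\<^esub> e1"])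
           (use 1 r Mc b e0 Msm in \<open>simp_all add: B.smult_r_distr E.smult_r_distr B.smult_assoc E.smult_assoc B.smult_closed E.smult_closed\<close>)
    next
      fix e assume "(\<zero>\<^bsub>B\<^esub>, e) \<in> M'"
      then obtain x1 e1 s where
        1: "x1 \<oplus>\<^bsub>B\<^esub> s \<odot>\<^bsub>B\<^esub> b = \<zero>\<^bsub>B\<^esub>" "e = e1 \<oplus>\<^bsub>E\<^esub> s \<odot>\<^bsub>E\<^esub> e0" "(x1, e1) \<in> M" "s \<in> carrier S"
        unfolding M'_def by force
      \<comment> \<open>From \<open>x1 + s b = 0\<close> it follows that \<open>s b = - x1\<close>
        lies in the domain, so \<open>s \<in> I\<close> and \<open>t s = s e0\<close>. Adding the
        two pairs of the old graph gives \<open>(0, e)\<close>.\<close>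
      have "s \<odot>\<^bsub>B\<^esub> b = (\<ominus>\<^bsub>S\<^esub> \<one>\<^bsub>S\<^esub>) \<odot>\<^bsub>B\<^esub> x1"
      proof -
        have "s \<odot>\<^bsub>B\<^esub> b \<oplus>\<^bsub>B\<^esub> x1 = \<zero>\<^bsub>B\<^esub>" using 1 Mc b by (simp add: B.X.a_comm B.smult_closed)
        then have "\<ominus>\<^bsub>B\<^esub> x1 = s \<odot>\<^bsub>B\<^esub> b" using 1 Mc b by (intro B.X.minus_equality) (auto simp: B.smult_closed)
        then show ?thesis using 1 Mc by (simp add: B.smult_minus_l B.smult_one)
      qed
      then have sI: "s \<in> I" using Msm[OF _ 1(3), of "\<ominus>\<^bsub>S\<^esub> \<one>\<^bsub>S\<^esub>"] 1(4) by (auto simp: I_def)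
      have "(\<zero>\<^bsub>B\<^esub>, e) \<in> M" using Madd[OF 1(3) tM[OF sI]] e0(2)[OF sI] 1 by simp
      then show "e = \<zero>\<^bsub>E\<^esub>" by (rule Mz)
    next
      fix a assume "a \<in> carrier A" then show "(f a, h a) \<in> M'" using Mf MM' by blast
    qed
    then have "M' = M" using max MM' by blast
    moreover have "(b, e0) \<in> M'"
      by (rule M'I[OF _ M0 A.R.one_closed]) (use b e0 in \<open>simp add: B.smult_one E.smult_one\<close>)
    ultimately show ?thesis by blast
  qed
  define k where "k b = (THE e. (b, e) \<in> M)" for b
  have k: "k b = e" if "(b, e) \<in> M" for b e unfolding k_def using that Mfun by blast
  have kM: "(b, k b) \<in> M" if "b \<in> carrier B" for b using dom[OF that] k by blast
  have "lin_map S B E k"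
    unfolding lin_map_def using Mc(2)[OF kM] k[OF Madd[OF kM kM]] k[OF Msm[OF _ kM]] by blast
  moreover have "\<And>a. a \<in> carrier A \<Longrightarrow> k (f a) = h a" using k Mf by blast
  ultimately show thesis using that by blast
qed

text \<open>From right to left this is \<open>baer_extend\<close>. For the converse the ring and a
  left ideal are first copied onto the universe, because only modules there are tested.\<close>

lemma injective_module_iff_baer: "injective_module S E \<longleftrightarrow> baer S E"
proof
  assume E: "baer S E"
  then have E': "left_module S E" by (simp add: baer_def)
  show "injective_module S E"
    unfolding injective_module_def
  proof (intro conjI allI ballI impI E')
    fix A B :: "('a, ('a, 'b) universe) module" and f h
    assume f: "f \<in> module_hom S A B" and h: "h \<in> module_hom S A E"
      and *: "left_module S A \<and> left_module S B \<and> inj_on f (carrier A)"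
    obtain k where "lin_map S B E k" "\<And>a. a \<in> carrier A \<Longrightarrow> k (f a) = h a"
      using baer_extend[OF E, of A B f h] * f h by (auto simp: module_hom_iff)
    then show "\<exists>k\<in>module_hom S B E. \<forall>a\<in>carrier A. k (f a) = h a"
      using * f by (intro bexI[of _ "restrict k (carrier B)"]) (auto simp: module_hom_iff[of f] lin_map_def[of _ _ _ f])
  qed
next
  assume inj: "injective_module S E"
  then have E: "left_module S E" by (simp add: injective_module_def)
  interpret E: left_module S E by (rule E)
  show "baer S E"
    unfolding baer_def
  proof (intro conjI allI impI E)
    fix I h assume *: "submod S (regular_module S) I \<and> lin_map S (regular_module S\<lparr>carrier := I\<rparr>) E h"
    have reg: "left_module S (regular_module S)" by (rule left_module_regular) (rule E.R.ring_axioms)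
    \<comment> \<open>A ring element is coded as its indicator family: one tuple at \<open>s\<close>
      and a different one elsewhere.\<close>
    define c :: "'a \<Rightarrow> ('a, 'b) universe" where
      "c s = Family (\<lambda>t. if t = s then Tuple [] else Tuple [Tuple []])" for s
    have "inj c" by (auto simp: inj_def c_def fun_eq_iff split: if_splits)
    then have c: "inj_on c (carrier (regular_module S))" using inj_on_subset by blast
    obtain B :: "('a, ('a, 'b) universe) module" and q u where
      B: "left_module S B" and q: "lin_map S (regular_module S) B q" and u: "lin_map S B (regular_module S) u"
      and uq: "\<And>x. x \<in> carrier S \<Longrightarrow> u (q x) = x" and qu: "\<And>x. x \<in> carrier B \<Longrightarrow> q (u x) = x"
      by (rule exists_copy[OF reg c]) simp
    interpret B: left_module S B by (rule B)
    note ID = submodD[OF conjunct1[OF *]]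
    define A where "A = B\<lparr>carrier := q ` I\<rparr>"
    have regI: "left_module S (regular_module S\<lparr>carrier := I\<rparr>)"
      using left_module.left_module_submod[OF reg] * by blast
    have "lin_map S (regular_module S\<lparr>carrier := I\<rparr>) B q"
      using q ID by (auto simp: lin_map_def)
    from submod_image[OF regI B this] have "submod S B (q ` I)" by simp
    then have A: "left_module S A" unfolding A_def by (rule B.left_module_submod)
    have AB: "carrier A \<subseteq> carrier B" using q ID by (auto simp: A_def lin_map_def)
    have f: "lin_map S A B (\<lambda>x. x)" using AB by (auto simp: lin_map_def A_def)
    have "lin_map S A (regular_module S\<lparr>carrier := I\<rparr>) u"
      using u AB uq ID lin_closed[OF reg B q] by (auto simp: lin_map_def A_def)
    then have h': "lin_map S A E (\<lambda>x. h (u x))" using * lin_compose by blast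
    obtain k where k: "k \<in> module_hom S B E" "\<And>a. a \<in> carrier A \<Longrightarrow> k a = h (u a)"
    proof -
      have "restrict (\<lambda>x. x) (carrier A) \<in> module_hom S A B" "restrict (\<lambda>x. h (u x)) (carrier A) \<in> module_hom S A E"
        using f h' A by auto
      moreover have "inj_on (restrict (\<lambda>x. x) (carrier A)) (carrier A)" by (auto simp: inj_on_def)
      ultimately show thesis
        using inj A B that unfolding injective_module_def by (fastforce simp: restrict_apply')
    qed
    have lk: "lin_map S B E k" using k by (simp add: module_hom_iff)
    have q1: "q \<one>\<^bsub>S\<^esub> \<in> carrier B" using lin_closed[OF reg B q] by simp
    have "h x = x \<odot>\<^bsub>E\<^esub> k (q \<one>\<^bsub>S\<^esub>)" if x: "x \<in> I" for x
    proof -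
      have xS: "x \<in> carrier S" using x ID by auto
      have "q x \<in> carrier A" using x by (simp add: A_def)
      then have "h x = k (q x)" using k uq xS by simp
      also have "q x = x \<odot>\<^bsub>B\<^esub> q \<one>\<^bsub>S\<^esub>" using lin_smult[OF reg B q xS, of "\<one>\<^bsub>S\<^esub>"] xS by simp
      also have "k \<dots> = x \<odot>\<^bsub>E\<^esub> k (q \<one>\<^bsub>S\<^esub>)" using lin_smult[OF B E lk xS q1] .
      finally show ?thesis .
    qed
    then show "\<exists>e\<in>carrier E. \<forall>x\<in>I. h x = x \<odot>\<^bsub>E\<^esub> e" using lin_closed[OF B E lk q1] by blast
  qed
qed

text \<open>The identity of \<open>X\<close> factors through \<open>E \<oplus> J\<close>, so
  \<open>X\<close> is a direct summand of an injective module. Four maps express this without a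
  direct sum of modules on different types.\<close>

lemma baer_retract:
  assumes E: "baer S E" and J: "baer S J" and X: "left_module S X"
    and i: "lin_map S X E i" and p: "lin_map S E X p" and a: "lin_map S X J a" and b: "lin_map S J X b"
    and id: "\<And>x. x \<in> carrier X \<Longrightarrow> p (i x) \<oplus>\<^bsub>X\<^esub> b (a x) = x"
  shows "baer S X"
  unfolding baer_def
proof (intro conjI allI impI X)
  interpret X: left_module S X by (rule X)
  fix I h assume *: "submod S (regular_module S) I \<and> lin_map S (regular_module S\<lparr>carrier := I\<rparr>) X h"
  have E': "left_module S E" and J': "left_module S J" using E J by (auto simp: baer_def)
  obtain e where e: "e \<in> carrier E" "\<And>x. x \<in> I \<Longrightarrow> i (h x) = x \<odot>\<^bsub>E\<^esub> e"
    using E lin_compose[OF conjunct2[OF *] i] * unfolding baer_def by metis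
  obtain e' where e': "e' \<in> carrier J" "\<And>x. x \<in> I \<Longrightarrow> a (h x) = x \<odot>\<^bsub>J\<^esub> e'"
    using J lin_compose[OF conjunct2[OF *] a] * unfolding baer_def by metis
  have pe: "p e \<in> carrier X" "b e' \<in> carrier X"
    using e e' p b by (auto simp: lin_map_def)
  have "h x = x \<odot>\<^bsub>X\<^esub> (p e \<oplus>\<^bsub>X\<^esub> b e')" if x: "x \<in> I" for x
  proof -
    have xS: "x \<in> carrier S" "h x \<in> carrier X" using x * by (auto simp: submod_def lin_map_def)
    have "h x = p (i (h x)) \<oplus>\<^bsub>X\<^esub> b (a (h x))" using id xS by simp
    also have "\<dots> = x \<odot>\<^bsub>X\<^esub> p e \<oplus>\<^bsub>X\<^esub> x \<odot>\<^bsub>X\<^esub> b e'"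
      using e e' x xS lin_smult[OF E' X p] lin_smult[OF J' X b] by simp
    finally show ?thesis using xS pe by (simp add: X.smult_r_distr)
  qed
  then show "\<exists>e\<in>carrier X. \<forall>x\<in>I. h x = x \<odot>\<^bsub>X\<^esub> e" using pe by blast
qed

section \<open>Enough injectives\<close>

text \<open>A nonzero ideal of the integers is generated by its least positive element
  \<open>n\<close>, so it suffices to solve \<open>n e = h n\<close>.\<close>

lemma divisible_baer:
  assumes D: "left_module \<Z> D"
    and div: "\<And>n x. \<lbrakk>n > 0; x \<in> carrier D\<rbrakk> \<Longrightarrow> \<exists>y\<in>carrier D. n \<odot>\<^bsub>D\<^esub> y = x"
  shows "baer \<Z> D"
  unfolding baer_def
proof (intro conjI allI impI D)
  interpret D: left_module \<Z> D by (rule D)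
  fix I h assume *: "submod \<Z> (regular_module \<Z>) I \<and> lin_map \<Z> (regular_module \<Z>\<lparr>carrier := I\<rparr>) D h"
  have I0: "0 \<in> I" and Iadd: "\<And>x y. x \<in> I \<Longrightarrow> y \<in> I \<Longrightarrow> x + y \<in> I" and Imul: "\<And>r x. x \<in> I \<Longrightarrow> r * x \<in> I"
    using * by (auto simp: submod_def)
  have hc: "\<And>x. x \<in> I \<Longrightarrow> h x \<in> carrier D" and hm: "\<And>r x. x \<in> I \<Longrightarrow> h (r * x) = r \<odot>\<^bsub>D\<^esub> h x"
    using * by (auto simp: lin_map_def)
  have h0: "h 0 = \<zero>\<^bsub>D\<^esub>" using hm[OF I0, of 0] D.smult_zero_l[OF hc[OF I0]] by simp
  show "\<exists>e\<in>carrier D. \<forall>x\<in>I. h x = x \<odot>\<^bsub>D\<^esub> e"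
  proof (cases "I = {0}")
    case True
    then show ?thesis using h0 D.smult_zero_l[of "\<zero>\<^bsub>D\<^esub>"] by (intro bexI[of _ "\<zero>\<^bsub>D\<^esub>"]) auto
  next
    case False
    then obtain x where x: "x \<in> I" "x \<noteq> 0" using I0 by blast
    define P where "P k \<longleftrightarrow> k > 0 \<and> int k \<in> I" for k
    have "P (nat \<bar>x\<bar>)" using x Imul[OF x(1), of "-1"] by (auto simp: P_def abs_if)
    define n where "n = (LEAST k. P k)"
    have n: "P n" unfolding n_def by (rule LeastI) fact
    have min: "\<not> P k" if "k < n" for k using that not_less_Least unfolding n_def by blast
    have dvd: "y = (y div int n) * int n" if "y \<in> I" for y
    proof -
      have "y + (- (y div int n)) * int n \<in> I" by (intro Iadd that Imul) (use n in \<open>simp add: P_def\<close>)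
      then have "y mod int n \<in> I" by (simp add: minus_div_mult_eq_mod)
      moreover have "0 \<le> y mod int n" "y mod int n < int n" using n by (auto simp: P_def)
      ultimately have "y mod int n = 0" using min[of "nat (y mod int n)"] by (auto simp: P_def)
      then show ?thesis by (simp add: dvd_eq_mod_eq_0[symmetric])
    qed
    obtain e where e: "e \<in> carrier D" "int n \<odot>\<^bsub>D\<^esub> e = h (int n)"
      using div[of "int n" "h (int n)"] n hc by (auto simp: P_def)
    have "h y = y \<odot>\<^bsub>D\<^esub> e" if y: "y \<in> I" for y
    proof -
      have "h y = h ((y div int n) * int n)" using dvd[OF y] by simp
      also have "\<dots> = (y div int n) \<odot>\<^bsub>D\<^esub> (int n \<odot>\<^bsub>D\<^esub> e)" using n hm by (simp add: P_def e)
      also have "\<dots> = y \<odot>\<^bsub>D\<^esub> e"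
        using D.smult_assoc[of "y div int n" "int n" e] e dvd[OF y] by simp
      finally show ?thesis .
    qed
    then show ?thesis using e by blast
  qed
qed

section \<open>Abelian groups as modules over the integers\<close>

definition int_module :: "('x, 'd) ring_scheme \<Rightarrow> (int, 'x) module" where
  "int_module X = \<lparr>carrier = carrier X, monoid.mult = undefined, one = undefined, ring.zero = \<zero>\<^bsub>X\<^esub>,
     ring.add = add X, smult = (\<lambda>k x. [k] \<cdot>\<^bsub>X\<^esub> x)\<rparr>"

lemma int_module_simps [simp]:
  "carrier (int_module X) = carrier X" "\<zero>\<^bsub>int_module X\<^esub> = \<zero>\<^bsub>X\<^esub>"
  "x \<oplus>\<^bsub>int_module X\<^esub> y = x \<oplus>\<^bsub>X\<^esub> y" "k \<odot>\<^bsub>int_module X\<^esub> x = [k] \<cdot>\<^bsub>X\<^esub> x"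
  by (simp_all add: int_module_def)

lemma ring_int: "ring \<Z>"
  by (rule cring.axioms[OF int_is_cring])

lemma left_module_int_module:
  fixes X :: "('x, 'd) ring_scheme"
  assumes "abelian_group X" shows "left_module \<Z> (int_module X)"
proof -
  interpret abelian_group X by fact
  have "\<exists>y\<in>carrier X. y \<oplus>\<^bsub>X\<^esub> x = \<zero>\<^bsub>X\<^esub>" if "x \<in> carrier X" for x
    using that l_neg by blast
  then show ?thesis
    by (intro left_moduleI)
      (simp_all add: ring_int a_ac add.int_pow_mult add.int_pow_distrib add.int_pow_pow mult.commute)
qed

text \<open>Induction upwards and downwards from 0 shows that an additive map respects integer
  multiples.\<close>

lemma additive_lin_map:
  fixes X :: "('x, 'd) ring_scheme"
  assumes X: "abelian_group X" and D: "left_module \<Z> D"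
    and f: "\<And>x. x \<in> carrier X \<Longrightarrow> f x \<in> carrier D"
    and add: "\<And>x y. \<lbrakk>x \<in> carrier X; y \<in> carrier X\<rbrakk> \<Longrightarrow> f (x \<oplus>\<^bsub>X\<^esub> y) = f x \<oplus>\<^bsub>D\<^esub> f y"
  shows "lin_map \<Z> (int_module X) D f"
proof -
  interpret X: abelian_group X by (rule X)
  interpret D: left_module \<Z> D by (rule D)
  have 0: "f \<zero>\<^bsub>X\<^esub> = \<zero>\<^bsub>D\<^esub>" using add[of "\<zero>\<^bsub>X\<^esub>" "\<zero>\<^bsub>X\<^esub>"] f[of "\<zero>\<^bsub>X\<^esub>"] by simp
  have "f ([k] \<cdot>\<^bsub>X\<^esub> x) = k \<odot>\<^bsub>D\<^esub> f x" if x: "x \<in> carrier X" for k x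
  proof (induction k rule: int_induct[where k = 0])
    case base
    then show ?case using 0 D.smult_zero_l[OF f[OF x]] by (simp add: add_pow_def)
  next
    case (step1 k)
    have "f ([(k + 1)] \<cdot>\<^bsub>X\<^esub> x) = f ([k] \<cdot>\<^bsub>X\<^esub> x) \<oplus>\<^bsub>D\<^esub> f x"
      using x by (simp add: X.add.int_pow_mult flip: add)
    then show ?case using step1 D.smult_l_distr[of k 1 "f x"] D.smult_one[of "f x"] f[OF x] by simp
  next
    case (step2 k)
    have "f ([k] \<cdot>\<^bsub>X\<^esub> x) = f ([(k - 1)] \<cdot>\<^bsub>X\<^esub> x) \<oplus>\<^bsub>D\<^esub> f x"
      using x X.add.int_pow_mult[of x "k - 1" 1] by (simp flip: add)
    moreover have "k \<odot>\<^bsub>D\<^esub> f x = (k - 1) \<odot>\<^bsub>D\<^esub> f x \<oplus>\<^bsub>D\<^esub> f x"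
      using D.smult_l_distr[of "k - 1" 1 "f x"] D.smult_one[of "f x"] f[OF x] by simp
    ultimately have "f ([(k - 1)] \<cdot>\<^bsub>X\<^esub> x) \<oplus>\<^bsub>D\<^esub> f x = (k - 1) \<odot>\<^bsub>D\<^esub> f x \<oplus>\<^bsub>D\<^esub> f x" using step2 by simp
    then show ?case using f x D.smult_closed[of "k - 1" "f x"] by simp
  qed
  then show ?thesis using f add by (simp add: lin_map_def)
qed

lemma lookup_map_hom: "f 0 = 0 \<Longrightarrow> Poly_Mapping.lookup (Poly_Mapping.map f p) x = f (Poly_Mapping.lookup p x)"
  by (simp add: Poly_Mapping.map.rep_eq when_def)

text \<open>A group is the free group on its elements modulo relations; dividing the rational vector space
  on its elements by the same relations embeds it into a divisible group.\<close>

lemma divisible_hull: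
  fixes X :: "('x, 'd) ring_scheme" and c :: "('x \<Rightarrow>\<^sub>0 rat) \<Rightarrow> 'z"
  assumes X: "abelian_group X" and c: "inj c"
  obtains D :: "(int, 'z) module" and \<kappa> where
    "baer \<Z> D" "\<And>x. x \<in> carrier X \<Longrightarrow> \<kappa> x \<in> carrier D" "inj_on \<kappa> (carrier X)"
    "\<And>x y. \<lbrakk>x \<in> carrier X; y \<in> carrier X\<rbrakk> \<Longrightarrow> \<kappa> (x \<oplus>\<^bsub>X\<^esub> y) = \<kappa> x \<oplus>\<^bsub>D\<^esub> \<kappa> y"
proof -
  interpret X: abelian_group X by (rule X)
  \<comment> \<open>The rational vector space with basis \<open>carrier X\<close>, regarded as a
    module over the integers.\<close>
  define P :: "(int, 'x \<Rightarrow>\<^sub>0 rat) module" where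
    "P = \<lparr>carrier = {p. Poly_Mapping.keys p \<subseteq> carrier X}, monoid.mult = undefined, one = undefined,
       ring.zero = 0, ring.add = (+), smult = (\<lambda>k. Poly_Mapping.map ((*) (of_int k)))\<rparr>"
  have P: "left_module \<Z> P"
  proof (rule left_moduleI)
    fix x assume "x \<in> carrier P"
    then show "\<exists>y\<in>carrier P. y \<oplus>\<^bsub>P\<^esub> x = \<zero>\<^bsub>P\<^esub>"
      by (intro bexI[of _ "- x"]) (auto simp: P_def)
  next
    fix r x assume "x \<in> carrier P"
    then show "r \<odot>\<^bsub>P\<^esub> x \<in> carrier P" by (auto simp: P_def in_keys_iff lookup_map_hom)
  qed (auto simp: P_def ring_int add.assoc add.commute lookup_add lookup_map_hom algebra_simps in_keys_iff
      intro!: poly_mapping_eqI dest: subsetD[OF keys_add])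
  define j :: "('x \<Rightarrow>\<^sub>0 int) \<Rightarrow> ('x \<Rightarrow>\<^sub>0 rat)" where "j = Poly_Mapping.map of_int"
  have lj: "Poly_Mapping.lookup (j u) x = of_int (Poly_Mapping.lookup u x)" for u x
    by (simp add: j_def lookup_map_hom)
  have j_add: "j (u + v) = j u + j v" for u v by (rule poly_mapping_eqI) (simp add: lj lookup_add)
  have j_0: "j 0 = 0" by (rule poly_mapping_eqI) (simp add: lj)
  have j_cmul: "j (frag_cmul k u) = Poly_Mapping.map ((*) (of_int k)) (j u)" for k u
    by (rule poly_mapping_eqI) (simp add: lj lookup_map_hom)
  have j_inj: "j u = j v \<longleftrightarrow> u = v" for u v by (auto simp: poly_mapping_eq_iff fun_eq_iff lj)
  have j_keys: "Poly_Mapping.keys (j u) = Poly_Mapping.keys u" for u by (auto simp: in_keys_iff lj)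
  let ?F = "free_Abelian_group (carrier X)"
  obtain \<phi> where \<phi>: "\<phi> \<in> hom ?F (add_monoid X)" and \<phi>_of: "\<And>x. x \<in> carrier X \<Longrightarrow> \<phi> (frag_of x) = x"
    by (rule comm_group.free_Abelian_group_universal[OF X.a_comm_group, of "\<lambda>x. x" "carrier X"]) auto
  have \<phi>_add: "\<phi> (u + v) = \<phi> u \<oplus>\<^bsub>X\<^esub> \<phi> v" if "Poly_Mapping.keys u \<subseteq> carrier X" "Poly_Mapping.keys v \<subseteq> carrier X" for u v
    using hom_mult[OF \<phi>, of u v] that by simp
  have \<phi>_c: "\<phi> u \<in> carrier X" if "Poly_Mapping.keys u \<subseteq> carrier X" for u
    using hom_carrier[OF \<phi>] that by auto
  have \<phi>_0: "\<phi> 0 = \<zero>\<^bsub>X\<^esub>" using hom_one[OF \<phi> group_free_Abelian_group X.a_group] by simp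
  have \<phi>_cmul: "\<phi> (frag_cmul k u) = \<zero>\<^bsub>X\<^esub>" if "\<phi> u = \<zero>\<^bsub>X\<^esub>" "Poly_Mapping.keys u \<subseteq> carrier X" for k u
    using hom_int_pow[OF \<phi> _ group_free_Abelian_group X.a_group, of u k] that group.int_pow_one[OF X.a_group, of k] by simp
  \<comment> \<open>The relations of the group \<open>X\<close> inside the rational space. Their
    rational span would be too large: the quotient by it would lose the torsion of
    \<open>X\<close>.\<close>
  define H where "H = j ` {u. Poly_Mapping.keys u \<subseteq> carrier X \<and> \<phi> u = \<zero>\<^bsub>X\<^esub>}"
  have HI: "j u \<in> H" if "Poly_Mapping.keys u \<subseteq> carrier X" "\<phi> u = \<zero>\<^bsub>X\<^esub>" for u
    using that by (auto simp: H_def)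
  have H: "submod \<Z> P H"
    unfolding submod_def
  proof (intro conjI ballI)
    show "H \<subseteq> carrier P" by (auto simp: H_def P_def j_keys)
    show "\<zero>\<^bsub>P\<^esub> \<in> H" using HI[of 0] by (simp add: P_def j_0 \<phi>_0)
  next
    fix p p' assume "p \<in> H" "p' \<in> H"
    then obtain u v where "p = j u" "p' = j v" "\<phi> u = \<zero>\<^bsub>X\<^esub>" "\<phi> v = \<zero>\<^bsub>X\<^esub>"
      and k: "Poly_Mapping.keys u \<subseteq> carrier X" "Poly_Mapping.keys v \<subseteq> carrier X"
      by (auto simp: H_def)
    moreover have "Poly_Mapping.keys (u + v) \<subseteq> carrier X" using k keys_add[of u v] by blast
    ultimately show "p \<oplus>\<^bsub>P\<^esub> p' \<in> H" using HI[of "u + v"] by (simp add: P_def j_add \<phi>_add)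
  next
    fix k p assume "p \<in> H"
    then obtain u where "p = j u" "\<phi> u = \<zero>\<^bsub>X\<^esub>" and u: "Poly_Mapping.keys u \<subseteq> carrier X"
      by (auto simp: H_def)
    moreover have "Poly_Mapping.keys (frag_cmul k u) \<subseteq> carrier X" using u keys_cmul[of k u] by blast
    ultimately show "k \<odot>\<^bsub>P\<^esub> p \<in> H" using HI[of "frag_cmul k u"] by (simp add: P_def j_cmul \<phi>_cmul)
  qed
  obtain D :: "(int, 'z) module" and q where D: "left_module \<Z> D" and q: "lin_map \<Z> P D q"
    and car: "carrier D = q ` carrier P" and ker: "\<And>x. x \<in> carrier P \<Longrightarrow> q x = \<zero>\<^bsub>D\<^esub> \<longleftrightarrow> x \<in> H"
    by (rule exists_quotient[OF P H, of c]) (use c inj_on_subset in blast)+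
  interpret D: left_module \<Z> D by (rule D)
  have q_add: "q (x + y) = q x \<oplus>\<^bsub>D\<^esub> q y" if "x \<in> carrier P" "y \<in> carrier P" for x y
    using lin_add[OF P D q that] by (simp add: P_def)
  have q_c: "q x \<in> carrier D" if "x \<in> carrier P" for x by (rule lin_closed[OF P D q that])
  have P_iff: "p \<in> carrier P \<longleftrightarrow> Poly_Mapping.keys p \<subseteq> carrier X" for p by (simp add: P_def)
  have "baer \<Z> D"
  proof (rule divisible_baer[OF D])
    fix n :: int and x assume n: "n > 0" and "x \<in> carrier D"
    then obtain p where p: "p \<in> carrier P" "x = q p" by (auto simp: car)
    \<comment> \<open>Dividing the coefficients by \<open>n\<close> keeps the support, and the class
      of the result is an \<open>n\<close>-th part of \<open>x\<close>.\<close>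
    let ?p = "Poly_Mapping.map ((*) (1 / of_int n)) p"
    have "?p \<in> carrier P" using p by (auto simp: P_def in_keys_iff lookup_map_hom)
    moreover have "n \<odot>\<^bsub>P\<^esub> ?p = p" using n by (auto simp: P_def lookup_map_hom intro!: poly_mapping_eqI)
    ultimately show "\<exists>y\<in>carrier D. n \<odot>\<^bsub>D\<^esub> y = x"
      using lin_smult[OF P D q, of n ?p] p by (intro bexI[of _ "q ?p"]) (auto simp: q_c)
  qed
  moreover
  define \<kappa> where "\<kappa> x = q (j (frag_of x))" for x
  have fc: "j (frag_of x) \<in> carrier P" if "x \<in> carrier X" for x using that by (simp add: P_iff j_keys)
  have \<kappa>c: "\<kappa> x \<in> carrier D" if "x \<in> carrier X" for x using fc[OF that] by (simp add: \<kappa>_def q_c)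
  have "\<kappa> (x \<oplus>\<^bsub>X\<^esub> y) = \<kappa> x \<oplus>\<^bsub>D\<^esub> \<kappa> y" if xy: "x \<in> carrier X" "y \<in> carrier X" for x y
  proof -
    \<comment> \<open>This is a relation of \<open>X\<close>, so its class vanishes and
      \<open>\<kappa>\<close> is additive.\<close>
    define u where "u = frag_of (x \<oplus>\<^bsub>X\<^esub> y) - (frag_of x + frag_of y)"
    have k2: "Poly_Mapping.keys (frag_of x + frag_of y) \<subseteq> carrier X"
      using xy keys_add[of "frag_of x" "frag_of y"] by auto
    have k: "Poly_Mapping.keys u \<subseteq> carrier X"
      using xy k2 keys_diff[of "frag_of (x \<oplus>\<^bsub>X\<^esub> y)" "frag_of x + frag_of y"] by (auto simp: u_def)
    have eq: "frag_of (x \<oplus>\<^bsub>X\<^esub> y) = u + (frag_of x + frag_of y)" by (simp add: u_def)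
    have "x \<oplus>\<^bsub>X\<^esub> y = \<phi> u \<oplus>\<^bsub>X\<^esub> (x \<oplus>\<^bsub>X\<^esub> y)"
      using \<phi>_of[of "x \<oplus>\<^bsub>X\<^esub> y"] \<phi>_add[OF k k2] \<phi>_add[of "frag_of x" "frag_of y"] xy unfolding eq
      by (simp add: \<phi>_of)
    then have "\<phi> u = \<zero>\<^bsub>X\<^esub>" using xy \<phi>_c[OF k] X.add.r_cancel_one'[of "x \<oplus>\<^bsub>X\<^esub> y" "\<phi> u"] by (simp add: eq_commute)
    then have "j u \<in> H" using k HI by blast
    then have "q (j u) = \<zero>\<^bsub>D\<^esub>" using ker[of "j u"] k by (simp add: P_iff j_keys)
    moreover have "q (j (frag_of (x \<oplus>\<^bsub>X\<^esub> y))) = q (j u) \<oplus>\<^bsub>D\<^esub> (q (j (frag_of x)) \<oplus>\<^bsub>D\<^esub> q (j (frag_of y)))"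
    proof -
      have "j (frag_of x) + j (frag_of y) \<in> carrier P"
        using k2 by (simp add: P_iff j_keys flip: j_add)
      moreover have "j u \<in> carrier P" using k by (simp add: P_iff j_keys)
      ultimately show ?thesis unfolding eq j_add using fc xy by (simp add: q_add)
    qed
    ultimately show ?thesis using \<kappa>c xy by (simp add: \<kappa>_def)
  qed
  moreover have "inj_on \<kappa> (carrier X)"
  proof (rule inj_onI)
    fix x y assume xy: "x \<in> carrier X" "y \<in> carrier X" "\<kappa> x = \<kappa> y"
    \<comment> \<open>Conversely, if the class of \<open>j u\<close> vanishes, then \<open>u\<close>
      is a relation because \<open>j\<close> is injective; so \<open>\<phi>\<close> takes the same
      value on the basis elements of \<open>x\<close> and \<open>y\<close>.\<close>
    define u where "u = frag_of x - frag_of y"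
    have k: "Poly_Mapping.keys u \<subseteq> carrier X" using xy keys_diff[of "frag_of x" "frag_of y"] by (auto simp: u_def)
    have eq: "frag_of x = u + frag_of y" by (simp add: u_def)
    have "\<kappa> y = q (j u) \<oplus>\<^bsub>D\<^esub> \<kappa> y"
      using xy k fc[OF xy(2)] q_add[of "j u" "j (frag_of y)"] by (simp add: \<kappa>_def eq j_add P_iff j_keys)
    then have "q (j u) = \<zero>\<^bsub>D\<^esub>"
      using \<kappa>c[OF xy(2)] q_c[of "j u"] k D.X.add.r_cancel_one'[of "\<kappa> y" "q (j u)"] by (simp add: P_iff j_keys eq_commute)
    then have "j u \<in> H" using ker[of "j u"] k by (simp add: P_iff j_keys)
    then have "\<phi> u = \<zero>\<^bsub>X\<^esub>" by (auto simp: H_def j_inj)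
    then have "\<phi> (frag_of x) = y"
      unfolding eq using \<phi>_add[OF k, of "frag_of y"] \<phi>_of[OF xy(2)] xy by simp
    then show "x = y" using \<phi>_of[OF xy(1)] by simp
  qed
  ultimately show thesis using that \<kappa>c by blast
qed

text \<open>The additive maps from \<open>S\<close> to \<open>D\<close>; the left action
  \<open>(r \<phi>) s = \<phi> (s r)\<close> comes from right multiplication on \<open>S\<close>.
  Extensional functions make equality pointwise on \<open>carrier S\<close>.\<close>

definition coinduced :: "'s ring \<Rightarrow> (int, 'z) module \<Rightarrow> ('s, 's \<Rightarrow> 'z) module" where
  "coinduced S D = \<lparr>carrier = {\<phi> \<in> carrier S \<rightarrow>\<^sub>E carrier D.
       \<forall>s\<in>carrier S. \<forall>t\<in>carrier S. \<phi> (s \<oplus>\<^bsub>S\<^esub> t) = \<phi> s \<oplus>\<^bsub>D\<^esub> \<phi> t},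
     monoid.mult = undefined, one = undefined, ring.zero = (\<lambda>s\<in>carrier S. \<zero>\<^bsub>D\<^esub>),
     ring.add = (\<lambda>\<phi> \<psi>. \<lambda>s\<in>carrier S. \<phi> s \<oplus>\<^bsub>D\<^esub> \<psi> s), smult = (\<lambda>r \<phi>. \<lambda>s\<in>carrier S. \<phi> (s \<otimes>\<^bsub>S\<^esub> r))\<rparr>"

text \<open>Adjunction: a homomorphism \<open>h\<close> into this module amounts to the additive map
  \<open>x \<mapsto> h x 1\<close> into \<open>D\<close>. Extending the latter from the left ideal
  to \<open>S\<close> yields the required element.\<close>

lemma baer_coinduced:
  assumes S: "ring S" and D: "baer \<Z> D"
  shows "baer S (coinduced S D)"
proof -
  have D': "left_module \<Z> D" using D by (simp add: baer_def)
  interpret S: ring S by (rule S)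
  interpret D: left_module \<Z> D by (rule D')
  let ?I = "coinduced S D"
  have mem: "\<phi> \<in> carrier ?I \<longleftrightarrow> \<phi> \<in> extensional (carrier S) \<and> (\<forall>s\<in>carrier S. \<phi> s \<in> carrier D) \<and>
     (\<forall>s\<in>carrier S. \<forall>t\<in>carrier S. \<phi> (s \<oplus>\<^bsub>S\<^esub> t) = \<phi> s \<oplus>\<^bsub>D\<^esub> \<phi> t)" for \<phi>
    by (auto simp: coinduced_def PiE_iff)
  have ops: "\<zero>\<^bsub>?I\<^esub> = (\<lambda>s\<in>carrier S. \<zero>\<^bsub>D\<^esub>)" "\<phi> \<oplus>\<^bsub>?I\<^esub> \<psi> = (\<lambda>s\<in>carrier S. \<phi> s \<oplus>\<^bsub>D\<^esub> \<psi> s)"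
    "r \<odot>\<^bsub>?I\<^esub> \<phi> = (\<lambda>s\<in>carrier S. \<phi> (s \<otimes>\<^bsub>S\<^esub> r))" for \<phi> \<psi> r
    by (simp_all add: coinduced_def)
  have ext: "\<phi> = \<psi>" if "\<phi> \<in> carrier ?I" "\<psi> \<in> carrier ?I" "\<And>s. s \<in> carrier S \<Longrightarrow> \<phi> s = \<psi> s" for \<phi> \<psi>
    using that by (auto simp: mem intro: extensionalityI)
  have add_cl: "\<phi> \<oplus>\<^bsub>?I\<^esub> \<psi> \<in> carrier ?I" if "\<phi> \<in> carrier ?I" "\<psi> \<in> carrier ?I" for \<phi> \<psi>
    using that by (auto simp: mem ops D.X.a_ac)
  have zero_cl: "\<zero>\<^bsub>?I\<^esub> \<in> carrier ?I" by (auto simp: mem ops)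
  have sm_cl: "r \<odot>\<^bsub>?I\<^esub> \<phi> \<in> carrier ?I" if "r \<in> carrier S" "\<phi> \<in> carrier ?I" for r \<phi>
    using that by (auto simp: mem ops S.l_distr)
  have I: "left_module S ?I"
  proof (rule left_moduleI[OF S add_cl zero_cl _ _ _ _ sm_cl])
    fix \<phi> \<psi> \<chi> assume "\<phi> \<in> carrier ?I" "\<psi> \<in> carrier ?I" "\<chi> \<in> carrier ?I"
    then show "\<phi> \<oplus>\<^bsub>?I\<^esub> \<psi> \<oplus>\<^bsub>?I\<^esub> \<chi> = \<phi> \<oplus>\<^bsub>?I\<^esub> (\<psi> \<oplus>\<^bsub>?I\<^esub> \<chi>)"
      by (intro ext add_cl) (auto simp: mem ops D.X.a_assoc)
  next
    fix \<phi> \<psi> assume "\<phi> \<in> carrier ?I" "\<psi> \<in> carrier ?I"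
    then show "\<phi> \<oplus>\<^bsub>?I\<^esub> \<psi> = \<psi> \<oplus>\<^bsub>?I\<^esub> \<phi>"
      by (intro ext add_cl) (auto simp: mem ops D.X.a_comm)
  next
    fix \<phi> assume \<phi>: "\<phi> \<in> carrier ?I"
    then show "\<zero>\<^bsub>?I\<^esub> \<oplus>\<^bsub>?I\<^esub> \<phi> = \<phi>" by (intro ext add_cl zero_cl) (auto simp: mem ops)
    let ?n = "\<lambda>s\<in>carrier S. \<ominus>\<^bsub>D\<^esub> \<phi> s"
    have n: "?n \<in> carrier ?I" using \<phi> by (auto simp: mem D.X.minus_add)
    then have "?n \<oplus>\<^bsub>?I\<^esub> \<phi> = \<zero>\<^bsub>?I\<^esub>"
      using \<phi> by (intro ext add_cl zero_cl) (auto simp: mem ops D.X.l_neg)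
    then show "\<exists>\<psi>\<in>carrier ?I. \<psi> \<oplus>\<^bsub>?I\<^esub> \<phi> = \<zero>\<^bsub>?I\<^esub>" using n by blast
    show "\<one>\<^bsub>S\<^esub> \<odot>\<^bsub>?I\<^esub> \<phi> = \<phi>" using \<phi> by (intro ext sm_cl) (auto simp: ops)
  next
    fix r s \<phi> assume "r \<in> carrier S" "s \<in> carrier S" "\<phi> \<in> carrier ?I"
    then show "(r \<oplus>\<^bsub>S\<^esub> s) \<odot>\<^bsub>?I\<^esub> \<phi> = r \<odot>\<^bsub>?I\<^esub> \<phi> \<oplus>\<^bsub>?I\<^esub> s \<odot>\<^bsub>?I\<^esub> \<phi>" "(r \<otimes>\<^bsub>S\<^esub> s) \<odot>\<^bsub>?I\<^esub> \<phi> = r \<odot>\<^bsub>?I\<^esub> (s \<odot>\<^bsub>?I\<^esub> \<phi>)"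
      by (intro ext sm_cl add_cl; auto simp: mem ops S.r_distr S.m_assoc)+
  next
    fix r \<phi> \<psi> assume "r \<in> carrier S" "\<phi> \<in> carrier ?I" "\<psi> \<in> carrier ?I"
    then show "r \<odot>\<^bsub>?I\<^esub> (\<phi> \<oplus>\<^bsub>?I\<^esub> \<psi>) = r \<odot>\<^bsub>?I\<^esub> \<phi> \<oplus>\<^bsub>?I\<^esub> r \<odot>\<^bsub>?I\<^esub> \<psi>"
      by (intro ext sm_cl add_cl; auto simp: mem ops)
  qed
  show ?thesis
    unfolding baer_def
  proof (intro conjI allI impI I)
    fix J h assume *: "submod S (regular_module S) J \<and> lin_map S (regular_module S\<lparr>carrier := J\<rparr>) ?I h"
    have J: "submod S (regular_module S) J" and h: "lin_map S (regular_module S\<lparr>carrier := J\<rparr>) ?I h"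
      using * by auto
    note JD = submodD[OF J]
    have SJ: "left_module S (regular_module S\<lparr>carrier := J\<rparr>)"
      by (rule left_module.left_module_submod[OF left_module_regular[OF S] J])
    define G where "G = S\<lparr>carrier := J\<rparr>"
    interpret J: left_module S "regular_module S\<lparr>carrier := J\<rparr>" by (rule SJ)
    have G: "abelian_group G"
    proof (rule abelian_groupI)
      fix x assume "x \<in> carrier G"
      then have x: "x \<in> J" by (simp add: G_def)
      then have "(\<ominus>\<^bsub>S\<^esub> \<one>\<^bsub>S\<^esub>) \<otimes>\<^bsub>S\<^esub> x \<oplus>\<^bsub>S\<^esub> x = \<zero>\<^bsub>S\<^esub>" using JD by (simp add: S.l_minus S.l_neg)
      then show "\<exists>y\<in>carrier G. y \<oplus>\<^bsub>G\<^esub> x = \<zero>\<^bsub>G\<^esub>" using x JD(5)[of "\<ominus>\<^bsub>S\<^esub> \<one>\<^bsub>S\<^esub>" x]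
        by (intro bexI[of _ "(\<ominus>\<^bsub>S\<^esub> \<one>\<^bsub>S\<^esub>) \<otimes>\<^bsub>S\<^esub> x"]) (simp_all add: G_def)
    qed (use JD in \<open>simp_all add: G_def S.a_ac\<close>)
    have hc: "h x \<in> carrier ?I" if "x \<in> J" for x using h that by (auto simp: lin_map_def)
    have "lin_map \<Z> (int_module G) D (\<lambda>x. h x \<one>\<^bsub>S\<^esub>)"
    proof (rule additive_lin_map[OF G D'])
      fix x y assume xy: "x \<in> carrier G" "y \<in> carrier G"
      then show "h x \<one>\<^bsub>S\<^esub> \<in> carrier D" using hc by (auto simp: G_def mem)
      have "h (x \<oplus>\<^bsub>S\<^esub> y) = h x \<oplus>\<^bsub>?I\<^esub> h y" using h xy by (auto simp: lin_map_def G_def)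
      then show "h (x \<oplus>\<^bsub>G\<^esub> y) \<one>\<^bsub>S\<^esub> = h x \<one>\<^bsub>S\<^esub> \<oplus>\<^bsub>D\<^esub> h y \<one>\<^bsub>S\<^esub>" by (simp add: G_def ops)
    qed
    moreover have "lin_map \<Z> (int_module G) (int_module S) (\<lambda>x. x)"
      by (rule additive_lin_map[OF G left_module_int_module]) (use JD in \<open>auto simp: G_def S.is_abelian_group\<close>)
    ultimately obtain k where k: "lin_map \<Z> (int_module S) D k" "\<And>x. x \<in> J \<Longrightarrow> k x = h x \<one>\<^bsub>S\<^esub>"
      using baer_extend[OF D left_module_int_module[OF G] left_module_int_module[OF S.is_abelian_group], of "\<lambda>x. x"]
      by (auto simp: G_def inj_on_def)
    let ?k = "restrict k (carrier S)"
    have kI: "?k \<in> carrier ?I" using k by (auto simp: mem lin_map_def)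
    have "h x = x \<odot>\<^bsub>?I\<^esub> ?k" if x: "x \<in> J" for x
    proof (rule ext[OF hc[OF x] sm_cl[OF _ kI]])
      show xS: "x \<in> carrier S" using x JD by auto
      fix s assume s: "s \<in> carrier S"
      then have sx: "s \<otimes>\<^bsub>S\<^esub> x \<in> J" using x JD by auto
      \<comment> \<open>Linearity recovers \<open>h\<close> from its values at 1:
        \<open>h x s = h (s x) 1 = k (s x)\<close>.\<close>
      have "h (s \<otimes>\<^bsub>S\<^esub> x) = s \<odot>\<^bsub>?I\<^esub> h x" using h x s by (auto simp: lin_map_def)
      then have "h (s \<otimes>\<^bsub>S\<^esub> x) \<one>\<^bsub>S\<^esub> = h x s" using s by (simp add: ops)
      then show "h x s = (x \<odot>\<^bsub>?I\<^esub> ?k) s" using k(2)[OF sx] xS s by (simp add: ops)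
    qed
    then show "\<exists>e\<in>carrier ?I. \<forall>x\<in>J. h x = x \<odot>\<^bsub>?I\<^esub> e" using kI by blast
  qed
qed

text \<open>A finitely supported function is coded by the tuple of its nonzero entries in an
  arbitrarily chosen order; injectivity compares only the sets of entries. With rational
  coefficients this brings a divisible hull back to the universe.\<close>

lemma inj_poly_mapping_code: "\<exists>c :: ('x \<Rightarrow>\<^sub>0 'q :: {countable, zero}) \<Rightarrow> ('s, 'y) universe. inj c"
  if "inj (e :: 'x \<Rightarrow> ('s, 'y) universe)"
proof -
  \<comment> \<open>A coefficient is coded by the length of a tuple.\<close>
  define num :: "'q \<Rightarrow> ('s, 'y) universe" where "num r = Tuple (replicate (to_nat r) (Tuple []))" for r
  have num: "num r = num r' \<longleftrightarrow> r = r'" for r r' by (simp add: num_def replicate_eq_replicate)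
  define code where "code = (\<lambda>p :: 'x \<Rightarrow>\<^sub>0 'q.
    Tuple (map (\<lambda>x. Tuple [e x, num (Poly_Mapping.lookup p x)]) (SOME xs. set xs = Poly_Mapping.keys p)))"
  have keys: "set (SOME xs. set xs = Poly_Mapping.keys p) = Poly_Mapping.keys p" for p :: "'x \<Rightarrow>\<^sub>0 'q"
    by (rule someI_ex) (simp add: finite_list)
  have "p = p'" if eq: "code p = code p'" for p p'
  proof -
    have *: "(\<lambda>x. Tuple [e x, num (Poly_Mapping.lookup p x)]) ` Poly_Mapping.keys p =
      (\<lambda>x. Tuple [e x, num (Poly_Mapping.lookup p' x)]) ` Poly_Mapping.keys p'"
    proof -
      have "map (\<lambda>x. Tuple [e x, num (Poly_Mapping.lookup p x)]) (SOME xs. set xs = Poly_Mapping.keys p) =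
        map (\<lambda>x. Tuple [e x, num (Poly_Mapping.lookup p' x)]) (SOME xs. set xs = Poly_Mapping.keys p')"
        using eq by (simp add: code_def)
      from arg_cong[OF this, of set] show ?thesis by (simp only: set_map keys)
    qed
    have 1: "Poly_Mapping.lookup r x = Poly_Mapping.lookup r' x"
      if "(\<lambda>x. Tuple [e x, num (Poly_Mapping.lookup r x)]) ` Poly_Mapping.keys r =
        (\<lambda>x. Tuple [e x, num (Poly_Mapping.lookup r' x)]) ` Poly_Mapping.keys r'" "x \<in> Poly_Mapping.keys r" for r r' x
    proof -
      have "Tuple [e x, num (Poly_Mapping.lookup r x)] \<in>
        (\<lambda>x. Tuple [e x, num (Poly_Mapping.lookup r' x)]) ` Poly_Mapping.keys r'" using that by blast
      then show ?thesis using \<open>inj e\<close> by (auto simp: num dest: injD)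
    qed
    show "p = p'"
    proof (rule poly_mapping_eqI)
      fix x
      show "Poly_Mapping.lookup p x = Poly_Mapping.lookup p' x"
      proof (cases "x \<in> Poly_Mapping.keys p")
        case True
        then show ?thesis by (rule 1[OF *])
      next
        case False
        show ?thesis
        proof (cases "x \<in> Poly_Mapping.keys p'")
          case True
          then show ?thesis by (rule 1[OF *[symmetric], symmetric])
        qed (use False in \<open>simp add: in_keys_iff\<close>)
      qed
    qed
  qed
  then show ?thesis by (auto simp: inj_def)
qed

lemma enough_injectives:
  fixes X :: "('s, ('s, 'y) universe) module"
  assumes X: "left_module S X"
  obtains I :: "('s, ('s, 'y) universe) module" and \<iota> where
    "baer S I" "lin_map S X I \<iota>" "inj_on \<iota> (carrier X)"
proof -
  interpret X: left_module S X by (rule X)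
  obtain c :: "(('s, 'y) universe \<Rightarrow>\<^sub>0 rat) \<Rightarrow> ('s, 'y) universe" where c: "inj c"
    using inj_poly_mapping_code[of "\<lambda>x. x"] by auto
  obtain D :: "(int, ('s, 'y) universe) module" and \<kappa> where
    D: "baer \<Z> D" and \<kappa>c: "\<And>x. x \<in> carrier X \<Longrightarrow> \<kappa> x \<in> carrier D" and \<kappa>_inj: "inj_on \<kappa> (carrier X)"
    and \<kappa>_add: "\<And>x y. \<lbrakk>x \<in> carrier X; y \<in> carrier X\<rbrakk> \<Longrightarrow> \<kappa> (x \<oplus>\<^bsub>X\<^esub> y) = \<kappa> x \<oplus>\<^bsub>D\<^esub> \<kappa> y"
    using divisible_hull[OF X.X.abelian_group_axioms c] by metis
  let ?I = "coinduced S D"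
  have I: "baer S ?I" by (rule baer_coinduced[OF X.R.ring_axioms D])
  then have I': "left_module S ?I" by (simp add: baer_def)
  \<comment> \<open>The coinduced module consists of functions from \<open>'s\<close> to the
    universe. \<open>Family\<close> codes them back into the universe, and the copy is a retract of
    the original.\<close>
  have "inj_on (Family :: _ \<Rightarrow> ('s, 'y) universe) (carrier ?I)" by (simp add: inj_on_def)
  from exists_copy[OF I' this]
  obtain J :: "('s, ('s, 'y) universe) module" and f u where J: "left_module S J" and f: "lin_map S ?I J f"
    and u: "lin_map S J ?I u" and f_inj: "inj_on f (carrier ?I)" and fu: "\<And>x. x \<in> carrier J \<Longrightarrow> f (u x) = x"
    by metis
  interpret J: left_module S J by (rule J)
  have "baer S J"
  proof (rule baer_retract[OF I I J u f])
    show "lin_map S J ?I (\<lambda>_. \<zero>\<^bsub>?I\<^esub>)" by (rule lin_zero_map[OF I'])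
    show "lin_map S ?I J f" by (rule f)
    show "\<And>x. x \<in> carrier J \<Longrightarrow> f (u x) \<oplus>\<^bsub>J\<^esub> f \<zero>\<^bsub>?I\<^esub> = x"
      using fu lin_zero[OF I' J f] by simp
  qed
  \<comment> \<open>The standard embedding into the coinduced module; evaluation at 1 recovers
    \<open>\<kappa> x\<close>.\<close>
  define \<iota> where "\<iota> x = (\<lambda>s\<in>carrier S. \<kappa> (s \<odot>\<^bsub>X\<^esub> x))" for x
  have "lin_map S X ?I \<iota>"
    unfolding lin_map_def
  proof (intro conjI ballI)
    fix x assume x: "x \<in> carrier X"
    then show "\<iota> x \<in> carrier ?I"
      by (auto simp: coinduced_def \<iota>_def \<kappa>c X.smult_closed X.smult_l_distr \<kappa>_add)
    fix r assume r: "r \<in> carrier S"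
    show "\<iota> (r \<odot>\<^bsub>X\<^esub> x) = r \<odot>\<^bsub>?I\<^esub> \<iota> x"
      using x r by (auto simp: coinduced_def \<iota>_def X.smult_assoc)
  next
    fix x y assume "x \<in> carrier X" "y \<in> carrier X"
    then show "\<iota> (x \<oplus>\<^bsub>X\<^esub> y) = \<iota> x \<oplus>\<^bsub>?I\<^esub> \<iota> y"
      by (auto simp: coinduced_def \<iota>_def X.smult_r_distr X.smult_closed \<kappa>_add)
  qed
  moreover have "inj_on \<iota> (carrier X)"
  proof (rule inj_onI)
    fix x y assume xy: "x \<in> carrier X" "y \<in> carrier X" "\<iota> x = \<iota> y"
    then have "\<kappa> (\<one>\<^bsub>S\<^esub> \<odot>\<^bsub>X\<^esub> x) = \<kappa> (\<one>\<^bsub>S\<^esub> \<odot>\<^bsub>X\<^esub> y)"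
      by (metis \<iota>_def restrict_apply' X.R.one_closed)
    then show "x = y" using xy \<kappa>_inj by (simp add: X.smult_one inj_onD)
  qed
  moreover have "\<iota> ` carrier X \<subseteq> carrier ?I" using calculation(1) by (auto simp: lin_map_def)
  ultimately have "lin_map S X J (\<lambda>x. f (\<iota> x))" "inj_on (f \<circ> \<iota>) (carrier X)"
    using lin_compose[OF _ f] comp_inj_on inj_on_subset[OF f_inj] by blast+
  then show thesis using that[OF \<open>baer S J\<close>] by (simp add: comp_def)
qed

text \<open>The resolution that \<open>Ext\<close> picks by choice is a resolution only because one
  exists on this universe.\<close>

lemma exists_injective_resolution:
  fixes Y :: "('s, 'y) module"
  assumes Y: "left_module S Y"
  shows "\<exists>(E :: nat \<Rightarrow> ('s, ('s, 'y) universe) module) \<epsilon> d. injective_resolution S Y E \<epsilon> d"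
proof -
  \<comment> \<open>Stated for every \<open>X\<close>, with the module property as a premise, so
    that choice yields functions on all modules that can be iterated.\<close>
  have "\<exists>(I :: ('s, ('s, 'y) universe) module) \<iota> (Q :: ('s, ('s, 'y) universe) module) q.
    left_module S X \<longrightarrow> baer S I \<and> lin_map S X I \<iota> \<and> inj_on \<iota> (carrier X) \<and> left_module S Q \<and>
      lin_map S I Q q \<and> carrier Q = q ` carrier I \<and> (\<forall>x\<in>carrier I. q x = \<zero>\<^bsub>Q\<^esub> \<longleftrightarrow> x \<in> \<iota> ` carrier X)"
    for X :: "('s, ('s, 'y) universe) module"
  proof (cases "left_module S X")
    case X: True
    obtain I :: "('s, ('s, 'y) universe) module" and \<iota> where
      I: "baer S I" and \<iota>: "lin_map S X I \<iota>" "inj_on \<iota> (carrier X)"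
      by (rule enough_injectives[OF X])
    have I': "left_module S I" using I by (simp add: baer_def)
    obtain Q :: "('s, ('s, 'y) universe) module" and q where
      "left_module S Q" "lin_map S I Q q" "carrier Q = q ` carrier I"
      "\<And>x. x \<in> carrier I \<Longrightarrow> q x = \<zero>\<^bsub>Q\<^esub> \<longleftrightarrow> x \<in> \<iota> ` carrier X"
      using exists_quotient[OF I' submod_image[OF X I' \<iota>(1)], of "\<lambda>x. x"] by auto
    then show ?thesis using I \<iota> by blast
  qed simp
  then obtain In :: "('s, ('s, 'y) universe) module \<Rightarrow> ('s, ('s, 'y) universe) module" and io
    and Qu :: "('s, ('s, 'y) universe) module \<Rightarrow> ('s, ('s, 'y) universe) module" and qu where
    step: "\<And>X. left_module S X \<Longrightarrow> baer S (In X) \<and> lin_map S X (In X) (io X) \<and> inj_on (io X) (carrier X) \<and>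
      left_module S (Qu X) \<and> lin_map S (In X) (Qu X) (qu X) \<and> carrier (Qu X) = qu X ` carrier (In X) \<and>
      (\<forall>x\<in>carrier (In X). qu X x = \<zero>\<^bsub>Qu X\<^esub> \<longleftrightarrow> x \<in> io X ` carrier X)"
    by metis
  have "inj_on (Elem :: 'y \<Rightarrow> ('s, 'y) universe) (carrier Y)" by (simp add: inj_on_def)
  from exists_copy[OF Y this]
  obtain X0 :: "('s, ('s, 'y) universe) module" and f u where X0: "left_module S X0" and f: "lin_map S Y X0 f"
    and u: "lin_map S X0 Y u" and f_inj: "inj_on f (carrier Y)" and fu: "\<And>x. x \<in> carrier X0 \<Longrightarrow> f (u x) = x"
    by metis
  have fim: "f ` carrier Y = carrier X0"
  proof
    show "f ` carrier Y \<subseteq> carrier X0" using f by (auto simp: lin_map_def)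
    show "carrier X0 \<subseteq> f ` carrier Y"
    proof
      fix x assume x: "x \<in> carrier X0"
      then have "u x \<in> carrier Y" using u by (auto simp: lin_map_def)
      then show "x \<in> f ` carrier Y" using fu[OF x] by (metis image_eqI)
    qed
  qed
  \<comment> \<open>The iterated cokernels: each is the quotient of an injective module by an
    embedded copy of its predecessor. The differential runs through the next one.\<close>
  define Xs where "Xs = rec_nat X0 (\<lambda>_. Qu)"
  have Xs: "left_module S (Xs i)" for i by (induction i) (auto simp: Xs_def X0 step)
  have Xs_Suc: "Xs (Suc i) = Qu (Xs i)" and Xs_0: "Xs 0 = X0" for i by (simp_all add: Xs_def)
  define E where "E i = In (Xs i)" for i
  define \<epsilon> where "\<epsilon> = restrict (\<lambda>y. io X0 (f y)) (carrier Y)"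
  define d where "d i = restrict (\<lambda>x. io (Xs (Suc i)) (qu (Xs i) x)) (carrier (E i))" for i
  have E: "baer S (E i)" and E': "left_module S (E i)" for i
    using step[OF Xs] by (simp_all add: E_def baer_def)
  have io: "lin_map S (Xs i) (E i) (io (Xs i))" and io_inj: "inj_on (io (Xs i)) (carrier (Xs i))" for i
    using step[OF Xs] by (simp_all add: E_def)
  have qu: "lin_map S (E i) (Xs (Suc i)) (qu (Xs i))" and
    qu_im: "qu (Xs i) ` carrier (E i) = carrier (Xs (Suc i))" and
    qu_ker: "x \<in> carrier (E i) \<Longrightarrow> qu (Xs i) x = \<zero>\<^bsub>Xs (Suc i)\<^esub> \<longleftrightarrow> x \<in> io (Xs i) ` carrier (Xs i)" for i x
    using step[OF Xs, of i] by (simp_all add: E_def Xs_Suc)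
  have ker: "{x \<in> carrier (E i). d i x = \<zero>\<^bsub>E (Suc i)\<^esub>} = io (Xs i) ` carrier (Xs i)" for i
  proof -
    have "d i x = \<zero>\<^bsub>E (Suc i)\<^esub> \<longleftrightarrow> x \<in> io (Xs i) ` carrier (Xs i)" if x: "x \<in> carrier (E i)" for x
    proof -
      have "io (Xs (Suc i)) (qu (Xs i) x) = \<zero>\<^bsub>E (Suc i)\<^esub> \<longleftrightarrow> qu (Xs i) x = \<zero>\<^bsub>Xs (Suc i)\<^esub>"
        using lin_inj[OF Xs E' io, of "Suc i"] io_inj[of "Suc i"] lin_zero[OF Xs E' io, of "Suc i"]
          lin_closed[OF E' Xs qu x] by metis
      then show ?thesis using qu_ker[OF x] x by (simp add: d_def)
    qed
    moreover have "io (Xs i) ` carrier (Xs i) \<subseteq> carrier (E i)" using io by (auto simp: lin_map_def)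
    ultimately show ?thesis by blast
  qed
  have im: "d i ` carrier (E i) = io (Xs (Suc i)) ` carrier (Xs (Suc i))" for i
    unfolding d_def qu_im[symmetric] by (simp add: image_image)
  have "injective_resolution S Y E \<epsilon> d"
    unfolding injective_resolution_def injective_module_iff_baer
  proof (intro conjI allI E)
    show "\<epsilon> \<in> module_hom S Y (E 0)"
      using lin_compose[OF f, of "E 0" "io X0"] io[of 0] Y by (simp add: \<epsilon>_def Xs_0)
    show "inj_on \<epsilon> (carrier Y)"
      using comp_inj_on[OF f_inj, of "io X0"] io_inj[of 0] fim by (simp add: \<epsilon>_def Xs_0 comp_def)
    show "d i \<in> module_hom S (E i) (E (Suc i))" for i
      using lin_compose[OF qu io] E' by (simp add: d_def)
    show "\<epsilon> ` carrier Y = {x \<in> carrier (E 0). d 0 x = \<zero>\<^bsub>E 1\<^esub>}"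
      using ker[of 0] by (simp add: \<epsilon>_def Xs_0 flip: fim) (simp add: image_image)
    show "d i ` carrier (E i) = {x \<in> carrier (E (Suc i)). d (Suc i) x = \<zero>\<^bsub>E (Suc (Suc i))\<^esub>}" for i
      unfolding im ker ..
  qed
  then show ?thesis by blast
qed

section \<open>Cosyzygies and injective dimension\<close>

text \<open>\<open>h\<close> takes one value on each fibre of \<open>g\<close> because it kills the
  kernel, so it descends to the image.\<close>

lemma lin_factor:
  assumes X: "left_module S X" and Q: "left_module S Q" and W: "left_module S W"
    and g: "lin_map S X Q g" and surj: "g ` carrier X = carrier Q" and h: "lin_map S X W h"
    and ker: "\<And>x. \<lbrakk>x \<in> carrier X; g x = \<zero>\<^bsub>Q\<^esub>\<rbrakk> \<Longrightarrow> h x = \<zero>\<^bsub>W\<^esub>"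
  obtains k where "lin_map S Q W k" "\<And>x. x \<in> carrier X \<Longrightarrow> k (g x) = h x"
proof -
  interpret X: left_module S X by (rule X)
  interpret Q: left_module S Q by (rule Q)
  interpret W: left_module S W by (rule W)
  have eq: "h x = h y" if xy: "x \<in> carrier X" "y \<in> carrier X" "g x = g y" for x y
  proof -
    have "g (x \<ominus>\<^bsub>X\<^esub> y) = \<zero>\<^bsub>Q\<^esub>"
      using xy lin_closed[OF X Q g] Q.X.diff_eq_zero_iff[of "g x" "g y"] by (simp add: lin_diff[OF X Q g])
    then have "h (x \<ominus>\<^bsub>X\<^esub> y) = \<zero>\<^bsub>W\<^esub>" using xy ker by blast
    then show ?thesis
      using xy lin_closed[OF X W h] W.X.diff_eq_zero_iff[of "h x" "h y"] by (simp add: lin_diff[OF X W h])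
  qed
  define u where "u = inv_into (carrier X) g"
  have u: "u q \<in> carrier X" "g (u q) = q" if "q \<in> carrier Q" for q
    using that surj by (auto simp: u_def inv_into_into f_inv_into_f)
  have k: "h (u (g x)) = h x" if "x \<in> carrier X" for x
    using that u[of "g x"] lin_closed[OF X Q g] by (intro eq) auto
  have "lin_map S Q W (\<lambda>q. h (u q))"
    unfolding lin_map_def surj[symmetric]
    by (auto simp: k lin_closed[OF X W h] lin_add[OF X W h] lin_smult[OF X W h] X.smult_closed
        simp flip: lin_add[OF X Q g] lin_smult[OF X Q g])
  then show thesis using that k by blast
qed

text \<open>Taken as a kernel, so that it is a submodule of \<open>E i\<close>. In a resolution
  index 0 gives a copy of the resolved module, and \<open>d i\<close> maps \<open>E i\<close> onto
  the cosyzygy of index \<open>i + 1\<close>.\<close>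

definition cosyzygy ::
  "(nat \<Rightarrow> ('s, 'e) module) \<Rightarrow> (nat \<Rightarrow> 'e \<Rightarrow> 'e) \<Rightarrow> nat \<Rightarrow> ('s, 'e) module" where
  "cosyzygy E d i = E i\<lparr>carrier := {x \<in> carrier (E i). d i x = \<zero>\<^bsub>E (Suc i)\<^esub>}\<rparr>"

lemma cosyzygy_simps [simp]:
  "carrier (cosyzygy E d i) = {x \<in> carrier (E i). d i x = \<zero>\<^bsub>E (Suc i)\<^esub>}" "\<zero>\<^bsub>cosyzygy E d i\<^esub> = \<zero>\<^bsub>E i\<^esub>"
  "x \<oplus>\<^bsub>cosyzygy E d i\<^esub> y = x \<oplus>\<^bsub>E i\<^esub> y" "r \<odot>\<^bsub>cosyzygy E d i\<^esub> x = r \<odot>\<^bsub>E i\<^esub> x"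
  by (simp_all add: cosyzygy_def)

text \<open>Zero modules start the comparison of two resolutions and end a truncated one. As
  submodules of given terms they stay on the same type.\<close>

lemma baer_zero_module:
  assumes E: "left_module S E" shows "baer S (E\<lparr>carrier := {\<zero>\<^bsub>E\<^esub>}\<rparr>)"
proof -
  interpret left_module S E by fact
  show ?thesis
    unfolding baer_def using left_module_submod[OF submod_zero]
    by (auto simp: lin_map_def submod_def)
qed

locale injective_res =
  fixes S :: "'s ring" and Y :: "('s, 'y) module" and E :: "nat \<Rightarrow> ('s, 'e) module" and \<epsilon> d
  assumes Y: "left_module S Y" and res: "injective_resolution S Y E \<epsilon> d"
begin

lemma E_baer: "baer S (E i)" and E: "left_module S (E i)"
  and eps: "lin_map S Y (E 0) \<epsilon>" and eps_inj: "inj_on \<epsilon> (carrier Y)"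
  and d: "lin_map S (E i) (E (Suc i)) (d i)"
  and eps_im: "\<epsilon> ` carrier Y = carrier (cosyzygy E d 0)"
  and d_im: "d i ` carrier (E i) = carrier (cosyzygy E d (Suc i))"
  using res by (auto simp: injective_resolution_def injective_module_iff_baer baer_def module_hom_iff)

lemma cosyzygy_submod: "submod S (E i) (carrier (cosyzygy E d i))"
  using submod_kernel[OF E E d] by simp

lemma cosyzygy: "left_module S (cosyzygy E d i)"
  using left_module.left_module_submod[OF E cosyzygy_submod] by (simp add: cosyzygy_def)

lemma cosyzygy_incl: "lin_map S (cosyzygy E d i) (E i) (\<lambda>x. x)"
  by (auto simp: lin_map_def)

lemma d_cosyzygy: "lin_map S (E i) (cosyzygy E d (Suc i)) (d i)"
  using d[of i] d_im[of i] by (auto simp: lin_map_def)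

lemma eps_cosyzygy: "lin_map S Y (cosyzygy E d 0) \<epsilon>"
  using eps eps_im by (auto simp: lin_map_def)

end

text \<open>Two comparison maps of resolutions and the homotopy from their composite to the identity, in a
  form that can be constructed degree by degree.\<close>

lemma cosyzygy_comparison:
  fixes E :: "nat \<Rightarrow> ('s, 'e) module" and F :: "nat \<Rightarrow> ('s, 'f) module"
  assumes E: "injective_res S Y E \<epsilon> d" and F: "injective_res S Y F \<eta> \<delta>"
  shows "\<exists>i p (J :: ('s, 'f) module) a b.
    lin_map S (cosyzygy F \<delta> k) (cosyzygy E d k) i \<and> lin_map S (cosyzygy E d k) (cosyzygy F \<delta> k) p \<and> baer S J \<and>
    lin_map S (cosyzygy F \<delta> k) J a \<and> lin_map S J (cosyzygy F \<delta> k) b \<and>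
    (\<forall>x\<in>carrier (cosyzygy F \<delta> k). p (i x) \<oplus>\<^bsub>F k\<^esub> b (a x) = x)"
proof -
  interpret E: injective_res S Y E \<epsilon> d by (rule E)
  interpret F: injective_res S Y F \<eta> \<delta> by (rule F)
  show ?thesis
  proof (induction k)
    case 0
    have inj: "x = \<zero>\<^bsub>Y\<^esub>" if "x \<in> carrier Y" "\<epsilon> x = \<zero>\<^bsub>E 0\<^esub>" for x
      using lin_inj[OF E.Y E.E E.eps] E.eps_inj that by blast
    have inj': "x = \<zero>\<^bsub>Y\<^esub>" if "x \<in> carrier Y" "\<eta> x = \<zero>\<^bsub>F 0\<^esub>" for x
      using lin_inj[OF F.Y F.E F.eps] F.eps_inj that by blast
    obtain i where i: "lin_map S (cosyzygy F \<delta> 0) (cosyzygy E d 0) i" "\<And>x. x \<in> carrier Y \<Longrightarrow> i (\<eta> x) = \<epsilon> x"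
      using lin_factor[OF E.Y F.cosyzygy E.cosyzygy F.eps_cosyzygy F.eps_im E.eps_cosyzygy]
        inj' lin_zero[OF E.Y E.E E.eps] by (metis cosyzygy_simps(2))
    obtain p where p: "lin_map S (cosyzygy E d 0) (cosyzygy F \<delta> 0) p" "\<And>x. x \<in> carrier Y \<Longrightarrow> p (\<epsilon> x) = \<eta> x"
      using lin_factor[OF E.Y E.cosyzygy F.cosyzygy E.eps_cosyzygy E.eps_im F.eps_cosyzygy]
        inj lin_zero[OF F.Y F.E F.eps] by (metis cosyzygy_simps(2))
    \<comment> \<open>In degree 0 both maps come from the identity of \<open>Y\<close>, so
      \<open>p\<close> after \<open>i\<close> is already the identity and the correction through
      \<open>J\<close> is zero.\<close>
    let ?J = "F 0\<lparr>carrier := {\<zero>\<^bsub>F 0\<^esub>}\<rparr>"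
    interpret F0: left_module S "F 0" by (rule F.E)
    have J: "baer S ?J" by (rule baer_zero_module[OF F.E])
    have J': "left_module S ?J" using J by (simp add: baer_def)
    have a: "lin_map S (cosyzygy F \<delta> 0) ?J (\<lambda>_. \<zero>\<^bsub>F 0\<^esub>)" using lin_zero_map[OF J'] by simp
    have b: "lin_map S ?J (cosyzygy F \<delta> 0) (\<lambda>_. \<zero>\<^bsub>F 0\<^esub>)" using lin_zero_map[OF F.cosyzygy, of ?J 0] by simp
    have "p (i x) \<oplus>\<^bsub>F 0\<^esub> \<zero>\<^bsub>F 0\<^esub> = x" if "x \<in> carrier (cosyzygy F \<delta> 0)" for x
    proof -
      obtain y where "y \<in> carrier Y" "x = \<eta> y" using \<open>x \<in> _\<close> unfolding F.eps_im[symmetric] by blast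
      then show ?thesis using i(2) p(2) lin_closed[OF F.Y F.E F.eps] by simp
    qed
    then show ?case using i(1) p(1) J a b by blast
  next
    case (Suc k)
    then obtain i p and J :: "('s, 'f) module" and a b where
      i: "lin_map S (cosyzygy F \<delta> k) (cosyzygy E d k) i" and p: "lin_map S (cosyzygy E d k) (cosyzygy F \<delta> k) p"
      and J: "baer S J" and a: "lin_map S (cosyzygy F \<delta> k) J a" and b: "lin_map S J (cosyzygy F \<delta> k) b"
      and id: "\<And>x. x \<in> carrier (cosyzygy F \<delta> k) \<Longrightarrow> p (i x) \<oplus>\<^bsub>F k\<^esub> b (a x) = x" by blast
    have J': "left_module S J" using J by (simp add: baer_def)
    interpret F0: left_module S "F k" by (rule F.E)
    interpret F1: left_module S "F (Suc k)" by (rule F.E)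
    have inj: "inj_on (\<lambda>x. x) A" for A :: "'z set" by simp
    \<comment> \<open>Injectivity extends \<open>i\<close>, \<open>p\<close> and \<open>a\<close>
      from the cosyzygies to the whole terms, while \<open>b\<close> is only composed with the
      inclusion.\<close>
    obtain f' where f': "lin_map S (F k) (E k) f'" "\<And>x. x \<in> carrier (cosyzygy F \<delta> k) \<Longrightarrow> f' x = i x"
      by (rule baer_extend[OF E.E_baer F.cosyzygy F.E F.cosyzygy_incl inj lin_compose[OF i E.cosyzygy_incl]]) blast
    obtain f where f: "lin_map S (E k) (F k) f" "\<And>x. x \<in> carrier (cosyzygy E d k) \<Longrightarrow> f x = p x"
      by (rule baer_extend[OF F.E_baer E.cosyzygy E.E E.cosyzygy_incl inj lin_compose[OF p F.cosyzygy_incl]]) blast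
    obtain \<alpha> where \<alpha>: "lin_map S (F k) J \<alpha>" "\<And>x. x \<in> carrier (cosyzygy F \<delta> k) \<Longrightarrow> \<alpha> x = a x"
      by (rule baer_extend[OF J F.cosyzygy F.E F.cosyzygy_incl inj a]) blast
    have b': "lin_map S J (F k) b" by (rule lin_compose[OF b F.cosyzygy_incl])
    have ff: "lin_map S (F k) (F k) (\<lambda>x. f (f' x))" and b\<alpha>: "lin_map S (F k) (F k) (\<lambda>x. b (\<alpha> x))"
      using lin_compose[OF f'(1) f(1)] lin_compose[OF \<alpha>(1) b'] by auto
    \<comment> \<open>The defect of the homotopy identity on the whole term. It vanishes on the
      cosyzygy and therefore factors through \<open>\<delta> k\<close> as the next
      \<open>a'\<close>; the next auxiliary injective module is \<open>F k\<close>, with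
      \<open>\<delta> k\<close> as its map \<open>b\<close>.\<close>
    define \<theta> where "\<theta> x = x \<ominus>\<^bsub>F k\<^esub> (f (f' x) \<oplus>\<^bsub>F k\<^esub> b (\<alpha> x))" for x
    note cl = lin_closed[OF F.E F.E ff] lin_closed[OF F.E F.E b\<alpha>]
    have \<theta>: "lin_map S (F k) (F k) \<theta>"
      unfolding lin_map_def \<theta>_def
    proof (intro conjI ballI)
      fix x y assume "x \<in> carrier (F k)" "y \<in> carrier (F k)"
      then show "x \<oplus>\<^bsub>F k\<^esub> y \<ominus>\<^bsub>F k\<^esub> (f (f' (x \<oplus>\<^bsub>F k\<^esub> y)) \<oplus>\<^bsub>F k\<^esub> b (\<alpha> (x \<oplus>\<^bsub>F k\<^esub> y))) =
        (x \<ominus>\<^bsub>F k\<^esub> (f (f' x) \<oplus>\<^bsub>F k\<^esub> b (\<alpha> x))) \<oplus>\<^bsub>F k\<^esub> (y \<ominus>\<^bsub>F k\<^esub> (f (f' y) \<oplus>\<^bsub>F k\<^esub> b (\<alpha> y)))"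
        using cl by (simp add: lin_add[OF F.E F.E ff] lin_add[OF F.E F.E b\<alpha>] a_minus_def F0.X.minus_add F0.X.a_ac)
    next
      fix r x assume "r \<in> carrier S" "x \<in> carrier (F k)"
      then show "r \<odot>\<^bsub>F k\<^esub> x \<ominus>\<^bsub>F k\<^esub> (f (f' (r \<odot>\<^bsub>F k\<^esub> x)) \<oplus>\<^bsub>F k\<^esub> b (\<alpha> (r \<odot>\<^bsub>F k\<^esub> x))) =
        r \<odot>\<^bsub>F k\<^esub> (x \<ominus>\<^bsub>F k\<^esub> (f (f' x) \<oplus>\<^bsub>F k\<^esub> b (\<alpha> x)))"
        using cl by (simp add: lin_smult[OF F.E F.E ff] lin_smult[OF F.E F.E b\<alpha>] F0.smult_diff F0.smult_r_distr)
    qed (use cl in simp)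
    have \<theta>0: "\<theta> x = \<zero>\<^bsub>F k\<^esub>" if x: "x \<in> carrier (cosyzygy F \<delta> k)" for x
    proof -
      have "i x \<in> carrier (cosyzygy E d k)" by (rule lin_closed[OF F.cosyzygy E.cosyzygy i x])
      then have "f (f' x) \<oplus>\<^bsub>F k\<^esub> b (\<alpha> x) = x" using id[OF x] f(2) f'(2)[OF x] \<alpha>(2)[OF x] by simp
      then show ?thesis using x by (simp add: \<theta>_def F0.X.diff_eq_zero_iff)
    qed
    have mem: "x \<in> carrier (cosyzygy F \<delta> k)" if "x \<in> carrier (F k)" "\<delta> k x = \<zero>\<^bsub>cosyzygy F \<delta> (Suc k)\<^esub>" for x
      using that by simp
    have mem': "x \<in> carrier (cosyzygy E d k)" if "x \<in> carrier (E k)" "d k x = \<zero>\<^bsub>cosyzygy E d (Suc k)\<^esub>" for x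
      using that by simp
    obtain i' where i': "lin_map S (cosyzygy F \<delta> (Suc k)) (cosyzygy E d (Suc k)) i'"
      "\<And>x. x \<in> carrier (F k) \<Longrightarrow> i' (\<delta> k x) = d k (f' x)"
    proof (rule lin_factor[OF F.E F.cosyzygy E.cosyzygy F.d_cosyzygy F.d_im lin_compose[OF f'(1) E.d_cosyzygy]])
      fix x assume "x \<in> carrier (F k)" "\<delta> k x = \<zero>\<^bsub>cosyzygy F \<delta> (Suc k)\<^esub>"
      then have "x \<in> carrier (cosyzygy F \<delta> k)" by (rule mem)
      then show "d k (f' x) = \<zero>\<^bsub>cosyzygy E d (Suc k)\<^esub>"
        using lin_closed[OF F.cosyzygy E.cosyzygy i] f'(2) by simp
    qed blast
    obtain p' where p': "lin_map S (cosyzygy E d (Suc k)) (cosyzygy F \<delta> (Suc k)) p'"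
      "\<And>x. x \<in> carrier (E k) \<Longrightarrow> p' (d k x) = \<delta> k (f x)"
    proof (rule lin_factor[OF E.E E.cosyzygy F.cosyzygy E.d_cosyzygy E.d_im lin_compose[OF f(1) F.d_cosyzygy]])
      fix x assume "x \<in> carrier (E k)" "d k x = \<zero>\<^bsub>cosyzygy E d (Suc k)\<^esub>"
      then have "x \<in> carrier (cosyzygy E d k)" by (rule mem')
      then show "\<delta> k (f x) = \<zero>\<^bsub>cosyzygy F \<delta> (Suc k)\<^esub>"
        using lin_closed[OF E.cosyzygy F.cosyzygy p] f(2) by simp
    qed blast
    obtain a' where a': "lin_map S (cosyzygy F \<delta> (Suc k)) (F k) a'" "\<And>x. x \<in> carrier (F k) \<Longrightarrow> a' (\<delta> k x) = \<theta> x"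
      by (rule lin_factor[OF F.E F.cosyzygy F.E F.d_cosyzygy F.d_im \<theta>]) (use \<theta>0 mem in blast)+
    \<comment> \<open>Apply \<open>\<delta> k\<close> to
      \<open>x = f (f' x) + b (\<alpha> x) + \<theta> x\<close>; the middle term dies because
      \<open>b\<close> has values in the kernel.\<close>
    have "p' (i' z) \<oplus>\<^bsub>F (Suc k)\<^esub> \<delta> k (a' z) = z" if z: "z \<in> carrier (cosyzygy F \<delta> (Suc k))" for z
    proof -
      obtain x where x: "x \<in> carrier (F k)" "z = \<delta> k x" using z unfolding F.d_im[symmetric] by blast
      have c: "f (f' x) \<in> carrier (F k)" "b (\<alpha> x) \<in> carrier (F k)" "f' x \<in> carrier (E k)"
        using cl x lin_closed[OF F.E E.E f'(1)] by auto
      have "\<delta> k (b (\<alpha> x)) = \<zero>\<^bsub>F (Suc k)\<^esub>"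
        using lin_closed[OF J' F.cosyzygy b] lin_closed[OF F.E J' \<alpha>(1)] x by auto
      then have "\<delta> k (\<theta> x) = \<delta> k x \<ominus>\<^bsub>F (Suc k)\<^esub> \<delta> k (f (f' x))"
        using x c lin_closed[OF F.E F.E F.d]
        by (simp add: \<theta>_def lin_diff[OF F.E F.E F.d] lin_add[OF F.E F.E F.d])
      then show ?thesis
        using x c p'(2) i'(2) a'(2) lin_closed[OF F.E F.E F.d] by (simp add: F1.X.diff_add_cancel)
    qed
    then show ?case using i'(1) p'(1) F.E_baer[of k] a'(1) F.d_cosyzygy[of k] by blast
  qed
qed

text \<open>A form of Schanuel's lemma: one cosyzygy is a direct summand of the other plus an
  injective module. The two resolutions may lie on different types.\<close>

lemma baer_cosyzygy:
  fixes E :: "nat \<Rightarrow> ('s, 'e) module" and F :: "nat \<Rightarrow> ('s, 'f) module"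
  assumes E: "injective_res S Y E \<epsilon> d" and F: "injective_res S Y F \<eta> \<delta>" and k: "baer S (cosyzygy E d k)"
  shows "baer S (cosyzygy F \<delta> k)"
proof -
  interpret F: injective_res S Y F \<eta> \<delta> by (rule F)
  obtain i p and J :: "('s, 'f) module" and a b where
    *: "lin_map S (cosyzygy F \<delta> k) (cosyzygy E d k) i" "lin_map S (cosyzygy E d k) (cosyzygy F \<delta> k) p"
      "lin_map S (cosyzygy F \<delta> k) J a" "lin_map S J (cosyzygy F \<delta> k) b"
    and J: "baer S J" and id: "\<And>x. x \<in> carrier (cosyzygy F \<delta> k) \<Longrightarrow> p (i x) \<oplus>\<^bsub>F k\<^esub> b (a x) = x"
    using cosyzygy_comparison[OF E F, of k] by blast
  show ?thesis by (rule baer_retract[OF k J F.cosyzygy *]) (use id in simp)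
qed

text \<open>An injective cosyzygy can itself be the last nonzero term, since the preceding
  differential, or \<open>\<epsilon>\<close> for \<open>k = 0\<close>, maps onto it.\<close>

lemma (in injective_res) truncated_resolution:
  assumes k: "baer S (cosyzygy E d k)"
  obtains F \<delta> where "injective_resolution S Y F \<epsilon> \<delta>" "\<And>i. i > k \<Longrightarrow> carrier (F i) = {\<zero>\<^bsub>F i\<^esub>}"
proof -
  define F where "F i = (if i < k then E i else if i = k then cosyzygy E d k else E i\<lparr>carrier := {\<zero>\<^bsub>E i\<^esub>}\<rparr>)" for i
  \<comment> \<open>From index \<open>k\<close> on the differential is zero; at \<open>k\<close>
    this is the restriction of \<open>d k\<close> to its kernel.\<close>
  define \<delta> where "\<delta> i = (\<lambda>x\<in>carrier (F i). if i < k then d i x else \<zero>\<^bsub>F (Suc i)\<^esub>)" for i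
  have F_baer: "baer S (F i)" for i
    using k E_baer baer_zero_module[OF E] by (auto simp: F_def)
  then have F: "left_module S (F i)" for i by (simp add: baer_def)
  have zero: "\<zero>\<^bsub>F i\<^esub> = \<zero>\<^bsub>E i\<^esub>" for i by (simp add: F_def)
  have car: "carrier (F i) =
      (if i < k then carrier (E i) else if i = k then carrier (cosyzygy E d k) else {\<zero>\<^bsub>E i\<^esub>})" for i
    by (simp add: F_def)
  have eps_F: "lin_map S Y (F 0) \<epsilon>" using eps eps_cosyzygy by (auto simp: F_def lin_map_def)
  have d_F: "lin_map S (F i) (F (Suc i)) (d i)" if "i < k" for i
    using that d[of i] d_cosyzygy[of i] by (cases "Suc i = k") (auto simp: F_def)
  have ker: "{x \<in> carrier (F i). \<delta> i x = \<zero>\<^bsub>F (Suc i)\<^esub>} = (if i \<le> k then carrier (cosyzygy E d i) else {\<zero>\<^bsub>E i\<^esub>})" for i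
    by (rule linorder_cases[of i k]) (auto simp: \<delta>_def zero car)
  have im: "\<delta> i ` carrier (F i) = (if i < k then carrier (cosyzygy E d (Suc i)) else {\<zero>\<^bsub>E (Suc i)\<^esub>})" for i
  proof (cases "i < k")
    case True
    then show ?thesis using d_im[of i] by (simp add: \<delta>_def car)
  next
    case False
    have "\<zero>\<^bsub>F i\<^esub> \<in> carrier (F i)"
      using F[of i] by (meson left_module.axioms(2) abelian_group.axioms(1) abelian_monoid.zero_closed)
    then show ?thesis using False by (auto simp: \<delta>_def zero)
  qed
  have "injective_resolution S Y F \<epsilon> \<delta>"
    unfolding injective_resolution_def injective_module_iff_baer
  proof (intro conjI allI F_baer)
    show "\<epsilon> \<in> module_hom S Y (F 0)"
      using eps_F res by (auto simp: injective_resolution_def module_hom_iff)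
    show "inj_on \<epsilon> (carrier Y)" by (rule eps_inj)
    show "\<delta> i \<in> module_hom S (F i) (F (Suc i))" for i
      using d_F[of i] lin_zero_map[OF F, of "F i" "Suc i"] F[of i] by (cases "i < k") (auto simp: \<delta>_def)
    show "\<epsilon> ` carrier Y = {x \<in> carrier (F 0). \<delta> 0 x = \<zero>\<^bsub>F 1\<^esub>}"
      using ker[of 0] eps_im by simp
    show "\<delta> i ` carrier (F i) = {x \<in> carrier (F (Suc i)). \<delta> (Suc i) x = \<zero>\<^bsub>F (Suc (Suc i))\<^esub>}" for i
      unfolding im ker by auto
  qed
  moreover have "carrier (F i) = {\<zero>\<^bsub>F i\<^esub>}" if "i > k" for i using that by (simp add: F_def)
  ultimately show thesis using that by blast
qed

text \<open>\<open>inj_dim\<close> quantifies over resolutions on one universe, whereas here a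
  single resolution on any type decides the dimension. This allows resolutions over two rings to be
  compared degree by degree.\<close>

lemma inj_dim_eq:
  fixes Y :: "('s, 'y) module" and E :: "nat \<Rightarrow> ('s, 'e) module"
  assumes E: "injective_res S Y E \<epsilon> d"
  shows "inj_dim S Y = Inf {enat k | k. baer S (cosyzygy E d k)}"
proof -
  interpret E: injective_res S Y E \<epsilon> d by (rule E)
  have "(\<exists>(F :: nat \<Rightarrow> ('s, ('s, 'y) universe) module) \<eta> \<delta>.
      injective_resolution S Y F \<eta> \<delta> \<and> (\<forall>i>k. carrier (F i) = {\<zero>\<^bsub>F i\<^esub>})) \<longleftrightarrow> baer S (cosyzygy E d k)"
    (is "?L \<longleftrightarrow> ?R") for k
  proof
    assume ?L
    then obtain F :: "nat \<Rightarrow> ('s, ('s, 'y) universe) module" and \<eta> \<delta> where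
      res: "injective_resolution S Y F \<eta> \<delta>" and F0: "\<And>i. i > k \<Longrightarrow> carrier (F i) = {\<zero>\<^bsub>F i\<^esub>}" by blast
    have F: "injective_res S Y F \<eta> \<delta>" by (rule injective_res.intro[OF E.Y res])
    interpret F: injective_res S Y F \<eta> \<delta> by (rule F)
    \<comment> \<open>\<open>F (k + 1)\<close> is zero, so the kernel of \<open>\<delta> k\<close>
      is all of \<open>F k\<close>, which is injective.\<close>
    have "carrier (cosyzygy F \<delta> k) = carrier (F k)"
      using lin_closed[OF F.E F.E F.d, of _ k] F0[of "Suc k"] by auto
    then have "cosyzygy F \<delta> k = F k" by (simp add: cosyzygy_def)
    then have "baer S (cosyzygy F \<delta> k)" using F.E_baer by simp
    then show ?R by (rule baer_cosyzygy[OF F E])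
  next
    assume R: ?R
    obtain F :: "nat \<Rightarrow> ('s, ('s, 'y) universe) module" and \<eta> \<delta> where
      res: "injective_resolution S Y F \<eta> \<delta>" using exists_injective_resolution[OF E.Y] by blast
    have F: "injective_res S Y F \<eta> \<delta>" by (rule injective_res.intro[OF E.Y res])
    interpret F: injective_res S Y F \<eta> \<delta> by (rule F)
    have "baer S (cosyzygy F \<delta> k)" by (rule baer_cosyzygy[OF E F R])
    then show ?L by (rule F.truncated_resolution) blast
  qed
  then show ?thesis unfolding inj_dim_def by simp
qed

section \<open>Extensions with nilpotent kernel\<close>

text \<open>The filtration \<open>F\<close> is a witness for the nilpotency of the kernel of \<open>\<pi>\<close>. The section \<open>\<sigma>\<close> is
  only a map of sets.\<close>

locale nilpotent_extension = S: ring S + R: ring R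
  for S :: "'s ring" and R :: "'a ring" +
  fixes \<pi> :: "'s \<Rightarrow> 'a" and \<sigma> :: "'a \<Rightarrow> 's" and F :: "nat \<Rightarrow> 's set" and N :: nat
  assumes hom: "\<pi> \<in> ring_hom S R"
    and sec: "r \<in> carrier R \<Longrightarrow> \<sigma> r \<in> carrier S" "r \<in> carrier R \<Longrightarrow> \<pi> (\<sigma> r) = r"
    and F_0: "F 0 = carrier S" and F_N: "F N = {\<zero>\<^bsub>S\<^esub>}" and F_sub: "F p \<subseteq> carrier S"
    and F_Suc: "\<lbrakk>x \<in> carrier S; \<pi> x = \<zero>\<^bsub>R\<^esub>; b \<in> F p\<rbrakk> \<Longrightarrow> x \<otimes>\<^bsub>S\<^esub> b \<in> F (Suc p)"
begin

lemma \<pi>_simps [simp]: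
  "x \<in> carrier S \<Longrightarrow> \<pi> x \<in> carrier R" "\<pi> \<one>\<^bsub>S\<^esub> = \<one>\<^bsub>R\<^esub>"
  "\<lbrakk>x \<in> carrier S; y \<in> carrier S\<rbrakk> \<Longrightarrow> \<pi> (x \<oplus>\<^bsub>S\<^esub> y) = \<pi> x \<oplus>\<^bsub>R\<^esub> \<pi> y"
  "\<lbrakk>x \<in> carrier S; y \<in> carrier S\<rbrakk> \<Longrightarrow> \<pi> (x \<otimes>\<^bsub>S\<^esub> y) = \<pi> x \<otimes>\<^bsub>R\<^esub> \<pi> y"
  using hom by (auto simp: ring_hom_def)

lemma \<pi>_zero [simp]: "\<pi> \<zero>\<^bsub>S\<^esub> = \<zero>\<^bsub>R\<^esub>"
  by (rule ring_hom_zero[OF hom S.ring_axioms R.ring_axioms])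

lemma \<pi>_diff [simp]: "\<lbrakk>x \<in> carrier S; y \<in> carrier S\<rbrakk> \<Longrightarrow> \<pi> (x \<ominus>\<^bsub>S\<^esub> y) = \<pi> x \<ominus>\<^bsub>R\<^esub> \<pi> y"
  by (rule additive_diff[OF S.abelian_group_axioms R.abelian_group_axioms]) (auto simp: additive_def)

text \<open>The scalar \<open>r\<close> acts through its lift \<open>\<sigma> r\<close>. Two lifts
  differ by an element of the kernel of \<open>\<pi>\<close>, which acts by zero here; so the module
  laws hold although \<open>\<sigma>\<close> need not be a homomorphism.\<close>

definition ann :: "('s, 'e, 'd) module_scheme \<Rightarrow> ('a, 'e) module" where
  "ann E = \<lparr>carrier = {e \<in> carrier E. \<forall>x\<in>carrier S. \<pi> x = \<zero>\<^bsub>R\<^esub> \<longrightarrow> x \<odot>\<^bsub>E\<^esub> e = \<zero>\<^bsub>E\<^esub>},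
     monoid.mult = undefined, one = undefined, ring.zero = \<zero>\<^bsub>E\<^esub>, ring.add = add E, smult = (\<lambda>r e. \<sigma> r \<odot>\<^bsub>E\<^esub> e)\<rparr>"

lemma ann_simps [simp]:
  "\<zero>\<^bsub>ann E\<^esub> = \<zero>\<^bsub>E\<^esub>" "x \<oplus>\<^bsub>ann E\<^esub> y = x \<oplus>\<^bsub>E\<^esub> y"
  by (simp_all add: ann_def)

lemma ann_iff: "e \<in> carrier (ann E) \<longleftrightarrow> e \<in> carrier E \<and> (\<forall>x\<in>carrier S. \<pi> x = \<zero>\<^bsub>R\<^esub> \<longrightarrow> x \<odot>\<^bsub>E\<^esub> e = \<zero>\<^bsub>E\<^esub>)"
  by (simp add: ann_def)

lemma ann_carrier: "e \<in> carrier (ann E) \<Longrightarrow> e \<in> carrier E"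
  by (simp add: ann_iff)

lemma smult_ann_eq:
  assumes E: "left_module S E" and e: "e \<in> carrier (ann E)" and x: "x \<in> carrier S" "y \<in> carrier S" "\<pi> x = \<pi> y"
  shows "x \<odot>\<^bsub>E\<^esub> e = y \<odot>\<^bsub>E\<^esub> e"
proof -
  interpret E: left_module S E by (rule E)
  have "\<pi> (x \<ominus>\<^bsub>S\<^esub> y) = \<zero>\<^bsub>R\<^esub>" using x by (simp add: R.diff_eq_zero_iff)
  then have 0: "(x \<ominus>\<^bsub>S\<^esub> y) \<odot>\<^bsub>E\<^esub> e = \<zero>\<^bsub>E\<^esub>" using e x by (simp add: ann_iff)
  have "x \<odot>\<^bsub>E\<^esub> e = ((x \<ominus>\<^bsub>S\<^esub> y) \<oplus>\<^bsub>S\<^esub> y) \<odot>\<^bsub>E\<^esub> e" using x by (simp add: S.diff_add_cancel)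
  also have "\<dots> = y \<odot>\<^bsub>E\<^esub> e" using e x 0 by (subst E.smult_l_distr) (auto simp: ann_iff E.smult_closed)
  finally show ?thesis .
qed

lemma smult_ann:
  assumes E: "left_module S E" and e: "e \<in> carrier (ann E)" and x: "x \<in> carrier S"
  shows "\<pi> x \<odot>\<^bsub>ann E\<^esub> e = x \<odot>\<^bsub>E\<^esub> e"
  using smult_ann_eq[OF E e _ x, of "\<sigma> (\<pi> x)"] x sec by (simp add: ann_def)

lemma ann_submod:
  assumes E: "left_module S E" shows "submod S E (carrier (ann E))"
proof -
  interpret E: left_module S E by (rule E)
  have "x \<odot>\<^bsub>E\<^esub> (r \<odot>\<^bsub>E\<^esub> e) = \<zero>\<^bsub>E\<^esub>" if "e \<in> carrier (ann E)" "r \<in> carrier S" "x \<in> carrier S" "\<pi> x = \<zero>\<^bsub>R\<^esub>" for e r x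
    using that E.smult_assoc[of x r e] by (simp add: ann_iff)
  then show ?thesis
    by (auto simp: submod_def ann_iff E.smult_closed E.smult_r_distr)
qed

lemma left_module_ann:
  assumes E: "left_module S E" shows "left_module R (ann E)"
proof -
  interpret E: left_module S E by (rule E)
  note sub = submodD[OF ann_submod[OF E]]
  have A: "left_module S (E\<lparr>carrier := carrier (ann E)\<rparr>)" by (rule E.left_module_submod[OF ann_submod[OF E]])
  interpret A: left_module S "E\<lparr>carrier := carrier (ann E)\<rparr>" by (rule A)
  have sm: "r \<odot>\<^bsub>ann E\<^esub> e = \<sigma> r \<odot>\<^bsub>E\<^esub> e" for r e by (simp add: ann_def)
  show ?thesis
  proof (rule left_moduleI[OF R.ring_axioms])
    fix x assume x: "x \<in> carrier (ann E)"
    show "\<exists>y\<in>carrier (ann E). y \<oplus>\<^bsub>ann E\<^esub> x = \<zero>\<^bsub>ann E\<^esub>"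
      using E.submod_minus[OF ann_submod[OF E] x] x by (intro bexI[of _ "\<ominus>\<^bsub>E\<^esub> x"]) (auto simp: E.X.l_neg ann_carrier)
    show "\<one>\<^bsub>R\<^esub> \<odot>\<^bsub>ann E\<^esub> x = x" using smult_ann[OF E x, of "\<one>\<^bsub>S\<^esub>"] x by (simp add: E.smult_one ann_carrier)
  next
    fix r s x assume *: "r \<in> carrier R" "s \<in> carrier R" "x \<in> carrier (ann E)"
    show "(r \<oplus>\<^bsub>R\<^esub> s) \<odot>\<^bsub>ann E\<^esub> x = r \<odot>\<^bsub>ann E\<^esub> x \<oplus>\<^bsub>ann E\<^esub> s \<odot>\<^bsub>ann E\<^esub> x"
      using smult_ann[OF E *(3), of "\<sigma> r \<oplus>\<^bsub>S\<^esub> \<sigma> s"] * sec by (simp add: sm E.smult_l_distr ann_carrier)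
    show "(r \<otimes>\<^bsub>R\<^esub> s) \<odot>\<^bsub>ann E\<^esub> x = r \<odot>\<^bsub>ann E\<^esub> (s \<odot>\<^bsub>ann E\<^esub> x)"
      using smult_ann[OF E *(3), of "\<sigma> r \<otimes>\<^bsub>S\<^esub> \<sigma> s"] * sec by (simp add: sm E.smult_assoc ann_carrier)
  qed (use sub sec in \<open>auto simp: sm E.X.a_ac ann_carrier E.smult_r_distr\<close>)
qed

lemma lin_ann:
  assumes E: "left_module S E" and E': "left_module S E'" and f: "lin_map S E E' f"
  shows "lin_map R (ann E) (ann E') f"
  unfolding lin_map_def
proof (intro conjI ballI)
  fix e assume e: "e \<in> carrier (ann E)"
  show "f e \<in> carrier (ann E')"
    using e lin_closed[OF E E' f] lin_zero[OF E E' f] by (auto simp: ann_iff simp flip: lin_smult[OF E E' f])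
  fix r assume r: "r \<in> carrier R"
  show "f (r \<odot>\<^bsub>ann E\<^esub> e) = r \<odot>\<^bsub>ann E'\<^esub> f e"
    using e r sec lin_smult[OF E E' f] by (simp add: ann_def)
qed (simp add: lin_add[OF E E' f] ann_carrier)

text \<open>A homomorphism from a left ideal \<open>I\<close> of \<open>R\<close> is pulled back
  along \<open>\<pi>\<close> to the preimage of \<open>I\<close>, which contains the kernel. The
  Baer element over \<open>S\<close> is annihilated by that kernel because \<open>h 0 = 0\<close>,
  so it lies in \<open>ann E\<close>.\<close>

lemma baer_ann:
  assumes E: "baer S E" shows "baer R (ann E)"
proof -
  have E': "left_module S E" using E by (simp add: baer_def)
  interpret E: left_module S E by (rule E')
  note A = left_module_ann[OF E']
  show ?thesis
    unfolding baer_def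
  proof (intro conjI allI impI A)
    fix I h assume *: "submod R (regular_module R) I \<and> lin_map R (regular_module R\<lparr>carrier := I\<rparr>) (ann E) h"
    let ?J = "{x \<in> carrier S. \<pi> x \<in> I}"
    have h: "\<And>a. a \<in> I \<Longrightarrow> h a \<in> carrier (ann E)" using * by (auto simp: lin_map_def)
    have h0: "h \<zero>\<^bsub>R\<^esub> = \<zero>\<^bsub>E\<^esub>"
      using lin_zero[OF left_module.left_module_submod[OF left_module_regular[OF R.ring_axioms]] A] * by fastforce
    have J: "submod S (regular_module S) ?J" using * by (auto simp: submod_def)
    moreover have "lin_map S (regular_module S\<lparr>carrier := ?J\<rparr>) E (\<lambda>x. h (\<pi> x))"
      using * h smult_ann[OF E' h] by (auto simp: lin_map_def ann_carrier)
    ultimately obtain e where e: "e \<in> carrier E" "\<And>x. x \<in> ?J \<Longrightarrow> h (\<pi> x) = x \<odot>\<^bsub>E\<^esub> e"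
      using E unfolding baer_def by blast
    have "x \<odot>\<^bsub>E\<^esub> e = \<zero>\<^bsub>E\<^esub>" if "x \<in> carrier S" "\<pi> x = \<zero>\<^bsub>R\<^esub>" for x
      using e(2)[of x] that h0 * by (auto simp: submod_def)
    then have eA: "e \<in> carrier (ann E)" using e by (simp add: ann_iff)
    have "h a = a \<odot>\<^bsub>ann E\<^esub> e" if a: "a \<in> I" for a
    proof -
      have "a \<in> carrier R" using a * by (auto simp: submod_def)
      then show ?thesis using e(2)[of "\<sigma> a"] a sec smult_ann[OF E' eA, of "\<sigma> a"] by simp
    qed
    then show "\<exists>e\<in>carrier (ann E). \<forall>a\<in>I. h a = a \<odot>\<^bsub>ann E\<^esub> e" using eA by blast
  qed
qed

end

text \<open>The assumption \<open>exact\<close> is the vanishing of Ext in positive degrees, put in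
  terms of elements: the complex of the modules \<open>ann (E i)\<close> is exact in every degree at
  least 1.\<close>

locale ann_exact = nilpotent_extension S R \<pi> \<sigma> F N + injective_res S Y E \<epsilon> d
  for S :: "'s ring" and R :: "'a ring" and \<pi> \<sigma> F N and Y :: "('s, 'y) module" and E :: "nat \<Rightarrow> ('s, 'e) module" and \<epsilon> d +
  assumes exact: "\<lbrakk>e \<in> carrier (ann (E (Suc i))); d (Suc i) e = \<zero>\<^bsub>E (Suc (Suc i))\<^esub>\<rbrakk> \<Longrightarrow>
    \<exists>e'\<in>carrier (ann (E i)). d i e' = e"
begin

section \<open>The complex of annihilated elements\<close>

definition ann_d where "ann_d i = restrict (d i) (carrier (ann (E i)))"

lemma d_d: "x \<in> carrier (E i) \<Longrightarrow> d (Suc i) (d i x) = \<zero>\<^bsub>E (Suc (Suc i))\<^esub>"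
  using d_im[of i] by auto

lemma ann_d_im:
  "ann_d i ` carrier (ann (E i)) = {x \<in> carrier (ann (E (Suc i))). ann_d (Suc i) x = \<zero>\<^bsub>ann (E (Suc (Suc i)))\<^esub>}"
proof
  show "ann_d i ` carrier (ann (E i)) \<subseteq> {x \<in> carrier (ann (E (Suc i))). ann_d (Suc i) x = \<zero>\<^bsub>ann (E (Suc (Suc i)))\<^esub>}"
    using lin_closed[OF left_module_ann[OF E] left_module_ann[OF E] lin_ann[OF E E d]] d_d
    by (auto simp: ann_d_def ann_carrier)
qed (use exact in \<open>force simp: ann_d_def\<close>)

text \<open>\<open>N0\<close> stands for any module with the carrier and the operations of
  \<open>ann Y\<close>, whose record need not equal \<open>ann Y\<close>. The kernel of
  \<open>g\<close> comes as such a module.\<close>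

lemma ann_resolution:
  fixes N0 :: "('a, 'y) module"
  assumes N0: "left_module R N0" and car: "carrier N0 = carrier (ann Y)"
    and add: "\<And>x y. \<lbrakk>x \<in> carrier N0; y \<in> carrier N0\<rbrakk> \<Longrightarrow> x \<oplus>\<^bsub>N0\<^esub> y = x \<oplus>\<^bsub>Y\<^esub> y"
    and smult: "\<And>x y. \<lbrakk>x \<in> carrier S; y \<in> carrier N0\<rbrakk> \<Longrightarrow> \<pi> x \<odot>\<^bsub>N0\<^esub> y = x \<odot>\<^bsub>Y\<^esub> y"
  shows "injective_res R N0 (\<lambda>i. ann (E i)) (restrict \<epsilon> (carrier N0)) ann_d"
proof (rule injective_res.intro[OF N0])
  let ?\<epsilon> = "restrict \<epsilon> (carrier N0)"
  have NY: "y \<in> carrier Y" if "y \<in> carrier N0" for y using that by (simp add: car ann_carrier)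
  have idY: "lin_map R N0 (ann Y) (\<lambda>y. y)"
    unfolding lin_map_def
  proof (intro conjI ballI)
    fix r y assume "r \<in> carrier R" "y \<in> carrier N0"
    then show "r \<odot>\<^bsub>N0\<^esub> y = r \<odot>\<^bsub>ann Y\<^esub> y" using smult[of "\<sigma> r" y] sec by (simp add: ann_def)
  qed (use add car in auto)
  have im: "\<epsilon> ` carrier N0 = {x \<in> carrier (ann (E 0)). d 0 x = \<zero>\<^bsub>E 1\<^esub>}"
  proof
    show "\<epsilon> ` carrier N0 \<subseteq> {x \<in> carrier (ann (E 0)). d 0 x = \<zero>\<^bsub>E 1\<^esub>}"
      using lin_closed[OF left_module_ann[OF Y] left_module_ann[OF E] lin_ann[OF Y E eps]] eps_im NY
      by (auto simp: car)
    show "{x \<in> carrier (ann (E 0)). d 0 x = \<zero>\<^bsub>E 1\<^esub>} \<subseteq> \<epsilon> ` carrier N0"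
    proof
      fix e assume e: "e \<in> {x \<in> carrier (ann (E 0)). d 0 x = \<zero>\<^bsub>E 1\<^esub>}"
      then have "e \<in> \<epsilon> ` carrier Y" using eps_im by (auto simp: ann_carrier)
      then obtain y where y: "y \<in> carrier Y" "e = \<epsilon> y" by blast
      \<comment> \<open>\<open>\<epsilon>\<close> is injective, so whatever annihilates
        \<open>\<epsilon> y\<close> annihilates \<open>y\<close>.\<close>
      have "x \<odot>\<^bsub>Y\<^esub> y = \<zero>\<^bsub>Y\<^esub>" if x: "x \<in> carrier S" "\<pi> x = \<zero>\<^bsub>R\<^esub>" for x
      proof -
        have "\<epsilon> (x \<odot>\<^bsub>Y\<^esub> y) = \<zero>\<^bsub>E 0\<^esub>" using lin_smult[OF Y E eps x(1) y(1)] e y x by (simp add: ann_iff)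
        then show ?thesis
          using lin_inj[OF Y E eps] eps_inj left_module.smult_closed[OF Y x(1) y(1)] by blast
      qed
      then show "e \<in> \<epsilon> ` carrier N0" using y car by (auto simp: ann_iff)
    qed
  qed
  show "injective_resolution R N0 (\<lambda>i. ann (E i)) ?\<epsilon> ann_d"
    unfolding injective_resolution_def injective_module_iff_baer
  proof (intro conjI allI baer_ann E_baer ann_d_im)
    show "?\<epsilon> \<in> module_hom R N0 (ann (E 0))"
      using lin_compose[OF idY lin_ann[OF Y E eps]] N0 by simp
    show "inj_on ?\<epsilon> (carrier N0)" using eps_inj NY by (auto simp: inj_on_def)
    show "ann_d i \<in> module_hom R (ann (E i)) (ann (E (Suc i)))" for i
      using lin_ann[OF E E d] left_module_ann[OF E] by (simp add: ann_d_def)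
    show "?\<epsilon> ` carrier N0 = {x \<in> carrier (ann (E 0)). ann_d 0 x = \<zero>\<^bsub>ann (E 1)\<^esub>}"
      using im by (auto simp: ann_d_def)
  qed
qed

text \<open>Taking annihilated elements is left exact: it commutes with kernels, here as an equality
  of records.\<close>

lemma ann_cosyzygy: "cosyzygy (\<lambda>i. ann (E i)) ann_d k = ann (cosyzygy E d k)"
  by (auto simp: cosyzygy_def ann_def ann_d_def)

text \<open>By injectivity the inclusion of \<open>ann (cosyzygy E d k)\<close> into
  \<open>ann (E k)\<close> has a retraction \<open>\<rho>\<close>. Then \<open>x - \<rho> x\<close>
  vanishes on the kernel of \<open>d k\<close>, so it factors through \<open>d k\<close> as a
  section \<open>s\<close>. Its linearity is stated over \<open>S\<close>, ready for use on left
  ideals of \<open>S\<close>.\<close>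

lemma split_cosyzygy:
  assumes inj: "baer R (ann (cosyzygy E d k))"
  obtains s where "\<And>c. c \<in> carrier (ann (cosyzygy E d (Suc k))) \<Longrightarrow> s c \<in> carrier (E k)"
    "\<And>c. c \<in> carrier (ann (cosyzygy E d (Suc k))) \<Longrightarrow> d k (s c) = c"
    "\<And>c c'. \<lbrakk>c \<in> carrier (ann (cosyzygy E d (Suc k))); c' \<in> carrier (ann (cosyzygy E d (Suc k)))\<rbrakk> \<Longrightarrow>
      s (c \<oplus>\<^bsub>E (Suc k)\<^esub> c') = s c \<oplus>\<^bsub>E k\<^esub> s c'"
    "\<And>x c. \<lbrakk>x \<in> carrier S; c \<in> carrier (ann (cosyzygy E d (Suc k)))\<rbrakk> \<Longrightarrow> s (x \<odot>\<^bsub>E (Suc k)\<^esub> c) = x \<odot>\<^bsub>E k\<^esub> s c"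
    "s \<zero>\<^bsub>E (Suc k)\<^esub> = \<zero>\<^bsub>E k\<^esub>"
proof -
  let ?A = "ann (E k)" and ?Z = "ann (cosyzygy E d k)" and ?C = "ann (cosyzygy E d (Suc k))"
  note A = left_module_ann[OF E, of k] and Z = left_module_ann[OF cosyzygy, of k] and C = left_module_ann[OF cosyzygy, of "Suc k"]
  interpret A: left_module R ?A by (rule A)
  interpret Ek: left_module S "E k" by (rule E)
  have incl: "lin_map R ?Z ?A (\<lambda>x. x)" by (rule lin_ann[OF cosyzygy E cosyzygy_incl])
  have idZ: "lin_map R ?Z ?Z (\<lambda>x. x)" using left_module.submod_carrier[OF Z] by (auto simp: lin_map_def)
  obtain \<rho> where \<rho>: "lin_map R ?A ?Z \<rho>" "\<And>z. z \<in> carrier ?Z \<Longrightarrow> \<rho> z = z"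
    by (rule baer_extend[OF inj Z A incl _ idZ]) auto
  have dC: "lin_map R ?A ?C (d k)" by (rule lin_ann[OF E cosyzygy d_cosyzygy])
  \<comment> \<open>Surjectivity onto the next cosyzygy is where the exactness assumption
    enters.\<close>
  have im: "d k ` carrier ?A = carrier ?C"
    using ann_d_im[of k] by (auto simp: ann_d_def ann_iff)
  have \<rho>A: "lin_map R ?A ?A \<rho>" by (rule lin_compose[OF \<rho>(1) incl])
  note \<rho>c = lin_closed[OF A A \<rho>A]
  have lin: "lin_map R ?A ?A (\<lambda>x. x \<ominus>\<^bsub>?A\<^esub> \<rho> x)"
    unfolding lin_map_def
    using \<rho>c by (auto simp: lin_add[OF A A \<rho>A] lin_smult[OF A A \<rho>A] A.smult_diff A.smult_closed
       A.X.add_diff_add simp del: ann_simps)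
  obtain s where s: "lin_map R ?C ?A s" "\<And>x. x \<in> carrier ?A \<Longrightarrow> s (d k x) = x \<ominus>\<^bsub>?A\<^esub> \<rho> x"
  proof (rule lin_factor[OF A C A dC im lin])
    fix x assume "x \<in> carrier ?A" "d k x = \<zero>\<^bsub>?C\<^esub>"
    then have "x \<in> carrier ?Z" by (simp add: ann_iff)
    then show "x \<ominus>\<^bsub>?A\<^esub> \<rho> x = \<zero>\<^bsub>?A\<^esub>" using \<rho>(2) \<open>x \<in> carrier ?A\<close> A.X.diff_eq_zero_iff[of x x] by simp
  qed blast
  show thesis
  proof (rule that[of s])
    fix c assume c: "c \<in> carrier ?C"
    then have sA: "s c \<in> carrier ?A" by (rule lin_closed[OF C A s(1)])
    then show "s c \<in> carrier (E k)" by (rule ann_carrier)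
    obtain x where x: "x \<in> carrier ?A" "c = d k x" using c im by blast
    have "d k (\<rho> x) = \<zero>\<^bsub>?C\<^esub>" using lin_closed[OF A Z \<rho>(1) x(1)] by (simp add: ann_iff)
    moreover have "d k (x \<ominus>\<^bsub>?A\<^esub> \<rho> x) = d k x \<ominus>\<^bsub>?C\<^esub> d k (\<rho> x)"
      using x \<rho>c by (intro lin_diff[OF A C dC])
    ultimately have "d k (s c) = c \<ominus>\<^bsub>?C\<^esub> \<zero>\<^bsub>?C\<^esub>" using x s(2) by simp
    moreover have "c \<ominus>\<^bsub>?C\<^esub> \<zero>\<^bsub>?C\<^esub> = c"
    proof -
      interpret C: left_module R ?C by (rule C)
      show ?thesis using C.X.diff_add_cancel(1)[OF c, of "\<zero>\<^bsub>?C\<^esub>"] c by (simp del: ann_simps)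
    qed
    ultimately show "d k (s c) = c" by simp
    show "s (x \<odot>\<^bsub>E (Suc k)\<^esub> c) = x \<odot>\<^bsub>E k\<^esub> s c" if x: "x \<in> carrier S" for x
      using lin_smult[OF C A s(1) _ c, of "\<pi> x"] x smult_ann[OF cosyzygy c x] smult_ann[OF E sA x] by simp
    show "s (c \<oplus>\<^bsub>E (Suc k)\<^esub> c') = s c \<oplus>\<^bsub>E k\<^esub> s c'" if "c' \<in> carrier ?C" for c'
      using lin_add[OF C A s(1) c that] by simp
  next
    show "s \<zero>\<^bsub>E (Suc k)\<^esub> = \<zero>\<^bsub>E k\<^esub>" using lin_zero[OF C A s(1)] by simp
  qed
qed

text \<open>A homomorphism from a left ideal \<^term>\<open>A\<close> extends to those \<^term>\<open>b\<close> that the kernel of \<^term>\<open>\<pi>\<close>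
  multiplies into \<^term>\<open>A\<close>: an extension with values in \<^term>\<open>E k\<close> is corrected by the
  section of the differential.\<close>

lemma baer_cosyzygy_ann:
  assumes inj: "baer R (ann (cosyzygy E d k))"
  shows "baer S (cosyzygy E d k)"
proof -
  let ?Z = "cosyzygy E d k" and ?C = "carrier (ann (cosyzygy E d (Suc k)))"
  interpret Ek: left_module S "E k" by (rule E)
  interpret E1: left_module S "E (Suc k)" by (rule E)
  interpret Z: left_module S ?Z by (rule cosyzygy)
  obtain s where sc: "\<And>c. c \<in> ?C \<Longrightarrow> s c \<in> carrier (E k)" and ds: "\<And>c. c \<in> ?C \<Longrightarrow> d k (s c) = c"
    and s_add: "\<And>c c'. \<lbrakk>c \<in> ?C; c' \<in> ?C\<rbrakk> \<Longrightarrow> s (c \<oplus>\<^bsub>E (Suc k)\<^esub> c') = s c \<oplus>\<^bsub>E k\<^esub> s c'"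
    and s_smult: "\<And>x c. \<lbrakk>x \<in> carrier S; c \<in> ?C\<rbrakk> \<Longrightarrow> s (x \<odot>\<^bsub>E (Suc k)\<^esub> c) = x \<odot>\<^bsub>E k\<^esub> s c"
    and s_0: "s \<zero>\<^bsub>E (Suc k)\<^esub> = \<zero>\<^bsub>E k\<^esub>"
    by (rule split_cosyzygy[OF inj]) blast
  \<comment> \<open>The index \<open>p\<close> measures how far \<open>A\<close> is from
    \<open>S\<close>: \<open>F 0 \<subseteq> A\<close> means that \<open>A\<close> is all of
    \<open>S\<close>, while \<open>F N\<close> is zero and lies in every left ideal, so
    \<open>p = N\<close> covers all of them.\<close>
  have main: "\<exists>e\<in>carrier ?Z. \<forall>x\<in>A. h x = x \<odot>\<^bsub>E k\<^esub> e"
    if "submod S (regular_module S) A" "lin_map S (regular_module S\<lparr>carrier := A\<rparr>) ?Z h" "F p \<subseteq> A" for A h p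
    using that
  proof (induction p arbitrary: A h)
    case 0
    then have A: "carrier S \<subseteq> A" by (simp add: F_0)
    have "h x = x \<odot>\<^bsub>E k\<^esub> h \<one>\<^bsub>S\<^esub>" if "x \<in> A" for x
    proof -
      have xS: "x \<in> carrier S" using that 0(1) by (auto simp: submod_def)
      have "\<forall>r\<in>carrier S. \<forall>x\<in>A. h (r \<otimes>\<^bsub>S\<^esub> x) = r \<odot>\<^bsub>E k\<^esub> h x"
        using 0(2) by (simp add: lin_map_def)
      moreover have "\<one>\<^bsub>S\<^esub> \<in> A" using A by auto
      ultimately have "h (x \<otimes>\<^bsub>S\<^esub> \<one>\<^bsub>S\<^esub>) = x \<odot>\<^bsub>E k\<^esub> h \<one>\<^bsub>S\<^esub>" using xS by blast
      then show ?thesis using xS by simp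
    qed
    moreover have "h \<one>\<^bsub>S\<^esub> \<in> carrier ?Z" using 0(2) A unfolding lin_map_def by auto
    ultimately show ?case by blast
  next
    case (Suc p)
    note AD = submodD[OF Suc.prems(1), simplified]
    have hZ: "h x \<in> carrier (E k)" "d k (h x) = \<zero>\<^bsub>E (Suc k)\<^esub>" if "x \<in> A" for x
      using Suc.prems(2) that by (auto simp: lin_map_def)
    have "lin_map S (regular_module S\<lparr>carrier := A\<rparr>) (E k) h"
      by (rule lin_compose[OF Suc.prems(2) cosyzygy_incl])
    \<comment> \<open>Injectivity is available for \<open>E k\<close> only, so multiples of
      \<open>e\<close> outside \<open>A\<close> may leave the cosyzygy.\<close>
    then obtain e where e: "e \<in> carrier (E k)" "\<And>x. x \<in> A \<Longrightarrow> h x = x \<odot>\<^bsub>E k\<^esub> e"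
      using E_baer[of k] Suc.prems(1) unfolding baer_def by blast
    define B where "B = {b \<in> carrier S. \<forall>x\<in>carrier S. \<pi> x = \<zero>\<^bsub>R\<^esub> \<longrightarrow> x \<otimes>\<^bsub>S\<^esub> b \<in> A}"
    have AB: "A \<subseteq> B" using AD by (auto simp: B_def)
    have BS: "b \<in> carrier S" if "b \<in> B" for b using that by (simp add: B_def)
    have Bsm: "r \<otimes>\<^bsub>S\<^esub> b \<in> B" if r: "r \<in> carrier S" and b: "b \<in> B" for r b
      unfolding B_def
    proof (intro CollectI conjI ballI impI)
      fix x assume x: "x \<in> carrier S" "\<pi> x = \<zero>\<^bsub>R\<^esub>"
      have "(x \<otimes>\<^bsub>S\<^esub> r) \<otimes>\<^bsub>S\<^esub> b \<in> A" using b x r by (simp add: B_def)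
      then show "x \<otimes>\<^bsub>S\<^esub> (r \<otimes>\<^bsub>S\<^esub> b) \<in> A" using x r BS[OF b] by (simp add: S.m_assoc)
    qed (use r BS[OF b] in simp)
    have Badd: "b \<oplus>\<^bsub>S\<^esub> b' \<in> B" if "b \<in> B" "b' \<in> B" for b b'
      using that AD by (auto simp: B_def S.r_distr)
    have B: "submod S (regular_module S) B"
      using Bsm Badd BS AB AD by (auto simp: submod_def)
    \<comment> \<open>For \<open>x\<close> in the kernel of \<open>\<pi>\<close> the product
      \<open>x b\<close> lies in \<open>A\<close>, where \<open>h\<close> has values in the kernel
      of \<open>d k\<close>; so \<open>x\<close> annihilates \<open>d k (b e)\<close>.\<close>
    have beC: "d k (b \<odot>\<^bsub>E k\<^esub> e) \<in> ?C" if b: "b \<in> B" for b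
    proof -
      have be: "b \<odot>\<^bsub>E k\<^esub> e \<in> carrier (E k)" using e BS[OF b] by (simp add: Ek.smult_closed)
      have "x \<odot>\<^bsub>E (Suc k)\<^esub> d k (b \<odot>\<^bsub>E k\<^esub> e) = \<zero>\<^bsub>E (Suc k)\<^esub>" if x: "x \<in> carrier S" "\<pi> x = \<zero>\<^bsub>R\<^esub>" for x
      proof -
        have xb: "x \<otimes>\<^bsub>S\<^esub> b \<in> A" using b x by (simp add: B_def)
        have "x \<odot>\<^bsub>E (Suc k)\<^esub> d k (b \<odot>\<^bsub>E k\<^esub> e) = d k ((x \<otimes>\<^bsub>S\<^esub> b) \<odot>\<^bsub>E k\<^esub> e)"
          using x be e BS[OF b] by (simp add: lin_smult[OF E E d] Ek.smult_assoc)
        then show ?thesis using e(2)[OF xb] hZ(2)[OF xb] by simp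
      qed
      then show ?thesis using d_d[OF be] lin_closed[OF E E d be] by (simp add: ann_iff)
    qed
    \<comment> \<open>Subtracting the section of the differential moves the value into the cosyzygy.
      On \<open>A\<close> the differential is already zero, so \<open>h'\<close> agrees with
      \<open>h\<close> there.\<close>
    define h' where "h' b = b \<odot>\<^bsub>E k\<^esub> e \<ominus>\<^bsub>E k\<^esub> s (d k (b \<odot>\<^bsub>E k\<^esub> e))" for b
    have c1: "b \<odot>\<^bsub>E k\<^esub> e \<in> carrier (E k)" "s (d k (b \<odot>\<^bsub>E k\<^esub> e)) \<in> carrier (E k)" if "b \<in> B" for b
      using e BS[OF that] sc[OF beC[OF that]] by (auto simp: Ek.smult_closed)
    have h'Z: "h' b \<in> carrier ?Z" if b: "b \<in> B" for b
    proof -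
      have "d k (h' b) = d k (b \<odot>\<^bsub>E k\<^esub> e) \<ominus>\<^bsub>E (Suc k)\<^esub> d k (b \<odot>\<^bsub>E k\<^esub> e)"
        unfolding h'_def using c1[OF b] by (simp add: lin_diff[OF E E d] ds[OF beC[OF b]])
      also have "\<dots> = \<zero>\<^bsub>E (Suc k)\<^esub>" using lin_closed[OF E E d c1(1)[OF b]] by (simp add: E1.X.diff_eq_zero_iff)
      finally show ?thesis using c1[OF b] by (simp add: h'_def)
    qed
    have h': "lin_map S (regular_module S\<lparr>carrier := B\<rparr>) ?Z h'"
      unfolding lin_map_def
    proof (intro conjI ballI)
      fix b b' assume "b \<in> carrier (regular_module S\<lparr>carrier := B\<rparr>)" "b' \<in> carrier (regular_module S\<lparr>carrier := B\<rparr>)"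
      then have b: "b \<in> B" "b' \<in> B" by auto
      have "h' (b \<oplus>\<^bsub>S\<^esub> b') = h' b \<oplus>\<^bsub>E k\<^esub> h' b'"
        unfolding h'_def using b c1 BS e beC
        by (simp add: Ek.smult_l_distr lin_add[OF E E d] s_add Ek.X.add_diff_add)
      then show "h' (b \<oplus>\<^bsub>regular_module S\<lparr>carrier := B\<rparr>\<^esub> b') = h' b \<oplus>\<^bsub>?Z\<^esub> h' b'" by simp
    next
      fix r b assume "r \<in> carrier S" "b \<in> carrier (regular_module S\<lparr>carrier := B\<rparr>)"
      then have r: "r \<in> carrier S" "b \<in> B" by auto
      have "h' (r \<otimes>\<^bsub>S\<^esub> b) = r \<odot>\<^bsub>E k\<^esub> h' b"
        unfolding h'_def using r c1 BS e beC
        by (simp add: Ek.smult_assoc lin_smult[OF E E d] s_smult Ek.smult_diff)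
      then show "h' (r \<odot>\<^bsub>regular_module S\<lparr>carrier := B\<rparr>\<^esub> b) = r \<odot>\<^bsub>?Z\<^esub> h' b" by simp
    qed (use h'Z in simp)
    \<comment> \<open>The kernel of \<open>\<pi>\<close> multiplies \<open>F p\<close> into
      \<open>F (p + 1)\<close>, which is contained in \<open>A\<close>.\<close>
    have "F p \<subseteq> B" using F_Suc Suc.prems(3) F_sub[of p] unfolding B_def by blast
    then obtain e' where e': "e' \<in> carrier ?Z" "\<And>x. x \<in> B \<Longrightarrow> h' x = x \<odot>\<^bsub>E k\<^esub> e'"
      using Suc.IH[OF B h'] by blast
    have "h x = h' x" if x: "x \<in> A" for x
      using hZ[OF x] e(2)[OF x] Ek.X.diff_add_cancel(1)[of "h x" "\<zero>\<^bsub>E k\<^esub>"] by (simp add: h'_def s_0)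
    then show ?case using e' AB by (intro bexI[of _ e']) auto
  qed
  show ?thesis
    unfolding baer_def
  proof (intro conjI allI impI cosyzygy)
    fix A h assume "submod S (regular_module S) A \<and> lin_map S (regular_module S\<lparr>carrier := A\<rparr>) ?Z h"
    then show "\<exists>e\<in>carrier ?Z. \<forall>x\<in>A. h x = x \<odot>\<^bsub>?Z\<^esub> e"
      using main[of A h N] by (auto simp: F_N submod_def)
  qed
qed

text \<open>One resolution \<open>E\<close> computes both sides, by itself over \<open>S\<close> and
  through its annihilated elements over \<open>R\<close>, and injectivity of the cosyzygies agrees
  in every degree.\<close>

theorem inj_dim_ann:
  fixes N0 :: "('a, 'y) module"
  assumes N0: "left_module R N0" "carrier N0 = carrier (ann Y)"
    "\<And>x y. \<lbrakk>x \<in> carrier N0; y \<in> carrier N0\<rbrakk> \<Longrightarrow> x \<oplus>\<^bsub>N0\<^esub> y = x \<oplus>\<^bsub>Y\<^esub> y"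
    "\<And>x y. \<lbrakk>x \<in> carrier S; y \<in> carrier N0\<rbrakk> \<Longrightarrow> \<pi> x \<odot>\<^bsub>N0\<^esub> y = x \<odot>\<^bsub>Y\<^esub> y"
  shows "inj_dim S Y = inj_dim R N0"
proof -
  have "baer S (cosyzygy E d k) \<longleftrightarrow> baer R (ann (cosyzygy E d k))" for k
    using baer_ann baer_cosyzygy_ann by blast
  then show ?thesis
    using inj_dim_eq[OF injective_res_axioms] inj_dim_eq[OF ann_resolution[OF N0]] by (simp add: ann_cosyzygy)
qed

end

section \<open>Tensor products\<close>

lemma transport_simps:
  assumes "inj_on f (carrier X)"
  shows "carrier (transport f X) = f ` carrier X" "\<zero>\<^bsub>transport f X\<^esub> = f \<zero>\<^bsub>X\<^esub>"
    "\<lbrakk>x \<in> carrier X; y \<in> carrier X\<rbrakk> \<Longrightarrow> f x \<oplus>\<^bsub>transport f X\<^esub> f y = f (x \<oplus>\<^bsub>X\<^esub> y)"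
    "x \<in> carrier X \<Longrightarrow> r \<odot>\<^bsub>transport f X\<^esub> f x = f (r \<odot>\<^bsub>X\<^esub> x)"
  using assms by (simp_all add: transport_def Let_def)

lemma left_module_transport:
  assumes X: "left_module S X" and f: "inj_on f (carrier X)"
  shows "left_module S (transport f X)"
  by (rule left_module_image[OF X transport_simps(1)[OF f] transport_simps(2)[OF f, symmetric]
    transport_simps(3)[OF f, symmetric] transport_simps(4)[OF f, symmetric]])

text \<open>The tensor product of a right and a left module is universal for such maps into abelian
  groups. Left scalars, which come from the bimodule structure of \<open>M\<close>, are treated
  separately.\<close>

definition balanced ::
  "'a ring \<Rightarrow> ('a, 'm) bimodule \<Rightarrow> ('a, 't) module \<Rightarrow> ('g, 'd) ring_scheme \<Rightarrow> ('m \<Rightarrow> 't \<Rightarrow> 'g) \<Rightarrow> bool" where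
  "balanced R M N G \<beta> \<longleftrightarrow>
    (\<forall>m\<in>carrier M. \<forall>t\<in>carrier N. \<beta> m t \<in> carrier G) \<and>
    (\<forall>m\<in>carrier M. \<forall>m'\<in>carrier M. \<forall>t\<in>carrier N. \<beta> (m \<oplus>\<^bsub>M\<^esub> m') t = \<beta> m t \<oplus>\<^bsub>G\<^esub> \<beta> m' t) \<and>
    (\<forall>m\<in>carrier M. \<forall>t\<in>carrier N. \<forall>t'\<in>carrier N. \<beta> m (t \<oplus>\<^bsub>N\<^esub> t') = \<beta> m t \<oplus>\<^bsub>G\<^esub> \<beta> m t') \<and>
    (\<forall>m\<in>carrier M. \<forall>r\<in>carrier R. \<forall>t\<in>carrier N. \<beta> (m \<odot>r\<^bsub>M\<^esub> r) t = \<beta> m (r \<odot>\<^bsub>N\<^esub> t))"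

locale tensor = M: bimodule R M + N: left_module R N
  for R :: "'a ring" and M :: "('a, 'm) bimodule" and N :: "('a, 't) module"
begin

abbreviation pairs where "pairs \<equiv> carrier M \<times> carrier N"
abbreviation supported :: "('m \<times> 't \<Rightarrow>\<^sub>0 int) \<Rightarrow> bool" where "supported c \<equiv> Poly_Mapping.keys c \<subseteq> pairs"
abbreviation H where "H \<equiv> tensor_kernel R M N"
abbreviation rel where "rel \<equiv> tensor_relations R M N"

definition L :: "'a \<Rightarrow> ('m \<times> 't \<Rightarrow>\<^sub>0 int) \<Rightarrow> ('m \<times> 't \<Rightarrow>\<^sub>0 int)" where
  "L r = frag_extend (\<lambda>(m, x). frag_of (r \<odot>\<^bsub>M\<^esub> m, x))"

definition cls :: "('m \<times> 't \<Rightarrow>\<^sub>0 int) \<Rightarrow> ('m \<times> 't \<Rightarrow>\<^sub>0 int) set" where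
  "cls c = H #>\<^bsub>tensor_free M N\<^esub> c"

lemma keys_diffI: "\<lbrakk>Poly_Mapping.keys a \<subseteq> A; Poly_Mapping.keys b \<subseteq> A\<rbrakk> \<Longrightarrow> Poly_Mapping.keys (a - b :: 'z \<Rightarrow>\<^sub>0 int) \<subseteq> A"
  using keys_diff[of a b] by blast

lemma keys_addI: "\<lbrakk>Poly_Mapping.keys a \<subseteq> A; Poly_Mapping.keys b \<subseteq> A\<rbrakk> \<Longrightarrow> Poly_Mapping.keys (a + b :: 'z \<Rightarrow>\<^sub>0 int) \<subseteq> A"
  using keys_add[of a b] by blast

lemma relE:
  assumes "c \<in> rel"
  obtains (add_l) m m' x where "m \<in> carrier M" "m' \<in> carrier M" "x \<in> carrier N"
      "c = frag_of (m \<oplus>\<^bsub>M\<^esub> m', x) - frag_of (m, x) - frag_of (m', x)"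
    | (add_r) m x x' where "m \<in> carrier M" "x \<in> carrier N" "x' \<in> carrier N"
      "c = frag_of (m, x \<oplus>\<^bsub>N\<^esub> x') - frag_of (m, x) - frag_of (m, x')"
    | (bal) m r x where "m \<in> carrier M" "r \<in> carrier R" "x \<in> carrier N"
      "c = frag_of (m \<odot>r\<^bsub>M\<^esub> r, x) - frag_of (m, r \<odot>\<^bsub>N\<^esub> x)"
  using assms unfolding tensor_relations_def Un_iff mem_Collect_eq
  by (elim disjE exE conjE) ((rule add_l, assumption+) | (rule add_r, assumption+) | (rule bal, assumption+))+

lemma relI:
  "\<lbrakk>m \<in> carrier M; m' \<in> carrier M; x \<in> carrier N\<rbrakk> \<Longrightarrow> frag_of (m \<oplus>\<^bsub>M\<^esub> m', x) - frag_of (m, x) - frag_of (m', x) \<in> rel"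
  "\<lbrakk>m \<in> carrier M; x \<in> carrier N; x' \<in> carrier N\<rbrakk> \<Longrightarrow> frag_of (m, x \<oplus>\<^bsub>N\<^esub> x') - frag_of (m, x) - frag_of (m, x') \<in> rel"
  "\<lbrakk>m \<in> carrier M; r \<in> carrier R; x \<in> carrier N\<rbrakk> \<Longrightarrow> frag_of (m \<odot>r\<^bsub>M\<^esub> r, x) - frag_of (m, r \<odot>\<^bsub>N\<^esub> x) \<in> rel"
  unfolding tensor_relations_def by blast+

lemma rel_keys: "c \<in> rel \<Longrightarrow> supported c"
  by (erule relE) (simp_all add: keys_diffI M.rsmult_closed N.smult_closed)

lemma rel_sub: "rel \<subseteq> carrier (tensor_free M N)"
  using rel_keys by (auto simp: tensor_free_def)

lemma H_subgroup: "subgroup H (tensor_free M N)"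
  unfolding tensor_kernel_def
  by (rule group.generate_is_subgroup[OF _ rel_sub]) (simp add: tensor_free_def)

lemma H_normal: "H \<lhd> tensor_free M N"
  by (rule comm_group.subgroup_imp_normal[OF _ H_subgroup])
     (simp add: tensor_free_def abelian_free_Abelian_group)

lemma H_keys: "c \<in> H \<Longrightarrow> supported c"
  using subsetD[OF subgroup.subset[OF H_subgroup], of c] by (simp add: tensor_free_def)

lemma H_zero: "0 \<in> H"
  using subgroup.one_closed[OF H_subgroup] by (simp add: tensor_free_def)

lemma H_add: "\<lbrakk>c \<in> H; d \<in> H\<rbrakk> \<Longrightarrow> c + d \<in> H"
  using subgroup.m_closed[OF H_subgroup] by (simp add: tensor_free_def)

lemma H_neg: "c \<in> H \<Longrightarrow> - c \<in> H"
  using subgroup.m_inv_closed[OF H_subgroup, of c] H_keys by (simp add: tensor_free_def)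

lemma H_diff: "\<lbrakk>c \<in> H; d \<in> H\<rbrakk> \<Longrightarrow> c - d \<in> H"
  using H_add[OF _ H_neg, of c d] by simp

lemma H_rel: "c \<in> rel \<Longrightarrow> c \<in> H"
  unfolding tensor_kernel_def by (rule generate.incl)

text \<open>A single closure step suffices: \<open>0 - h\<close> gives inverses and
  \<open>h1 - (0 - h2)\<close> gives sums.\<close>

lemma H_induct [consumes 1, case_names zero rel diff]:
  assumes "c \<in> H" and "P 0" and "\<And>c. c \<in> rel \<Longrightarrow> P c" and "\<And>c d. \<lbrakk>c \<in> H; d \<in> H; P c; P d\<rbrakk> \<Longrightarrow> P (c - d)"
  shows "P c"
  using assms(1) unfolding tensor_kernel_def
proof (induction rule: generate.induct)
  case one
  then show ?case using assms(2) by (simp add: tensor_free_def)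
next
  case (incl h)
  then show ?case by (rule assms(3))
next
  case (inv h)
  then have "P (0 - h)" by (intro assms(4) H_zero assms(2,3) H_rel)
  then show ?case using rel_keys[OF inv] by (simp add: tensor_free_def)
next
  case (eng h1 h2)
  then have h: "h1 \<in> H" "h2 \<in> H" by (auto simp: tensor_kernel_def)
  then have "P (0 - h2)" using eng by (intro assms(4) H_zero assms(2))
  then have "P (h1 - (0 - h2))" using eng h H_neg by (intro assms(4)[of h1 "0 - h2"]) auto
  then show ?case by (simp add: tensor_free_def)
qed

lemma cls_iff: "d \<in> cls c \<longleftrightarrow> d - c \<in> H"
proof
  assume "d \<in> cls c"
  then show "d - c \<in> H" by (auto simp: cls_def r_coset_def tensor_free_def)
next
  assume "d - c \<in> H"
  then have "d = (d - c) \<otimes>\<^bsub>tensor_free M N\<^esub> c" by (simp add: tensor_free_def)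
  then show "d \<in> cls c" using \<open>d - c \<in> H\<close> unfolding cls_def r_coset_def by blast
qed

lemma cls_self: "c \<in> cls c"
  by (simp add: cls_iff H_zero)

lemma cls_eq: "cls c = cls d \<longleftrightarrow> c - d \<in> H"
proof
  assume "cls c = cls d"
  then show "c - d \<in> H" using cls_self[of c] by (simp add: cls_iff)
next
  assume *: "c - d \<in> H"
  have "x - c \<in> H \<longleftrightarrow> x - d \<in> H" for x
    using H_add[OF _ *, of "x - c"] H_diff[OF _ *, of "x - d"] by auto
  then show "cls c = cls d" by (auto simp: cls_iff)
qed

lemma L_simps [simp]:
  "L r 0 = 0" "L r (frag_of (m, x)) = frag_of (r \<odot>\<^bsub>M\<^esub> m, x)" "L r (c + d) = L r c + L r d"
  "L r (c - d) = L r c - L r d"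
  by (simp_all add: L_def frag_extend_add frag_extend_diff)

lemma L_keys: "\<lbrakk>supported c; r \<in> carrier R\<rbrakk> \<Longrightarrow> supported (L r c)"
proof (induction c rule: frag_induction)
  case (diff a b)
  then show ?case by (simp add: keys_diffI)
qed (auto simp: M.smult_closed)

text \<open>Left multiplication sends each kind of relation to one of the same kind; for the
  balancing relation this is \<open>(r m) s = r (m s)\<close>.\<close>

lemma L_H:
  assumes r: "r \<in> carrier R" and c: "c \<in> H" shows "L r c \<in> H"
  using c
proof (induction rule: H_induct)
  case (rel c)
  then have "L r c \<in> rel"
  proof (cases rule: relE)
    case (add_l m m' x)
    then show ?thesis using relI(1)[of "r \<odot>\<^bsub>M\<^esub> m" "r \<odot>\<^bsub>M\<^esub> m'" x] r by (simp add: M.smult_closed M.smult_r_distr)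
  next
    case (add_r m x x')
    then show ?thesis using relI(2)[of "r \<odot>\<^bsub>M\<^esub> m" x x'] r by (simp add: M.smult_closed)
  next
    case (bal m s x)
    then show ?thesis using relI(3)[of "r \<odot>\<^bsub>M\<^esub> m" s x] r by (simp add: M.smult_closed M.smult_rsmult)
  qed
  then show ?case by (rule H_rel)
qed (auto simp: H_zero H_diff)

abbreviation Q where "Q \<equiv> tensor_product R M N"

lemma Q_simps:
  "carrier Q = cls ` {c. supported c}" "\<zero>\<^bsub>Q\<^esub> = cls 0"
  "\<lbrakk>supported c; supported d\<rbrakk> \<Longrightarrow> cls c \<oplus>\<^bsub>Q\<^esub> cls d = cls (c + d)"
  "r \<in> carrier R \<Longrightarrow> r \<odot>\<^bsub>Q\<^esub> cls c = cls (L r c)"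
proof -
  show "carrier Q = cls ` {c. supported c}"
    by (auto simp: tensor_product_def Let_def FactGroup_def RCOSETS_def cls_def) (auto simp: tensor_free_def)
  show "\<zero>\<^bsub>Q\<^esub> = cls 0"
    by (auto simp: tensor_product_def Let_def FactGroup_def cls_iff)
  show "cls c \<oplus>\<^bsub>Q\<^esub> cls d = cls (c + d)"
    if "supported c" "supported d"
    using normal.rcos_sum[OF H_normal, of c d] that
    by (simp add: tensor_product_def Let_def FactGroup_def cls_def) (simp add: tensor_free_def)
  show "r \<odot>\<^bsub>Q\<^esub> cls c = cls (L r c)" if r: "r \<in> carrier R"
  proof -
    \<comment> \<open>All representatives give the same class, so the union over the coset in the
      definition collapses to one class.\<close>
    have "cls (L r d) = cls (L r c)" if "d \<in> cls c" for d
      using L_H[OF r, of "d - c"] that by (simp add: cls_iff cls_eq)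
    then have "(\<Union>d\<in>cls c. cls (L r d)) = cls (L r c)" using cls_self[of c] by blast
    moreover have "r \<odot>\<^bsub>Q\<^esub> cls c = (\<Union>d\<in>cls c. cls (L r d))"
      unfolding cls_def L_def by (simp add: tensor_product_def Let_def)
    ultimately show ?thesis by simp
  qed
qed

lemma left_module_Q: "left_module R Q"
proof (rule left_moduleI)
  show "ring R" by (rule M.R.ring_axioms)
next
  fix x assume "x \<in> carrier Q"
  then obtain c where c: "supported c" "x = cls c" by (auto simp: Q_simps)
  show "\<exists>y\<in>carrier Q. y \<oplus>\<^bsub>Q\<^esub> x = \<zero>\<^bsub>Q\<^esub>"
    using c by (intro bexI[of _ "cls (- c)"]) (auto simp: Q_simps)
  have "L \<one>\<^bsub>R\<^esub> c = c" using c(1) by (induction c rule: frag_induction) (auto simp: M.smult_one)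
  then show "\<one>\<^bsub>R\<^esub> \<odot>\<^bsub>Q\<^esub> x = x" using c by (simp add: Q_simps)
  show "\<zero>\<^bsub>Q\<^esub> \<oplus>\<^bsub>Q\<^esub> x = x" using c by (simp add: Q_simps)
next
  fix r s x assume rs: "r \<in> carrier R" "s \<in> carrier R" and "x \<in> carrier Q"
  then obtain c where c: "supported c" "x = cls c" by (auto simp: Q_simps)
  have "L (r \<otimes>\<^bsub>R\<^esub> s) c = L r (L s c)" using c(1)
    by (induction c rule: frag_induction) (auto simp: M.smult_assoc rs)
  then show "(r \<otimes>\<^bsub>R\<^esub> s) \<odot>\<^bsub>Q\<^esub> x = r \<odot>\<^bsub>Q\<^esub> (s \<odot>\<^bsub>Q\<^esub> x)" using c rs by (simp add: Q_simps)
  \<comment> \<open>The other scalar laws hold on formal sums; this one holds only modulo the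
    relations that split a sum in \<open>M\<close>.\<close>
  have "L (r \<oplus>\<^bsub>R\<^esub> s) c - (L r c + L s c) \<in> H" using c(1)
  proof (induction c rule: frag_induction)
    case (one p)
    then obtain m x where p: "p = (m, x)" "m \<in> carrier M" "x \<in> carrier N" by auto
    then show ?case
      using H_rel[OF relI(1)[of "r \<odot>\<^bsub>M\<^esub> m" "s \<odot>\<^bsub>M\<^esub> m" x]] rs
      by (simp add: M.smult_l_distr M.smult_closed algebra_simps)
  next
    case (diff a b)
    then show ?case using H_diff[OF diff] by (simp add: algebra_simps)
  qed (simp add: H_zero)
  then show "(r \<oplus>\<^bsub>R\<^esub> s) \<odot>\<^bsub>Q\<^esub> x = r \<odot>\<^bsub>Q\<^esub> x \<oplus>\<^bsub>Q\<^esub> s \<odot>\<^bsub>Q\<^esub> x"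
    using c rs by (simp add: Q_simps L_keys cls_eq)
next
  fix r x y assume r: "r \<in> carrier R" and "x \<in> carrier Q" "y \<in> carrier Q"
  then obtain c d where c: "supported c" "x = cls c"
    and d: "supported d" "y = cls d" by (auto simp: Q_simps)
  show "r \<odot>\<^bsub>Q\<^esub> (x \<oplus>\<^bsub>Q\<^esub> y) = r \<odot>\<^bsub>Q\<^esub> x \<oplus>\<^bsub>Q\<^esub> r \<odot>\<^bsub>Q\<^esub> y"
    using c d r by (simp add: Q_simps L_keys keys_addI)
next
  fix x y z assume "x \<in> carrier Q" "y \<in> carrier Q" "z \<in> carrier Q"
  then obtain a b c where "supported a" "supported b" "supported c"
    "x = cls a" "y = cls b" "z = cls c" by (auto simp: Q_simps(1))
  then show "x \<oplus>\<^bsub>Q\<^esub> y \<oplus>\<^bsub>Q\<^esub> z = x \<oplus>\<^bsub>Q\<^esub> (y \<oplus>\<^bsub>Q\<^esub> z)"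
    by (simp add: Q_simps keys_addI add.assoc)
next
  fix x y assume "x \<in> carrier Q" "y \<in> carrier Q"
  then obtain a b where "supported a" "supported b" "x = cls a" "y = cls b"
    by (auto simp: Q_simps(1))
  then show "x \<oplus>\<^bsub>Q\<^esub> y = y \<oplus>\<^bsub>Q\<^esub> x" "x \<oplus>\<^bsub>Q\<^esub> y \<in> carrier Q"
    by (simp_all add: Q_simps keys_addI add.commute)
next
  show "\<zero>\<^bsub>Q\<^esub> \<in> carrier Q" by (simp add: Q_simps)
next
  fix r x assume "r \<in> carrier R" "x \<in> carrier Q"
  then show "r \<odot>\<^bsub>Q\<^esub> x \<in> carrier Q"
    by (auto simp: Q_simps(1)) (simp add: Q_simps L_keys)
qed

section \<open>Lists representing formal sums, and the universal property\<close>

definition valid :: "(int \<times> 'm \<times> 't) list \<Rightarrow> bool" where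
  "valid xs \<longleftrightarrow> (\<forall>(k, m, t)\<in>set xs. m \<in> carrier M \<and> t \<in> carrier N)"

lemma formal_sum_simps [simp]:
  "formal_sum [] = 0" "formal_sum ((k, m, t) # xs) = frag_cmul k (frag_of (m, t)) + formal_sum xs"
  "formal_sum (xs @ ys) = formal_sum xs + formal_sum ys"
  by (simp_all add: formal_sum_def)

lemma formal_sum_neg: "formal_sum (map (apfst uminus) xs) = - formal_sum xs"
  by (induction xs) (auto simp flip: minus_frag_cmul)

lemma keys_formal_sum: "valid xs \<Longrightarrow> supported (formal_sum xs)"
proof (induction xs)
  case (Cons x xs)
  obtain k m t where x: "x = (k, m, t)" by (cases x)
  have "supported (frag_cmul k (frag_of (m, t)))"
    using Cons.prems keys_cmul[of k "frag_of (m, t)"] by (auto simp: valid_def x)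
  then show ?case using Cons by (simp add: x keys_addI valid_def)
qed simp

lemma exists_formal_sum:
  assumes "supported c" shows "\<exists>xs. valid xs \<and> formal_sum xs = c"
  using assms
proof (induction c rule: frag_induction)
  case zero
  then show ?case by (intro exI[of _ "[]"]) (simp add: valid_def)
next
  case (one p)
  then show ?case by (intro exI[of _ "[(1, fst p, snd p)]"]) (auto simp: valid_def)
next
  case (diff a b)
  then obtain xs ys where "valid xs" "formal_sum xs = a" "valid ys" "formal_sum ys = b" by blast
  then show ?case
    by (intro exI[of _ "xs @ map (apfst uminus) ys"]) (auto simp: valid_def formal_sum_neg)
qed

text \<open>The universal property on representatives: the additive extension of
  \<open>\<beta>\<close> to formal sums kills every relation. The last conclusion evaluates it along
  a list of triples, which is the shape of the codes of tensors.\<close>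

lemma balanced_extension:
  fixes G :: "('b, 'g, 'd) module_scheme"
  assumes G: "abelian_group G" and \<beta>: "balanced R M N G \<beta>"
  obtains h where "\<And>c. supported c \<Longrightarrow> h c \<in> carrier G"
    "\<And>c d. \<lbrakk>supported c; supported d\<rbrakk> \<Longrightarrow> h (c + d) = h c \<oplus>\<^bsub>G\<^esub> h d"
    "\<And>m t. \<lbrakk>m \<in> carrier M; t \<in> carrier N\<rbrakk> \<Longrightarrow> h (frag_of (m, t)) = \<beta> m t"
    "\<And>c d. \<lbrakk>supported c; supported d; cls c = cls d\<rbrakk> \<Longrightarrow> h c = h d"
    "\<And>xs. valid xs \<Longrightarrow> h (formal_sum xs) = eval_sum G \<beta> xs"
proof -
  interpret G: abelian_group G by (rule G)
  let ?F = "free_Abelian_group pairs"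
  obtain h where h: "h \<in> hom ?F (add_monoid G)" and h_of: "\<And>p. p \<in> pairs \<Longrightarrow> h (frag_of p) = (case p of (m, t) \<Rightarrow> \<beta> m t)"
  proof -
    have "(\<lambda>(m, t). \<beta> m t) ` pairs \<subseteq> carrier (add_monoid G)" using \<beta> by (auto simp: balanced_def)
    from comm_group.free_Abelian_group_universal[OF G.a_comm_group this] show thesis using that by metis
  qed
  have hc: "h c \<in> carrier G" if "supported c" for c
    using hom_carrier[OF h] that by auto
  have h_add: "h (c + d) = h c \<oplus>\<^bsub>G\<^esub> h d" if "supported c" "supported d" for c d
    using hom_mult[OF h, of c d] that by simp
  have h_0: "h 0 = \<zero>\<^bsub>G\<^esub>" using hom_one[OF h group_free_Abelian_group G.a_group] by simp
  have h_diff: "h (c - d) = h c \<ominus>\<^bsub>G\<^esub> h d" if cd: "supported c" "supported d" for c d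
  proof -
    have "h (c - d) \<oplus>\<^bsub>G\<^esub> h d = h c" using h_add[of "c - d" d] cd keys_diffI[OF cd] by simp
    then have "h c \<ominus>\<^bsub>G\<^esub> h d = h (c - d) \<oplus>\<^bsub>G\<^esub> (h d \<ominus>\<^bsub>G\<^esub> h d)"
      using hc cd hc[OF keys_diffI[OF cd]] by (metis a_minus_def G.a_assoc G.a_inv_closed)
    then show ?thesis using hc cd hc[OF keys_diffI[OF cd]] by (simp add: a_minus_def G.r_neg)
  qed
  have h_of': "h (frag_of (m, t)) = \<beta> m t" if "m \<in> carrier M" "t \<in> carrier N" for m t
    using h_of[of "(m, t)"] that by simp
  have bc: "\<beta> m t \<in> carrier G" if "m \<in> carrier M" "t \<in> carrier N" for m t
    using \<beta> that by (auto simp: balanced_def)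
  have dz: "(a \<oplus>\<^bsub>G\<^esub> b \<ominus>\<^bsub>G\<^esub> a) \<ominus>\<^bsub>G\<^esub> b = \<zero>\<^bsub>G\<^esub>" if "a \<in> carrier G" "b \<in> carrier G" for a b
  proof -
    have "(a \<oplus>\<^bsub>G\<^esub> b \<ominus>\<^bsub>G\<^esub> a) \<ominus>\<^bsub>G\<^esub> b = (a \<oplus>\<^bsub>G\<^esub> \<ominus>\<^bsub>G\<^esub> a) \<oplus>\<^bsub>G\<^esub> (b \<oplus>\<^bsub>G\<^esub> \<ominus>\<^bsub>G\<^esub> b)"
      using that by (simp add: a_minus_def G.a_ac)
    then show ?thesis using that by (simp add: G.r_neg)
  qed
  have h_H: "h c = \<zero>\<^bsub>G\<^esub>" if "c \<in> H" for c
    using that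
  proof (induction rule: H_induct)
    case (rel c)
    then show ?case
    proof (cases rule: relE)
      case (add_l m m' x)
      then show ?thesis using \<beta> dz[of "\<beta> m x" "\<beta> m' x"]
        by (simp add: h_diff keys_diffI h_of' bc balanced_def)
    next
      case (add_r m x x')
      then show ?thesis using \<beta> dz[of "\<beta> m x" "\<beta> m x'"]
        by (simp add: h_diff keys_diffI h_of' bc balanced_def)
    next
      case (bal m r x)
      then show ?thesis using \<beta> bc[of m "r \<odot>\<^bsub>N\<^esub> x"]
        by (simp add: h_diff h_of' balanced_def M.rsmult_closed N.smult_closed G.diff_eq_zero_iff)
    qed
  qed (simp_all add: h_0 h_diff H_keys a_minus_def G.r_neg)
  show thesis
  proof (rule that[of h])
    fix c d assume cd: "supported c" "supported d" "cls c = cls d"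
    then have "h c \<ominus>\<^bsub>G\<^esub> h d = \<zero>\<^bsub>G\<^esub>" using h_H[of "c - d"] by (simp add: cls_eq h_diff)
    then show "h c = h d" using cd hc by (simp add: G.diff_eq_zero_iff)
  next
    fix xs assume "valid xs"
    then show "h (formal_sum xs) = eval_sum G \<beta> xs"
    proof (induction xs)
      case Nil
      then show ?case by (simp add: eval_sum_def h_0)
    next
      case (Cons x xs)
      obtain k m t where x: "x = (k, m, t)" by (cases x)
      have v: "m \<in> carrier M" "t \<in> carrier N" "valid xs" using Cons.prems x by (auto simp: valid_def)
      have "h (frag_cmul k (frag_of (m, t))) = [k] \<cdot>\<^bsub>G\<^esub> \<beta> m t"
        using hom_int_pow[OF h _ group_free_Abelian_group G.a_group, of "frag_of (m, t)" k] v
        by (simp add: h_of' add_pow_def)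
      moreover have "supported (frag_cmul k (frag_of (m, t)))"
        using v keys_cmul[of k "frag_of (m, t)"] by auto
      ultimately show ?case
        using Cons.IH v x keys_formal_sum[OF v(3)] by (simp add: h_add eval_sum_def)
    qed
  qed (use hc h_add h_of' in auto)
qed

end

section \<open>Tensors coded by lists\<close>

locale coded_tensor = tensor R M N
  for R :: "'a ring" and M :: "('a, 'm) bimodule" and N :: "('a, ('a, 'm) tensor) module"
begin

abbreviation code where "code \<equiv> tensor_code M N"
abbreviation T where "T \<equiv> transport code Q"
abbreviation cons where "cons m t \<equiv> code (pure_tensor R M N m t)"

text \<open>The code contains a list that represents the class, so the class can be read off again;
  this makes \<open>code\<close> injective.\<close>

lemma code_cls:
  assumes "supported c"
  obtains xs where "code (cls c) = FSum xs" "valid xs" "cls (formal_sum xs) = cls c"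
proof -
  let ?xs = "SOME xs. (\<forall>(k, m, t)\<in>set xs. m \<in> carrier M \<and> t \<in> carrier N) \<and> formal_sum xs \<in> cls c"
  have "\<exists>xs. valid xs \<and> formal_sum xs \<in> cls c" using exists_formal_sum[OF assms] cls_self[of c] by blast
  then have "valid ?xs \<and> formal_sum ?xs \<in> cls c" unfolding valid_def by (rule someI_ex)
  then show thesis using that[of ?xs] by (auto simp: tensor_code_def cls_iff cls_eq)
qed

lemma code_inj: "inj_on code (carrier Q)"
proof (rule inj_onI)
  fix x y assume "x \<in> carrier Q" "y \<in> carrier Q" and eq: "code x = code y"
  then obtain c d where c: "supported c" "x = cls c"
    and d: "supported d" "y = cls d" by (auto simp: Q_simps)
  obtain xs where "code (cls c) = FSum xs" "cls (formal_sum xs) = cls c" by (rule code_cls[OF c(1)])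
  moreover obtain ys where "code (cls d) = FSum ys" "cls (formal_sum ys) = cls d" by (rule code_cls[OF d(1)])
  ultimately show "x = y" using c d eq by simp
qed

lemma left_module_T: "left_module R T"
  by (rule left_module_transport[OF left_module_Q code_inj])

lemma T_simps:
  "carrier T = (\<lambda>c. code (cls c)) ` {c. supported c}"
  "\<lbrakk>supported c; supported d\<rbrakk> \<Longrightarrow> code (cls c) \<oplus>\<^bsub>T\<^esub> code (cls d) = code (cls (c + d))"
  "\<lbrakk>r \<in> carrier R; supported c\<rbrakk> \<Longrightarrow> r \<odot>\<^bsub>T\<^esub> code (cls c) = code (cls (L r c))"
  by (simp_all add: transport_simps[OF code_inj] Q_simps image_image)

lemma cons_eq: "cons m t = code (cls (frag_of (m, t)))"
  by (simp add: pure_tensor_def cls_def)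

lemma T_diff:
  assumes cd: "supported c" "supported d"
  shows "code (cls c) \<ominus>\<^bsub>T\<^esub> code (cls d) = code (cls (c - d))"
proof -
  interpret T: left_module R T by (rule left_module_T)
  have mem: "code (cls c) \<in> carrier T" "code (cls d) \<in> carrier T" "code (cls (c - d)) \<in> carrier T"
    using cd keys_diffI[OF cd] by (auto simp: T_simps)
  have "code (cls (c - d)) \<oplus>\<^bsub>T\<^esub> code (cls d) = code (cls c)"
    using cd keys_diffI[OF cd] by (simp add: T_simps)
  then have "code (cls c) \<ominus>\<^bsub>T\<^esub> code (cls d) = code (cls (c - d)) \<oplus>\<^bsub>T\<^esub> (code (cls d) \<ominus>\<^bsub>T\<^esub> code (cls d))"
    using mem by (metis a_minus_def T.X.a_assoc T.X.a_inv_closed)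
  then show ?thesis using mem by (simp add: a_minus_def T.X.r_neg)
qed

lemma cons_balanced: "balanced R M N T cons"
proof -
  have *: "code (cls c) = code (cls d)" if "c - d \<in> rel" for c d
    by (rule arg_cong[where f = code]) (simp add: cls_eq H_rel that)
  have "code (cls (frag_of (m \<oplus>\<^bsub>M\<^esub> m', t))) = code (cls (frag_of (m, t) + frag_of (m', t)))"
    if "m \<in> carrier M" "m' \<in> carrier M" "t \<in> carrier N" for m m' t
    by (rule *) (use relI(1)[OF that] in \<open>simp add: diff_diff_add\<close>)
  moreover have "code (cls (frag_of (m, t \<oplus>\<^bsub>N\<^esub> t'))) = code (cls (frag_of (m, t) + frag_of (m, t')))"
    if "m \<in> carrier M" "t \<in> carrier N" "t' \<in> carrier N" for m t t'
    by (rule *) (use relI(2)[OF that] in \<open>simp add: diff_diff_add\<close>)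
  moreover have "code (cls (frag_of (m \<odot>r\<^bsub>M\<^esub> r, t))) = code (cls (frag_of (m, r \<odot>\<^bsub>N\<^esub> t)))"
    if "m \<in> carrier M" "r \<in> carrier R" "t \<in> carrier N" for m r t
    by (rule *) (use relI(3)[OF that] in simp)
  moreover have "code (cls (frag_of (m, t))) \<in> carrier T" if "m \<in> carrier M" "t \<in> carrier N" for m t
    using that by (auto simp: T_simps)
  ultimately show ?thesis unfolding balanced_def cons_eq by (simp add: T_simps(2))
qed

lemma smult_cons:
  "\<lbrakk>r \<in> carrier R; m \<in> carrier M; t \<in> carrier N\<rbrakk> \<Longrightarrow> r \<odot>\<^bsub>T\<^esub> cons m t = cons (r \<odot>\<^bsub>M\<^esub> m) t"
  by (simp add: cons_eq T_simps)

lemma T_induct: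
  assumes "x \<in> carrier T" and cons: "\<And>m t. \<lbrakk>m \<in> carrier M; t \<in> carrier N\<rbrakk> \<Longrightarrow> P (cons m t)"
    and diff: "\<And>x y. \<lbrakk>x \<in> carrier T; y \<in> carrier T; P x; P y\<rbrakk> \<Longrightarrow> P (x \<ominus>\<^bsub>T\<^esub> y)"
  shows "P x"
proof -
  obtain c where c: "supported c" "x = code (cls c)" using assms(1) by (auto simp: T_simps)
  have "supported c \<and> P (code (cls c))" using c(1)
  proof (induction c rule: frag_induction)
    case zero
    \<comment> \<open>Zero is obtained as the difference of a pure tensor with itself.\<close>
    let ?z = "frag_of (\<zero>\<^bsub>M\<^esub>, \<zero>\<^bsub>N\<^esub>)"
    have "P (code (cls ?z) \<ominus>\<^bsub>T\<^esub> code (cls ?z))"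
      by (intro diff) (use cons[of "\<zero>\<^bsub>M\<^esub>" "\<zero>\<^bsub>N\<^esub>"] in \<open>auto simp: T_simps cons_eq\<close>)
    then show ?case by (subst (asm) T_diff) auto
  next
    case (one p)
    then show ?case using cons[of "fst p" "snd p"] by (auto simp: cons_eq)
  next
    case (diff a b)
    then have ab: "supported a" "supported b" by auto
    then have "P (code (cls a) \<ominus>\<^bsub>T\<^esub> code (cls b))" using diff by (intro assms(3)) (auto simp: T_simps)
    then show ?case using ab keys_diffI[OF ab] by (simp add: T_diff)
  qed
  then show ?thesis using c by simp
qed

text \<open>The list inside a code is chosen arbitrarily, but \<open>eval_sum\<close> along it is
  the value of the homomorphism induced by \<open>\<beta>\<close>, which depends only on the
  class.\<close>

lemma T_lift:
  fixes G :: "('b, 'g, 'd) module_scheme"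
  assumes G: "abelian_group G" and \<beta>: "balanced R M N G \<beta>"
  shows "additive T G (\<lambda>x. eval_sum G \<beta> (the_FSum x))"
    and "\<lbrakk>m \<in> carrier M; t \<in> carrier N\<rbrakk> \<Longrightarrow> eval_sum G \<beta> (the_FSum (cons m t)) = \<beta> m t"
proof -
  obtain h where hc: "\<And>c. supported c \<Longrightarrow> h c \<in> carrier G"
    and h_add: "\<And>c d. \<lbrakk>supported c; supported d\<rbrakk> \<Longrightarrow> h (c + d) = h c \<oplus>\<^bsub>G\<^esub> h d"
    and h_of: "\<And>m t. \<lbrakk>m \<in> carrier M; t \<in> carrier N\<rbrakk> \<Longrightarrow> h (frag_of (m, t)) = \<beta> m t"
    and h_cls: "\<And>c d. \<lbrakk>supported c; supported d; cls c = cls d\<rbrakk> \<Longrightarrow> h c = h d"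
    and h_sum: "\<And>xs. valid xs \<Longrightarrow> h (formal_sum xs) = eval_sum G \<beta> xs"
    by (rule balanced_extension[OF G \<beta>]) (rule that, assumption+)
  have ev: "eval_sum G \<beta> (the_FSum (code (cls c))) = h c" if c: "supported c" for c
  proof -
    obtain xs where xs: "code (cls c) = FSum xs" "valid xs" "cls (formal_sum xs) = cls c" by (rule code_cls[OF c])
    then have "eval_sum G \<beta> (the_FSum (code (cls c))) = h (formal_sum xs)" by (simp add: h_sum)
    also have "\<dots> = h c" using xs c keys_formal_sum by (intro h_cls) auto
    finally show ?thesis .
  qed
  show "additive T G (\<lambda>x. eval_sum G \<beta> (the_FSum x))"
    unfolding additive_def
  proof (intro conjI ballI)
    fix x assume "x \<in> carrier T"
    then show "eval_sum G \<beta> (the_FSum x) \<in> carrier G" using ev hc by (auto simp: T_simps(1))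
  next
    fix x y assume "x \<in> carrier T" "y \<in> carrier T"
    then obtain c d where "supported c" "supported d"
      "x = code (cls c)" "y = code (cls d)" by (auto simp: T_simps(1))
    then show "eval_sum G \<beta> (the_FSum (x \<oplus>\<^bsub>T\<^esub> y)) = eval_sum G \<beta> (the_FSum x) \<oplus>\<^bsub>G\<^esub> eval_sum G \<beta> (the_FSum y)"
      by (simp add: T_simps(2) ev h_add keys_addI)
  qed
  show "eval_sum G \<beta> (the_FSum (cons m t)) = \<beta> m t" if "m \<in> carrier M" "t \<in> carrier N"
    using that by (simp add: cons_eq ev h_of)
qed

end

section \<open>Tensor powers\<close>

lemma additive_finsum:
  assumes X: "abelian_group X" and Y: "abelian_group Y" and h: "additive X Y h"
    and A: "finite A" and f: "\<And>i. i \<in> A \<Longrightarrow> f i \<in> carrier X"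
  shows "h (finsum X f A) = finsum Y (\<lambda>i. h (f i)) A"
proof -
  interpret X: abelian_group X by (rule X)
  interpret Y: abelian_group Y by (rule Y)
  show ?thesis
    using A f
  proof (induction A rule: finite_induct)
    case empty
    then show ?case using additive_zero[OF X Y h] by simp
  next
    case (insert a A)
    then show ?case
      using additive_closed[OF h] additive_add[OF h, of "f a" "finsum X f A"]
      by (simp add: X.finsum_closed Pi_def)
  qed
qed

text \<open>The map on \<open>M \<otimes> M\<^sup>i\<close> induced by a balanced map \<open>\<beta>\<close>; for \<open>i = 0\<close> this uses \<open>M \<otimes> R = M\<close>.\<close>

fun tensor_lift :: "'a ring \<Rightarrow> nat \<Rightarrow> ('b, 'g, 'd) module_scheme \<Rightarrow> ('m \<Rightarrow> ('a, 'm) tensor \<Rightarrow> 'g) \<Rightarrow> ('a, 'm) tensor \<Rightarrow> 'g" where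
  "tensor_lift R 0 G \<beta> x = \<beta> (the_Vec x) (Scal \<one>\<^bsub>R\<^esub>)"
| "tensor_lift R (Suc i) G \<beta> x = eval_sum G \<beta> (the_FSum x)"

locale tensor_algebra = bimodule R M for R :: "'a ring" and M :: "('a, 'm) bimodule"
begin

abbreviation T where "T \<equiv> tensor_power R M"
abbreviation cons where "cons \<equiv> tensor_cons R M"
abbreviation \<mu> where "\<mu> \<equiv> tensor_mult R M"

lemma left_module_T: "left_module R (T i)"
proof (induction i rule: nat_less_induct)
  case (1 i)
  consider "i = 0" | "i = Suc 0" | j where "i = Suc (Suc j)" by (metis not0_implies_Suc)
  then show ?case
  proof cases
    case 1
    have "inj_on Scal (carrier (regular_module R))" by (simp add: inj_on_def)
    then show ?thesis using 1 left_module_transport[OF left_module_regular[OF R.ring_axioms]] by simp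
  next
    case 2
    have "inj_on Vec (carrier M)" by (simp add: inj_on_def)
    then show ?thesis using 2 left_module_transport[OF left_module_axioms] by simp
  next
    case (3 j)
    then have "left_module R (T (Suc j))" using 1 by simp
    then interpret c: coded_tensor R M "T (Suc j)"
      by (intro coded_tensor.intro tensor.intro bimodule_axioms)
    show ?thesis using c.left_module_T 3 by (simp add: Let_def)
  qed
qed

lemma coded_tensor_T: "coded_tensor R M (T (Suc j))"
  by (intro coded_tensor.intro tensor.intro bimodule_axioms left_module_T)

lemma T_group: "abelian_group (T i)"
  by (rule left_module_group[OF left_module_T])

lemma T_0_simps:
  "carrier (T 0) = Scal ` carrier R" "\<zero>\<^bsub>T 0\<^esub> = Scal \<zero>\<^bsub>R\<^esub>"
  "\<lbrakk>r \<in> carrier R; s \<in> carrier R\<rbrakk> \<Longrightarrow> Scal r \<oplus>\<^bsub>T 0\<^esub> Scal s = Scal (r \<oplus>\<^bsub>R\<^esub> s)"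
  "\<lbrakk>r \<in> carrier R; s \<in> carrier R\<rbrakk> \<Longrightarrow> r \<odot>\<^bsub>T 0\<^esub> Scal s = Scal (r \<otimes>\<^bsub>R\<^esub> s)"
  using transport_simps[of Scal "regular_module R"] by (simp_all add: inj_on_def regular_module_def)

lemma T_1_simps:
  "carrier (T (Suc 0)) = Vec ` carrier M" "\<zero>\<^bsub>T (Suc 0)\<^esub> = Vec \<zero>\<^bsub>M\<^esub>"
  "\<lbrakk>m \<in> carrier M; m' \<in> carrier M\<rbrakk> \<Longrightarrow> Vec m \<oplus>\<^bsub>T (Suc 0)\<^esub> Vec m' = Vec (m \<oplus>\<^bsub>M\<^esub> m')"
  "m \<in> carrier M \<Longrightarrow> r \<odot>\<^bsub>T (Suc 0)\<^esub> Vec m = Vec (r \<odot>\<^bsub>M\<^esub> m)"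
  using transport_simps[of Vec M] by (simp_all add: inj_on_def)

lemma cons_balanced: "balanced R M (T i) (T (Suc i)) (cons i)"
proof (cases i)
  case 0
  show ?thesis
    unfolding balanced_def 0
    by (auto simp: T_0_simps T_1_simps rsmult_closed rsmult_l_distr rsmult_r_distr rsmult_assoc
        simp del: tensor_power.simps)
next
  case (Suc j)
  interpret c: coded_tensor R M "T (Suc j)" by (rule coded_tensor_T)
  show ?thesis using c.cons_balanced Suc by (simp add: Let_def balanced_def)
qed

lemma smult_cons:
  "\<lbrakk>r \<in> carrier R; m \<in> carrier M; t \<in> carrier (T i)\<rbrakk> \<Longrightarrow> r \<odot>\<^bsub>T (Suc i)\<^esub> cons i m t = cons i (r \<odot>\<^bsub>M\<^esub> m) t"
proof (cases i)
  case 0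
  assume "r \<in> carrier R" "m \<in> carrier M" "t \<in> carrier (T i)"
  then show ?thesis
    unfolding 0 by (auto simp: T_0_simps T_1_simps rsmult_closed smult_rsmult simp del: tensor_power.simps)
next
  case (Suc j)
  assume *: "r \<in> carrier R" "m \<in> carrier M" "t \<in> carrier (T i)"
  interpret c: coded_tensor R M "T (Suc j)" by (rule coded_tensor_T)
  show ?thesis using c.smult_cons * Suc by (simp add: Let_def)
qed

lemma cons_simps:
  shows cons_closed: "\<lbrakk>m \<in> carrier M; t \<in> carrier (T i)\<rbrakk> \<Longrightarrow> cons i m t \<in> carrier (T (Suc i))"
    and cons_add_l: "\<lbrakk>m \<in> carrier M; m' \<in> carrier M; t \<in> carrier (T i)\<rbrakk> \<Longrightarrow>
      cons i (m \<oplus>\<^bsub>M\<^esub> m') t = cons i m t \<oplus>\<^bsub>T (Suc i)\<^esub> cons i m' t"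
    and cons_add_r: "\<lbrakk>m \<in> carrier M; t \<in> carrier (T i); t' \<in> carrier (T i)\<rbrakk> \<Longrightarrow>
      cons i m (t \<oplus>\<^bsub>T i\<^esub> t') = cons i m t \<oplus>\<^bsub>T (Suc i)\<^esub> cons i m t'"
    and cons_smult: "\<lbrakk>m \<in> carrier M; r \<in> carrier R; t \<in> carrier (T i)\<rbrakk> \<Longrightarrow>
      cons i (m \<odot>r\<^bsub>M\<^esub> r) t = cons i m (r \<odot>\<^bsub>T i\<^esub> t)"
  using cons_balanced[of i] unfolding balanced_def by blast+

lemma T_induct [consumes 1, case_names cons diff]:
  assumes "x \<in> carrier (T (Suc i))" and "\<And>m t. \<lbrakk>m \<in> carrier M; t \<in> carrier (T i)\<rbrakk> \<Longrightarrow> P (cons i m t)"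
    and "\<And>x y. \<lbrakk>x \<in> carrier (T (Suc i)); y \<in> carrier (T (Suc i)); P x; P y\<rbrakk> \<Longrightarrow> P (x \<ominus>\<^bsub>T (Suc i)\<^esub> y)"
  shows "P x"
proof (cases i)
  case 0
  obtain m where m: "m \<in> carrier M" "x = Vec m"
    using assms(1) unfolding 0 T_1_simps by blast
  \<comment> \<open>In degree 1 every element has the form \<open>m \<otimes> 1\<close>.\<close>
  then show ?thesis using assms(2)[of m "Scal \<one>\<^bsub>R\<^esub>"] unfolding 0 T_0_simps by (simp add: rsmult_one)
next
  case (Suc j)
  interpret c: coded_tensor R M "T (Suc j)" by (rule coded_tensor_T)
  show ?thesis using c.T_induct[of x P] assms Suc by (simp add: Let_def)
qed

lemma T_lift:
  fixes G :: "('b, 'g, 'd) module_scheme"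
  assumes G: "abelian_group G" and \<beta>: "balanced R M (T i) G \<beta>"
  shows "additive (T (Suc i)) G (tensor_lift R i G \<beta>)"
    and "\<lbrakk>m \<in> carrier M; t \<in> carrier (T i)\<rbrakk> \<Longrightarrow> tensor_lift R i G \<beta> (cons i m t) = \<beta> m t"
proof -
  have "additive (T (Suc i)) G (tensor_lift R i G \<beta>) \<and>
    (\<forall>m\<in>carrier M. \<forall>t\<in>carrier (T i). tensor_lift R i G \<beta> (cons i m t) = \<beta> m t)"
  proof (cases i)
    case 0
    have 1: "Scal \<one>\<^bsub>R\<^esub> \<in> carrier (T 0)" unfolding T_0_simps by simp
    have "\<beta> (m \<odot>r\<^bsub>M\<^esub> r) (Scal \<one>\<^bsub>R\<^esub>) = \<beta> m (Scal r)" if "m \<in> carrier M" "r \<in> carrier R" for m r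
      using \<beta> 1 that T_0_simps(4)[of r "\<one>\<^bsub>R\<^esub>"] unfolding balanced_def 0 by simp
    moreover have "additive (T (Suc 0)) G (tensor_lift R 0 G \<beta>)"
      using \<beta> 1 unfolding additive_def balanced_def 0 T_1_simps by (auto simp: T_1_simps simp del: tensor_power.simps)
    ultimately show ?thesis
      unfolding 0 T_0_simps by auto
  next
    case (Suc j)
    interpret c: coded_tensor R M "T (Suc j)" by (rule coded_tensor_T)
    have "tensor_lift R i G \<beta> = (\<lambda>x. eval_sum G \<beta> (the_FSum x))" by (rule ext) (simp add: Suc)
    then show ?thesis using c.T_lift[OF G, of \<beta>] \<beta> Suc by (simp add: Let_def)
  qed
  then show "additive (T (Suc i)) G (tensor_lift R i G \<beta>)"
    and "\<lbrakk>m \<in> carrier M; t \<in> carrier (T i)\<rbrakk> \<Longrightarrow> tensor_lift R i G \<beta> (cons i m t) = \<beta> m t" by blast+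
qed

text \<open>Both \<open>tensor_mult\<close> in its left argument and \<open>tensor_act\<close>
  follow the pattern \<open>f (m \<otimes> t) = h m (f t)\<close>. The step to degree
  \<open>i + 1\<close> is well defined because linearity of \<open>f i\<close> makes
  \<open>h i m (f i t)\<close> balanced, so linearity has to be carried through the induction on the
  degree.\<close>

lemma T_recursion:
  fixes Z :: "nat \<Rightarrow> ('a, 'z) module"
  assumes Z: "\<And>i. left_module R (Z i)" and h: "\<And>i. balanced R M (Z i) (Z (Suc i)) (h i)"
    and h_smult: "\<And>i r m z. \<lbrakk>r \<in> carrier R; m \<in> carrier M; z \<in> carrier (Z i)\<rbrakk> \<Longrightarrow>
      h i (r \<odot>\<^bsub>M\<^esub> m) z = r \<odot>\<^bsub>Z (Suc i)\<^esub> h i m z"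
    and f_0: "lin_map R (T 0) (Z 0) (f 0)"
    and f_Suc: "\<And>i. f (Suc i) = tensor_lift R i (Z (Suc i)) (\<lambda>m t. h i m (f i t))"
  shows "lin_map R (T i) (Z i) (f i)"
    and "\<lbrakk>m \<in> carrier M; t \<in> carrier (T i)\<rbrakk> \<Longrightarrow> f (Suc i) (cons i m t) = h i m (f i t)"
proof -
  have bal: "balanced R M (T i) (Z (Suc i)) (\<lambda>m t. h i m (f i t))" if "lin_map R (T i) (Z i) (f i)" for i
    using that h[of i] by (simp add: balanced_def lin_map_def)
  have step: "f (Suc i) (cons i m t) = h i m (f i t)"
    if "lin_map R (T i) (Z i) (f i)" "m \<in> carrier M" "t \<in> carrier (T i)" for i m t
    unfolding f_Suc by (rule T_lift(2)[OF left_module_group[OF Z] bal[OF that(1)] that(2,3)])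
  show lin: "lin_map R (T i) (Z i) (f i)" for i
  proof (induction i)
    case (Suc i)
    have add: "additive (T (Suc i)) (Z (Suc i)) (f (Suc i))"
      unfolding f_Suc by (rule T_lift(1)[OF left_module_group[OF Z] bal[OF Suc]])
    note f_diff = additive_diff[OF T_group left_module_group[OF Z] add]
    interpret A: left_module R "T (Suc i)" by (rule left_module_T)
    interpret B: left_module R "Z (Suc i)" by (rule Z)
    have "f (Suc i) (r \<odot>\<^bsub>T (Suc i)\<^esub> x) = r \<odot>\<^bsub>Z (Suc i)\<^esub> f (Suc i) x"
      if r: "r \<in> carrier R" and x: "x \<in> carrier (T (Suc i))" for r x
      using x
    proof (induction x rule: T_induct)
      case (cons m t)
      then show ?case
        using r step[OF Suc] lin_closed[OF left_module_T Z Suc]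
        by (simp only: smult_cons smult_closed h_smult)
    next
      case (diff u v)
      then show ?case
        using r additive_closed[OF add] by (simp only: A.smult_diff A.smult_closed f_diff B.smult_diff)
    qed
    then show ?case using add by (simp add: lin_map_def additive_def)
  qed (rule f_0)
  show "\<lbrakk>m \<in> carrier M; t \<in> carrier (T i)\<rbrakk> \<Longrightarrow> f (Suc i) (cons i m t) = h i m (f i t)"
    by (rule step[OF lin])
qed

section \<open>The product of tensor powers\<close>

lemma \<mu>_step:
  assumes y: "y \<in> carrier (T j)"
  shows \<mu>_lin: "lin_map R (T i) (T (i + j)) (\<lambda>x. \<mu> i j x y)"
    and \<mu>_Suc: "\<lbrakk>m \<in> carrier M; t \<in> carrier (T i)\<rbrakk> \<Longrightarrow> \<mu> (Suc i) j (cons i m t) y = cons (i + j) m (\<mu> i j t y)"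
proof -
  interpret Tj: left_module R "T j" by (rule left_module_T)
  have f_0: "lin_map R (T 0) (T (0 + j)) (\<lambda>x. \<mu> 0 j x y)"
    unfolding lin_map_def T_0_simps(1)
    using y by (auto simp: T_0_simps Tj.smult_closed Tj.smult_l_distr Tj.smult_assoc simp del: tensor_power.simps)
  \<comment> \<open>In degree 1 the lift evaluates at \<open>Scal 1\<close>, and the two sides agree
    because 1 acts as the identity on \<open>T j\<close>.\<close>
  have f_Suc: "(\<lambda>x. \<mu> (Suc i) j x y) = tensor_lift R i (T (Suc i + j)) (\<lambda>m t. cons (i + j) m (\<mu> i j t y))" for i
    using y by (cases i) (auto simp: Tj.smult_one)
  have bal: "balanced R M (T (i + j)) (T (Suc i + j)) (cons (i + j))" for i
    using cons_balanced[of "i + j"] by simp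
  have sm: "cons (i + j) (r \<odot>\<^bsub>M\<^esub> m) z = r \<odot>\<^bsub>T (Suc i + j)\<^esub> cons (i + j) m z"
    if "r \<in> carrier R" "m \<in> carrier M" "z \<in> carrier (T (i + j))" for i r m z
    using smult_cons[OF that] by simp
  note rec = T_recursion[of "\<lambda>i. T (i + j)" "\<lambda>i. cons (i + j)" "\<lambda>i x. \<mu> i j x y", OF left_module_T bal sm f_0 f_Suc]
  show "lin_map R (T i) (T (i + j)) (\<lambda>x. \<mu> i j x y)"
    "\<lbrakk>m \<in> carrier M; t \<in> carrier (T i)\<rbrakk> \<Longrightarrow> \<mu> (Suc i) j (cons i m t) y = cons (i + j) m (\<mu> i j t y)"
    using rec by blast+
qed

lemma \<mu>_additive: "y \<in> carrier (T j) \<Longrightarrow> additive (T i) (T (i + j)) (\<lambda>x. \<mu> i j x y)"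
  by (rule lin_additive[OF left_module_T left_module_T \<mu>_lin])

lemma \<mu>_smult:
  "\<lbrakk>r \<in> carrier R; x \<in> carrier (T i); y \<in> carrier (T j)\<rbrakk> \<Longrightarrow> \<mu> i j (r \<odot>\<^bsub>T i\<^esub> x) y = r \<odot>\<^bsub>T (i + j)\<^esub> \<mu> i j x y"
  by (rule lin_smult[OF left_module_T left_module_T \<mu>_lin])

declare tensor_power.simps [simp del] tensor_cons.simps [simp del] tensor_mult.simps [simp del]

lemma \<mu>_closed: "\<lbrakk>x \<in> carrier (T i); y \<in> carrier (T j)\<rbrakk> \<Longrightarrow> \<mu> i j x y \<in> carrier (T (i + j))"
  using additive_closed[OF \<mu>_additive] .

lemma \<mu>_additive_r:
  assumes "x \<in> carrier (T i)" shows "additive (T j) (T (i + j)) (\<mu> i j x)"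
  using assms
proof (induction i arbitrary: x)
  case 0
  then obtain r where "r \<in> carrier R" "x = Scal r" unfolding T_0_simps by blast
  then show ?case
    using left_module_T[of j]
    by (simp add: additive_def tensor_mult.simps left_module.smult_closed left_module.smult_r_distr)
next
  case (Suc i)
  show ?case
    unfolding additive_def
  proof (intro conjI ballI)
    fix y y' assume y: "y \<in> carrier (T j)" "y' \<in> carrier (T j)"
    interpret Tj: abelian_group "T j" by (rule T_group)
    interpret B: abelian_group "T (Suc i + j)" by (rule T_group)
    show "\<mu> (Suc i) j x (y \<oplus>\<^bsub>T j\<^esub> y') = \<mu> (Suc i) j x y \<oplus>\<^bsub>T (Suc i + j)\<^esub> \<mu> (Suc i) j x y'"
      using Suc.prems
    proof (induction x rule: T_induct)
      case (cons m t)
      note add = Suc.IH[OF cons(2)]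
      show ?case
        using cons y additive_closed[OF add] additive_add[OF add] by (simp add: \<mu>_Suc cons_simps)
    next
      case (diff u v)
      have "\<mu> (Suc i) j (u \<ominus>\<^bsub>T (Suc i)\<^esub> v) z = \<mu> (Suc i) j u z \<ominus>\<^bsub>T (Suc i + j)\<^esub> \<mu> (Suc i) j v z"
        if "z \<in> carrier (T j)" for z
        by (rule additive_diff[OF T_group T_group \<mu>_additive[OF that] diff(1,2)])
      then show ?case
        using diff y \<mu>_closed[OF diff(1)] \<mu>_closed[OF diff(2)]
        by (simp add: B.add_diff_add del: add_Suc)
    qed
  qed (use \<mu>_closed[OF Suc.prems] in blast)
qed

text \<open>Peeling the leading factors off \<open>x\<close> reduces the claim to degree 0, where it
  is left linearity of the product.\<close>

lemma \<mu>_assoc: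
  assumes "x \<in> carrier (T i)" "y \<in> carrier (T j)" "z \<in> carrier (T k)"
  shows "\<mu> (i + j) k (\<mu> i j x y) z = \<mu> i (j + k) x (\<mu> j k y z)"
  using assms(1)
proof (induction i arbitrary: x)
  case 0
  then obtain r where "r \<in> carrier R" "x = Scal r" unfolding T_0_simps by blast
  then show ?case using assms \<mu>_smult[of r y j z k] by (simp add: tensor_mult.simps)
next
  case (Suc i)
  from Suc.prems show ?case
  proof (induction x rule: T_induct)
    case (cons m t)
    then show ?case using Suc.IH[of t] assms by (simp add: \<mu>_Suc \<mu>_closed add.assoc)
  next
    case (diff u v)
    have "\<mu> (Suc i) j (u \<ominus>\<^bsub>T (Suc i)\<^esub> v) y = \<mu> (Suc i) j u y \<ominus>\<^bsub>T (Suc i + j)\<^esub> \<mu> (Suc i) j v y"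
      by (rule additive_diff[OF T_group T_group \<mu>_additive[OF assms(2)] diff(1,2)])
    moreover have "\<mu> (Suc i + j) k (\<mu> (Suc i) j u y \<ominus>\<^bsub>T (Suc i + j)\<^esub> \<mu> (Suc i) j v y) z =
      \<mu> (Suc i + j) k (\<mu> (Suc i) j u y) z \<ominus>\<^bsub>T (Suc i + j + k)\<^esub> \<mu> (Suc i + j) k (\<mu> (Suc i) j v y) z"
      by (rule additive_diff[OF T_group T_group \<mu>_additive[OF assms(3)]]) (intro \<mu>_closed diff assms)+
    moreover have "\<mu> (Suc i) (j + k) (u \<ominus>\<^bsub>T (Suc i)\<^esub> v) (\<mu> j k y z) =
      \<mu> (Suc i) (j + k) u (\<mu> j k y z) \<ominus>\<^bsub>T (Suc i + (j + k))\<^esub> \<mu> (Suc i) (j + k) v (\<mu> j k y z)"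
      by (rule additive_diff[OF T_group T_group \<mu>_additive diff(1,2)]) (intro \<mu>_closed assms)
    ultimately show ?case using diff by (simp add: add.assoc)
  qed
qed

lemma \<mu>_one: "x \<in> carrier (T i) \<Longrightarrow> \<mu> i 0 x (Scal \<one>\<^bsub>R\<^esub>) = x"
proof (induction i arbitrary: x)
  case 0
  then obtain r where "r \<in> carrier R" "x = Scal r" unfolding T_0_simps by blast
  then show ?case by (simp add: tensor_mult.simps T_0_simps)
next
  case (Suc i)
  have 1: "Scal \<one>\<^bsub>R\<^esub> \<in> carrier (T 0)" unfolding T_0_simps by simp
  from Suc.prems show ?case
  proof (induction x rule: T_induct)
    case (cons m t)
    then show ?case using Suc.IH[of t] \<mu>_Suc[of "Scal \<one>\<^bsub>R\<^esub>" 0 m t i] 1 by simp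
  next
    case (diff u v)
    then show ?case using additive_diff[OF T_group T_group \<mu>_additive[OF 1] diff(1,2)] by simp
  qed
qed

end

section \<open>The \<open>n\<close>-trivial extension\<close>

text \<open>Both sides run over the pairs with \<open>i + j \<le> k\<close>, grouped by total degree
  or by \<open>i\<close>. Associativity of the ring and of its action on \<open>Y\<close> both rest
  on this.\<close>

lemma (in abelian_monoid) finsum_triangle:
  fixes k :: nat
  assumes "\<And>i j. i + j \<le> k \<Longrightarrow> F i j \<in> carrier G"
  shows "(\<Oplus>a\<in>{..k}. \<Oplus>i\<in>{..a}. F i (a - i)) = (\<Oplus>i\<in>{..k}. \<Oplus>j\<in>{..k - i}. F i j)"
  using assms
proof (induction k)
  case 0
  then show ?case by simp
next
  case (Suc k)
  have F: "F i j \<in> carrier G" if "i + j \<le> Suc k" for i j using Suc.prems that by blast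
  have split: "(\<Oplus>j\<in>{..Suc k - i}. F i j) = (\<Oplus>j\<in>{..k - i}. F i j) \<oplus> F i (Suc k - i)" if "i \<le> k" for i
    using that F by (simp add: Suc_diff_le finsum_Suc Pi_def a_comm finsum_closed)
  have "(\<Oplus>i\<in>{..Suc k}. \<Oplus>j\<in>{..Suc k - i}. F i j) =
      F (Suc k) 0 \<oplus> (\<Oplus>i\<in>{..k}. \<Oplus>j\<in>{..Suc k - i}. F i j)"
    using F by (subst finsum_Suc) (auto intro!: finsum_closed)
  also have "(\<Oplus>i\<in>{..k}. \<Oplus>j\<in>{..Suc k - i}. F i j) = (\<Oplus>i\<in>{..k}. (\<Oplus>j\<in>{..k - i}. F i j) \<oplus> F i (Suc k - i))"
    using F split by (intro finsum_cong') (auto intro!: finsum_closed)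
  also have "\<dots> = (\<Oplus>i\<in>{..k}. \<Oplus>j\<in>{..k - i}. F i j) \<oplus> (\<Oplus>i\<in>{..k}. F i (Suc k - i))"
    using F by (intro finsum_addf) (auto intro!: finsum_closed)
  also have "(\<Oplus>i\<in>{..k}. \<Oplus>j\<in>{..k - i}. F i j) = (\<Oplus>a\<in>{..k}. \<Oplus>i\<in>{..a}. F i (a - i))"
    using Suc by simp
  also have "F (Suc k) 0 \<oplus> ((\<Oplus>a\<in>{..k}. \<Oplus>i\<in>{..a}. F i (a - i)) \<oplus> (\<Oplus>i\<in>{..k}. F i (Suc k - i))) =
      (F (Suc k) 0 \<oplus> (\<Oplus>i\<in>{..k}. F i (Suc k - i))) \<oplus> (\<Oplus>a\<in>{..k}. \<Oplus>i\<in>{..a}. F i (a - i))"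
    using F by (simp add: a_ac finsum_closed Pi_def)
  also have "F (Suc k) 0 \<oplus> (\<Oplus>i\<in>{..k}. F i (Suc k - i)) = (\<Oplus>i\<in>{..Suc k}. F i (Suc k - i))"
    using F by (simp add: finsum_Suc Pi_def)
  also have "\<dots> \<oplus> (\<Oplus>a\<in>{..k}. \<Oplus>i\<in>{..a}. F i (a - i)) = (\<Oplus>a\<in>{..Suc k}. \<Oplus>i\<in>{..a}. F i (a - i))"
    by (rule finsum_Suc[symmetric]) (use F in \<open>auto intro!: finsum_closed\<close>)
  finally show ?case by simp
qed

context tensor_algebra begin

context
  fixes n :: nat
begin

abbreviation S where "S \<equiv> trivial_extension R M n"

section \<open>The ring axioms of the trivial extension\<close>

lemma S_simps:
  "carrier S = (\<Pi>\<^sub>E i\<in>{..n}. carrier (T i))" "\<zero>\<^bsub>S\<^esub> = (\<lambda>i\<in>{..n}. \<zero>\<^bsub>T i\<^esub>)"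
  "\<one>\<^bsub>S\<^esub> = (\<lambda>i\<in>{..n}. if i = 0 then Scal \<one>\<^bsub>R\<^esub> else \<zero>\<^bsub>T i\<^esub>)"
  "x \<oplus>\<^bsub>S\<^esub> y = (\<lambda>i\<in>{..n}. x i \<oplus>\<^bsub>T i\<^esub> y i)"
  "x \<otimes>\<^bsub>S\<^esub> y = (\<lambda>k\<in>{..n}. \<Oplus>\<^bsub>T k\<^esub>i\<in>{..k}. \<mu> i (k - i) (x i) (y (k - i)))"
  by (simp_all add: trivial_extension_def)

lemma S_mem: "\<lbrakk>x \<in> carrier S; i \<le> n\<rbrakk> \<Longrightarrow> x i \<in> carrier (T i)"
  by (auto simp: S_simps)

lemma S_ext:
  assumes "x \<in> carrier S" "y \<in> carrier S" "\<And>i. i \<le> n \<Longrightarrow> x i = y i" shows "x = y"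
  using assms by (auto simp: S_simps intro: PiE_ext)

lemma \<mu>_term:
  "\<lbrakk>x \<in> carrier S; y \<in> carrier S; k \<le> n; i \<le> k\<rbrakk> \<Longrightarrow> \<mu> i (k - i) (x i) (y (k - i)) \<in> carrier (T k)"
  using \<mu>_closed[of "x i" i "y (k - i)" "k - i"] S_mem[of x i] S_mem[of y "k - i"] by simp

lemma T_fin_closed: "(\<And>i. i \<in> A \<Longrightarrow> f i \<in> carrier (T k)) \<Longrightarrow> finsum (T k) f A \<in> carrier (T k)"
  by (rule abelian_monoid.finsum_closed[OF abelian_group.axioms(1)[OF T_group]]) auto

lemma S_closed:
  "\<lbrakk>x \<in> carrier S; y \<in> carrier S\<rbrakk> \<Longrightarrow> x \<oplus>\<^bsub>S\<^esub> y \<in> carrier S" "\<zero>\<^bsub>S\<^esub> \<in> carrier S" "\<one>\<^bsub>S\<^esub> \<in> carrier S"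
  "\<lbrakk>x \<in> carrier S; y \<in> carrier S\<rbrakk> \<Longrightarrow> x \<otimes>\<^bsub>S\<^esub> y \<in> carrier S"
proof -
  have z: "\<zero>\<^bsub>T i\<^esub> \<in> carrier (T i)" for i using T_group[of i] by (simp add: abelian_groupE)
  have a: "x \<oplus>\<^bsub>T i\<^esub> y \<in> carrier (T i)" if "x \<in> carrier (T i)" "y \<in> carrier (T i)" for x y i
    using T_group[of i] that by (simp add: abelian_groupE)
  show "x \<oplus>\<^bsub>S\<^esub> y \<in> carrier S" if xy: "x \<in> carrier S" "y \<in> carrier S"
  proof -
    have "(\<lambda>i\<in>{..n}. x i \<oplus>\<^bsub>T i\<^esub> y i) \<in> (\<Pi>\<^sub>E i\<in>{..n}. carrier (T i))"
      using a S_mem[OF xy(1)] S_mem[OF xy(2)] by simp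
    then show ?thesis by (simp add: S_simps)
  qed
  show "\<zero>\<^bsub>S\<^esub> \<in> carrier S" using z by (auto simp: S_simps)
  have "Scal \<one>\<^bsub>R\<^esub> \<in> carrier (T 0)" unfolding T_0_simps by simp
  then show "\<one>\<^bsub>S\<^esub> \<in> carrier S" using z by (auto simp: S_simps)
  show "x \<otimes>\<^bsub>S\<^esub> y \<in> carrier S" if xy: "x \<in> carrier S" "y \<in> carrier S"
  proof -
    have "(\<lambda>k\<in>{..n}. \<Oplus>\<^bsub>T k\<^esub>i\<in>{..k}. \<mu> i (k - i) (x i) (y (k - i))) \<in> (\<Pi>\<^sub>E i\<in>{..n}. carrier (T i))"
      using \<mu>_term[OF xy] by (auto intro!: T_fin_closed)
    then show ?thesis by (simp add: S_simps)
  qed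
qed

lemma \<mu>_add_l: "\<lbrakk>x \<in> carrier (T i); x' \<in> carrier (T i); y \<in> carrier (T j)\<rbrakk> \<Longrightarrow>
    \<mu> i j (x \<oplus>\<^bsub>T i\<^esub> x') y = \<mu> i j x y \<oplus>\<^bsub>T (i + j)\<^esub> \<mu> i j x' y"
  by (rule additive_add[OF \<mu>_additive])

lemma \<mu>_add_r: "\<lbrakk>x \<in> carrier (T i); y \<in> carrier (T j); y' \<in> carrier (T j)\<rbrakk> \<Longrightarrow>
    \<mu> i j x (y \<oplus>\<^bsub>T j\<^esub> y') = \<mu> i j x y \<oplus>\<^bsub>T (i + j)\<^esub> \<mu> i j x y'"
  by (rule additive_add[OF \<mu>_additive_r])

lemma S_add_simp: "i \<le> n \<Longrightarrow> (x \<oplus>\<^bsub>S\<^esub> y) i = x i \<oplus>\<^bsub>T i\<^esub> y i"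
  and S_mult_simp: "k \<le> n \<Longrightarrow> (x \<otimes>\<^bsub>S\<^esub> y) k = (\<Oplus>\<^bsub>T k\<^esub>i\<in>{..k}. \<mu> i (k - i) (x i) (y (k - i)))"
  and S_zero_simp: "i \<le> n \<Longrightarrow> \<zero>\<^bsub>S\<^esub> i = \<zero>\<^bsub>T i\<^esub>"
  and S_one_simp: "i \<le> n \<Longrightarrow> \<one>\<^bsub>S\<^esub> i = (if i = 0 then Scal \<one>\<^bsub>R\<^esub> else \<zero>\<^bsub>T i\<^esub>)"
  by (simp_all add: S_simps)

lemma abelian_group_S: "abelian_group S"
proof (rule abelian_groupI)
  fix x y z assume "x \<in> carrier S" "y \<in> carrier S" "z \<in> carrier S"
  then show "x \<oplus>\<^bsub>S\<^esub> y \<oplus>\<^bsub>S\<^esub> z = x \<oplus>\<^bsub>S\<^esub> (y \<oplus>\<^bsub>S\<^esub> z)"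
    by (intro S_ext S_closed) (simp_all add: S_add_simp S_mem abelian_groupE(1,3)[OF T_group])
next
  fix x y assume "x \<in> carrier S" "y \<in> carrier S"
  then show "x \<oplus>\<^bsub>S\<^esub> y = y \<oplus>\<^bsub>S\<^esub> x"
    by (intro S_ext S_closed) (simp_all add: S_add_simp S_mem abelian_groupE(4)[OF T_group])
next
  fix x assume x: "x \<in> carrier S"
  then show "\<zero>\<^bsub>S\<^esub> \<oplus>\<^bsub>S\<^esub> x = x"
    by (intro S_ext S_closed) (simp_all add: S_add_simp S_zero_simp S_mem abelian_groupE(5)[OF T_group])
  let ?y = "\<lambda>i\<in>{..n}. \<ominus>\<^bsub>T i\<^esub> x i"
  have "?y \<in> carrier S"
  proof -
    have "?y \<in> (\<Pi>\<^sub>E i\<in>{..n}. carrier (T i))"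
      using S_mem[OF x] abelian_group.a_inv_closed[OF T_group] by simp
    then show ?thesis by (simp add: S_simps)
  qed
  moreover from this have "?y \<oplus>\<^bsub>S\<^esub> x = \<zero>\<^bsub>S\<^esub>"
    using x by (intro S_ext S_closed) (simp_all add: S_add_simp S_zero_simp S_mem abelian_group.l_neg[OF T_group])
  ultimately show "\<exists>y\<in>carrier S. y \<oplus>\<^bsub>S\<^esub> x = \<zero>\<^bsub>S\<^esub>" by blast
qed (use S_closed in auto)

text \<open>Component \<open>k\<close> of either product is the sum of
  \<open>x i \<otimes> y b \<otimes> z (k - i - b)\<close> over
  \<open>i + b \<le> k\<close>.\<close>

lemma S_assoc:
  assumes x: "x \<in> carrier S" and y: "y \<in> carrier S" and z: "z \<in> carrier S"
  shows "x \<otimes>\<^bsub>S\<^esub> y \<otimes>\<^bsub>S\<^esub> z = x \<otimes>\<^bsub>S\<^esub> (y \<otimes>\<^bsub>S\<^esub> z)"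
proof (rule S_ext)
  fix k assume k: "k \<le> n"
  interpret Tk: abelian_group "T k" by (rule T_group)
  let ?F = "\<lambda>i b. \<mu> (i + b) (k - (i + b)) (\<mu> i b (x i) (y b)) (z (k - (i + b)))"
  have F: "?F i b \<in> carrier (T k)" if "i + b \<le> k" for i b
  proof -
    have "\<mu> i b (x i) (y b) \<in> carrier (T (i + b))" using that k x y by (intro \<mu>_closed S_mem) auto
    then show ?thesis using \<mu>_closed[of _ "i + b" "z (k - (i + b))" "k - (i + b)"] S_mem[OF z, of "k - (i + b)"] that k by simp
  qed
  have "(x \<otimes>\<^bsub>S\<^esub> y \<otimes>\<^bsub>S\<^esub> z) k = (\<Oplus>\<^bsub>T k\<^esub>a\<in>{..k}. \<mu> a (k - a) ((x \<otimes>\<^bsub>S\<^esub> y) a) (z (k - a)))"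
    using k by (simp add: S_mult_simp)
  also have "\<dots> = (\<Oplus>\<^bsub>T k\<^esub>a\<in>{..k}. \<Oplus>\<^bsub>T k\<^esub>i\<in>{..a}. ?F i (a - i))"
  proof (rule Tk.finsum_cong'[OF refl])
    show "(\<lambda>a. \<Oplus>\<^bsub>T k\<^esub>i\<in>{..a}. ?F i (a - i)) \<in> {..k} \<rightarrow> carrier (T k)"
      by (intro Pi_I T_fin_closed F) auto
    fix a assume a: "a \<in> {..k}"
    have za: "z (k - a) \<in> carrier (T (k - a))" using k z by (intro S_mem) auto
    have "\<mu> a (k - a) ((x \<otimes>\<^bsub>S\<^esub> y) a) (z (k - a)) =
        (\<Oplus>\<^bsub>T (a + (k - a))\<^esub>i\<in>{..a}. \<mu> a (k - a) (\<mu> i (a - i) (x i) (y (a - i))) (z (k - a)))"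
    proof -
      have "(x \<otimes>\<^bsub>S\<^esub> y) a = (\<Oplus>\<^bsub>T a\<^esub>i\<in>{..a}. \<mu> i (a - i) (x i) (y (a - i)))" using a k by (simp add: S_mult_simp)
      then show ?thesis
        by (simp only:) (rule additive_finsum[OF T_group T_group \<mu>_additive[OF za]], use a k x y in \<open>auto intro!: \<mu>_term\<close>)
    qed
    also have "a + (k - a) = k" using a by simp
    also have "(\<Oplus>\<^bsub>T k\<^esub>i\<in>{..a}. \<mu> a (k - a) (\<mu> i (a - i) (x i) (y (a - i))) (z (k - a))) =
        (\<Oplus>\<^bsub>T k\<^esub>i\<in>{..a}. ?F i (a - i))"
    proof (rule Tk.finsum_cong'[OF refl])
      show "(\<lambda>i. ?F i (a - i)) \<in> {..a} \<rightarrow> carrier (T k)" using a by (intro Pi_I F) auto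
    qed simp
    finally show "\<mu> a (k - a) ((x \<otimes>\<^bsub>S\<^esub> y) a) (z (k - a)) = (\<Oplus>\<^bsub>T k\<^esub>i\<in>{..a}. ?F i (a - i))" .
  qed
  also have "\<dots> = (\<Oplus>\<^bsub>T k\<^esub>i\<in>{..k}. \<Oplus>\<^bsub>T k\<^esub>b\<in>{..k - i}. ?F i b)"
    by (rule Tk.finsum_triangle[OF F])
  also have "\<dots> = (\<Oplus>\<^bsub>T k\<^esub>i\<in>{..k}. \<mu> i (k - i) (x i) ((y \<otimes>\<^bsub>S\<^esub> z) (k - i)))"
  proof (rule Tk.finsum_cong'[OF refl])
    show "(\<lambda>i. \<mu> i (k - i) (x i) ((y \<otimes>\<^bsub>S\<^esub> z) (k - i))) \<in> {..k} \<rightarrow> carrier (T k)"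
      using k x y z S_closed(4) by (auto intro!: \<mu>_term)
    fix i assume i: "i \<in> {..k}"
    have xi: "x i \<in> carrier (T i)" using i k x by (intro S_mem) auto
    have "\<mu> i (k - i) (x i) ((y \<otimes>\<^bsub>S\<^esub> z) (k - i)) =
        (\<Oplus>\<^bsub>T (i + (k - i))\<^esub>b\<in>{..k - i}. \<mu> i (k - i) (x i) (\<mu> b (k - i - b) (y b) (z (k - i - b))))"
    proof -
      have "(y \<otimes>\<^bsub>S\<^esub> z) (k - i) = (\<Oplus>\<^bsub>T (k - i)\<^esub>b\<in>{..k - i}. \<mu> b (k - i - b) (y b) (z (k - i - b)))"
        using i k by (simp add: S_mult_simp)
      then show ?thesis
        by (simp only:) (rule additive_finsum[OF T_group T_group \<mu>_additive_r[OF xi]], simp, rule \<mu>_term, use i k y z in auto)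
    qed
    moreover have "\<mu> i (k - i) (x i) (\<mu> b (k - i - b) (y b) (z (k - i - b))) = ?F i b" if b: "b \<le> k - i" for b
      using \<mu>_assoc[OF xi S_mem[OF y, of b] S_mem[OF z, of "k - i - b"]] b i k by simp
    moreover have "(\<Oplus>\<^bsub>T k\<^esub>b\<in>{..k - i}. ?F i b) =
        (\<Oplus>\<^bsub>T k\<^esub>b\<in>{..k - i}. \<mu> i (k - i) (x i) (\<mu> b (k - i - b) (y b) (z (k - i - b))))"
    proof (rule Tk.finsum_cong'[OF refl])
      show "(\<lambda>b. \<mu> i (k - i) (x i) (\<mu> b (k - i - b) (y b) (z (k - i - b)))) \<in> {..k - i} \<rightarrow> carrier (T k)"
        using i F calculation(2) by (intro Pi_I) auto
    qed (use calculation(2) in simp)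
    ultimately show "(\<Oplus>\<^bsub>T k\<^esub>b\<in>{..k - i}. ?F i b) = \<mu> i (k - i) (x i) ((y \<otimes>\<^bsub>S\<^esub> z) (k - i))"
      using i by simp
  qed
  also have "\<dots> = (x \<otimes>\<^bsub>S\<^esub> (y \<otimes>\<^bsub>S\<^esub> z)) k" using k by (simp add: S_mult_simp)
  finally show "(x \<otimes>\<^bsub>S\<^esub> y \<otimes>\<^bsub>S\<^esub> z) k = (x \<otimes>\<^bsub>S\<^esub> (y \<otimes>\<^bsub>S\<^esub> z)) k" .
qed (use assms S_closed in auto)

lemma \<mu>_zero_l: "y \<in> carrier (T j) \<Longrightarrow> \<mu> i j \<zero>\<^bsub>T i\<^esub> y = \<zero>\<^bsub>T (i + j)\<^esub>"
  by (rule additive_zero[OF T_group T_group \<mu>_additive])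

lemma \<mu>_zero_r: "x \<in> carrier (T i) \<Longrightarrow> \<mu> i j x \<zero>\<^bsub>T j\<^esub> = \<zero>\<^bsub>T (i + j)\<^esub>"
  by (rule additive_zero[OF T_group T_group \<mu>_additive_r])

text \<open>In the unit laws only the term with the unit in degree 0 survives: \<open>i = 0\<close>
  for the left unit and \<open>i = k\<close> for the right one.\<close>

lemma ring_S: "ring S"
proof (rule ringI[OF abelian_group_S])
  show "monoid S"
  proof (rule monoidI)
    fix x assume x: "x \<in> carrier S"
    show "\<one>\<^bsub>S\<^esub> \<otimes>\<^bsub>S\<^esub> x = x"
    proof (rule S_ext)
      fix k assume k: "k \<le> n"
      interpret Tk: left_module R "T k" by (rule left_module_T)
      have "(\<one>\<^bsub>S\<^esub> \<otimes>\<^bsub>S\<^esub> x) k = (\<Oplus>\<^bsub>T k\<^esub>i\<in>{..k}. if i = 0 then x k else \<zero>\<^bsub>T k\<^esub>)"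
        unfolding S_mult_simp[OF k]
      proof (rule Tk.X.finsum_cong'[OF refl])
        fix i assume i: "i \<in> {..k}"
        show "\<mu> i (k - i) (\<one>\<^bsub>S\<^esub> i) (x (k - i)) = (if i = 0 then x k else \<zero>\<^bsub>T k\<^esub>)"
          using i k S_mem[OF x, of "k - i"] \<mu>_zero_l[of "x (k - i)" "k - i" i] Tk.smult_one
          by (auto simp: S_one_simp tensor_mult.simps)
      qed (use S_mem[OF x k] in auto)
      also have "\<dots> = x k" using S_mem[OF x k] Tk.X.finsum_singleton[of 0 "{..k}" "\<lambda>_. x k"] by simp
      finally show "(\<one>\<^bsub>S\<^esub> \<otimes>\<^bsub>S\<^esub> x) k = x k" .
    qed (use x S_closed in auto)
    show "x \<otimes>\<^bsub>S\<^esub> \<one>\<^bsub>S\<^esub> = x"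
    proof (rule S_ext)
      fix k assume k: "k \<le> n"
      interpret Tk: left_module R "T k" by (rule left_module_T)
      have "(x \<otimes>\<^bsub>S\<^esub> \<one>\<^bsub>S\<^esub>) k = (\<Oplus>\<^bsub>T k\<^esub>i\<in>{..k}. if k = i then x k else \<zero>\<^bsub>T k\<^esub>)"
        unfolding S_mult_simp[OF k]
      proof (rule Tk.X.finsum_cong'[OF refl])
        fix i assume i: "i \<in> {..k}"
        show "\<mu> i (k - i) (x i) (\<one>\<^bsub>S\<^esub> (k - i)) = (if k = i then x k else \<zero>\<^bsub>T k\<^esub>)"
          using i k S_mem[OF x, of i] \<mu>_zero_r[of "x i" i "k - i"] \<mu>_one[of "x k" k] S_mem[OF x k]
          by (auto simp: S_one_simp)
      qed (use S_mem[OF x k] in auto)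
      also have "\<dots> = x k" using S_mem[OF x k] Tk.X.finsum_singleton[of k "{..k}" "\<lambda>_. x k"] by simp
      finally show "(x \<otimes>\<^bsub>S\<^esub> \<one>\<^bsub>S\<^esub>) k = x k" .
    qed (use x S_closed in auto)
  qed (use S_closed S_assoc in auto)
next
  fix x y z assume x: "x \<in> carrier S" and y: "y \<in> carrier S" and z: "z \<in> carrier S"
  show "(x \<oplus>\<^bsub>S\<^esub> y) \<otimes>\<^bsub>S\<^esub> z = x \<otimes>\<^bsub>S\<^esub> z \<oplus>\<^bsub>S\<^esub> y \<otimes>\<^bsub>S\<^esub> z"
  proof (rule S_ext)
    fix k assume k: "k \<le> n"
    interpret Tk: abelian_group "T k" by (rule T_group)
    have "\<mu> i (k - i) ((x \<oplus>\<^bsub>S\<^esub> y) i) (z (k - i)) =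
      \<mu> i (k - i) (x i) (z (k - i)) \<oplus>\<^bsub>T k\<^esub> \<mu> i (k - i) (y i) (z (k - i))" if "i \<le> k" for i
      using that k \<mu>_add_l[OF S_mem[OF x] S_mem[OF y] S_mem[OF z], of i "k - i"] by (simp add: S_add_simp)
    then have "((x \<oplus>\<^bsub>S\<^esub> y) \<otimes>\<^bsub>S\<^esub> z) k =
      (\<Oplus>\<^bsub>T k\<^esub>i\<in>{..k}. \<mu> i (k - i) (x i) (z (k - i)) \<oplus>\<^bsub>T k\<^esub> \<mu> i (k - i) (y i) (z (k - i)))"
      unfolding S_mult_simp[OF k] using k x y z by (intro Tk.finsum_cong') (auto intro!: \<mu>_term)
    also have "\<dots> = (x \<otimes>\<^bsub>S\<^esub> z \<oplus>\<^bsub>S\<^esub> y \<otimes>\<^bsub>S\<^esub> z) k"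
      using k x y z by (subst Tk.finsum_addf) (auto intro!: \<mu>_term simp: S_add_simp S_mult_simp)
    finally show "((x \<oplus>\<^bsub>S\<^esub> y) \<otimes>\<^bsub>S\<^esub> z) k = (x \<otimes>\<^bsub>S\<^esub> z \<oplus>\<^bsub>S\<^esub> y \<otimes>\<^bsub>S\<^esub> z) k" .
  qed (use x y z S_closed in auto)
  show "z \<otimes>\<^bsub>S\<^esub> (x \<oplus>\<^bsub>S\<^esub> y) = z \<otimes>\<^bsub>S\<^esub> x \<oplus>\<^bsub>S\<^esub> z \<otimes>\<^bsub>S\<^esub> y"
  proof (rule S_ext)
    fix k assume k: "k \<le> n"
    interpret Tk: abelian_group "T k" by (rule T_group)
    have "\<mu> i (k - i) (z i) ((x \<oplus>\<^bsub>S\<^esub> y) (k - i)) =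
      \<mu> i (k - i) (z i) (x (k - i)) \<oplus>\<^bsub>T k\<^esub> \<mu> i (k - i) (z i) (y (k - i))" if "i \<le> k" for i
      using that k \<mu>_add_r[OF S_mem[OF z] S_mem[OF x] S_mem[OF y], of i "k - i"] by (simp add: S_add_simp)
    then have "(z \<otimes>\<^bsub>S\<^esub> (x \<oplus>\<^bsub>S\<^esub> y)) k =
      (\<Oplus>\<^bsub>T k\<^esub>i\<in>{..k}. \<mu> i (k - i) (z i) (x (k - i)) \<oplus>\<^bsub>T k\<^esub> \<mu> i (k - i) (z i) (y (k - i)))"
      unfolding S_mult_simp[OF k] using k x y z by (intro Tk.finsum_cong') (auto intro!: \<mu>_term)
    also have "\<dots> = (z \<otimes>\<^bsub>S\<^esub> x \<oplus>\<^bsub>S\<^esub> z \<otimes>\<^bsub>S\<^esub> y) k"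
      using k x y z by (subst Tk.finsum_addf) (auto intro!: \<mu>_term simp: S_add_simp S_mult_simp)
    finally show "(z \<otimes>\<^bsub>S\<^esub> (x \<oplus>\<^bsub>S\<^esub> y)) k = (z \<otimes>\<^bsub>S\<^esub> x \<oplus>\<^bsub>S\<^esub> z \<otimes>\<^bsub>S\<^esub> y) k" .
  qed (use x y z S_closed in auto)
qed

end

end

section \<open>The module of a pair\<close>

locale extension_module = tensor_algebra R M
  for R :: "'a ring" and M :: "('a, 'm) bimodule" +
  fixes n :: nat and Y :: "('a, 'y) module" and g :: "'y \<Rightarrow> 'm \<Rightarrow> 'y"
  assumes pair: "extension_pair R M n Y g"
begin

lemma left_module_Y: "left_module R Y"
  using pair by (simp add: extension_pair_def)

interpretation Y: left_module R Y by (rule left_module_Y)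

lemma Y_group: "abelian_group Y"
  by (rule left_module_group[OF left_module_Y])

abbreviation act where "act \<equiv> tensor_act Y g"

lemma g_hom: "y \<in> carrier Y \<Longrightarrow> g y \<in> module_hom R M Y"
  using pair by (auto simp: extension_pair_def module_hom_def[of R Y] hom_module_def)

lemma g_simps:
  shows g_closed: "\<lbrakk>y \<in> carrier Y; m \<in> carrier M\<rbrakk> \<Longrightarrow> g y m \<in> carrier Y"
    and g_add_r: "\<lbrakk>y \<in> carrier Y; m \<in> carrier M; m' \<in> carrier M\<rbrakk> \<Longrightarrow> g y (m \<oplus>\<^bsub>M\<^esub> m') = g y m \<oplus>\<^bsub>Y\<^esub> g y m'"
    and g_smult_r: "\<lbrakk>y \<in> carrier Y; r \<in> carrier R; m \<in> carrier M\<rbrakk> \<Longrightarrow> g y (r \<odot>\<^bsub>M\<^esub> m) = r \<odot>\<^bsub>Y\<^esub> g y m"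
    and g_add_l: "\<lbrakk>y \<in> carrier Y; y' \<in> carrier Y; m \<in> carrier M\<rbrakk> \<Longrightarrow> g (y \<oplus>\<^bsub>Y\<^esub> y') m = g y m \<oplus>\<^bsub>Y\<^esub> g y' m"
    and g_smult_l: "\<lbrakk>y \<in> carrier Y; r \<in> carrier R; m \<in> carrier M\<rbrakk> \<Longrightarrow> g (r \<odot>\<^bsub>Y\<^esub> y) m = g y (m \<odot>r\<^bsub>M\<^esub> r)"
proof -
  show "\<lbrakk>y \<in> carrier Y; m \<in> carrier M\<rbrakk> \<Longrightarrow> g y m \<in> carrier Y"
    "\<lbrakk>y \<in> carrier Y; m \<in> carrier M; m' \<in> carrier M\<rbrakk> \<Longrightarrow> g y (m \<oplus>\<^bsub>M\<^esub> m') = g y m \<oplus>\<^bsub>Y\<^esub> g y m'"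
    "\<lbrakk>y \<in> carrier Y; r \<in> carrier R; m \<in> carrier M\<rbrakk> \<Longrightarrow> g y (r \<odot>\<^bsub>M\<^esub> m) = r \<odot>\<^bsub>Y\<^esub> g y m"
    using g_hom[of y] by (auto simp: module_hom_def)
  show "\<lbrakk>y \<in> carrier Y; y' \<in> carrier Y; m \<in> carrier M\<rbrakk> \<Longrightarrow> g (y \<oplus>\<^bsub>Y\<^esub> y') m = g y m \<oplus>\<^bsub>Y\<^esub> g y' m"
    "\<lbrakk>y \<in> carrier Y; r \<in> carrier R; m \<in> carrier M\<rbrakk> \<Longrightarrow> g (r \<odot>\<^bsub>Y\<^esub> y) m = g y (m \<odot>r\<^bsub>M\<^esub> r)"
    using pair by (auto simp: extension_pair_def module_hom_def[of R Y] hom_module_def)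
qed

lemma g_additive: "m \<in> carrier M \<Longrightarrow> additive Y Y (\<lambda>y. g y m)"
  by (simp add: additive_def g_simps)

text \<open>\<open>T_recursion\<close> for the constant family \<open>Y\<close> and
  \<open>h m y = g y m\<close>. Balancedness is \<open>g y (m r) = g (r y) m\<close>, the linearity
  of \<open>g\<close> into \<open>Hom(M, Y)\<close>; linearity of each \<open>g y\<close> accounts
  for the left scalars.\<close>

lemma act_step:
  assumes y: "y \<in> carrier Y"
  shows act_lin: "lin_map R (T i) Y (\<lambda>x. act i x y)"
    and act_Suc: "\<lbrakk>m \<in> carrier M; t \<in> carrier (T i)\<rbrakk> \<Longrightarrow> act (Suc i) (cons i m t) y = g (act i t y) m"
proof -
  have f_0: "lin_map R (T 0) Y (\<lambda>x. act 0 x y)"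
    unfolding lin_map_def T_0_simps(1)
    using y by (auto simp: T_0_simps Y.smult_closed Y.smult_l_distr Y.smult_assoc)
  have f_Suc: "(\<lambda>x. act (Suc i) x y) = tensor_lift R i Y (\<lambda>m t. g (act i t y) m)" for i
    using y by (cases i) (auto simp: Y.smult_one)
  have bal: "balanced R M Y Y (\<lambda>m y. g y m)"
    by (simp add: balanced_def g_simps)
  note rec = T_recursion[of "\<lambda>_. Y" "\<lambda>_ m y. g y m" "\<lambda>i x. act i x y", OF left_module_Y bal g_smult_r f_0 f_Suc]
  show "lin_map R (T i) Y (\<lambda>x. act i x y)"
    "\<lbrakk>m \<in> carrier M; t \<in> carrier (T i)\<rbrakk> \<Longrightarrow> act (Suc i) (cons i m t) y = g (act i t y) m"
    using rec by blast+
qed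

lemma act_additive: "y \<in> carrier Y \<Longrightarrow> additive (T i) Y (\<lambda>x. act i x y)"
  by (rule lin_additive[OF left_module_T left_module_Y act_lin])

lemma act_smult: "\<lbrakk>r \<in> carrier R; x \<in> carrier (T i); y \<in> carrier Y\<rbrakk> \<Longrightarrow> act i (r \<odot>\<^bsub>T i\<^esub> x) y = r \<odot>\<^bsub>Y\<^esub> act i x y"
  by (rule lin_smult[OF left_module_T left_module_Y act_lin])

declare tensor_act.simps(2,3) [simp del]

lemma act_closed: "\<lbrakk>x \<in> carrier (T i); y \<in> carrier Y\<rbrakk> \<Longrightarrow> act i x y \<in> carrier Y"
  using additive_closed[OF act_additive] .

lemma act_zero_l: "y \<in> carrier Y \<Longrightarrow> act i \<zero>\<^bsub>T i\<^esub> y = \<zero>\<^bsub>Y\<^esub>"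
  by (rule additive_zero[OF T_group Y_group act_additive])

lemma act_diff_l:
  "\<lbrakk>u \<in> carrier (T i); v \<in> carrier (T i); y \<in> carrier Y\<rbrakk> \<Longrightarrow>
    act i (u \<ominus>\<^bsub>T i\<^esub> v) y = act i u y \<ominus>\<^bsub>Y\<^esub> act i v y"
  by (rule additive_diff[OF T_group Y_group act_additive])

lemma act_additive_r:
  assumes "x \<in> carrier (T i)" shows "additive Y Y (act i x)"
  using assms
proof (induction i arbitrary: x)
  case 0
  then obtain r where "r \<in> carrier R" "x = Scal r" unfolding T_0_simps(1) by blast
  then show ?case by (simp add: additive_def Y.smult_closed Y.smult_r_distr)
next
  case (Suc i)
  show ?case
    unfolding additive_def
  proof (intro conjI ballI)
    fix y y' assume y: "y \<in> carrier Y" "y' \<in> carrier Y"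
    show "act (Suc i) x (y \<oplus>\<^bsub>Y\<^esub> y') = act (Suc i) x y \<oplus>\<^bsub>Y\<^esub> act (Suc i) x y'"
      using Suc.prems
    proof (induction x rule: T_induct)
      case (cons m t)
      note add = Suc.IH[OF cons(2)]
      show ?case
        using cons y additive_closed[OF add] additive_add[OF add] by (simp add: act_Suc g_simps)
    next
      case (diff u v)
      then show ?case
        using y act_closed[OF diff(1)] act_closed[OF diff(2)]
        by (simp add: act_diff_l Y.X.add_diff_add)
    qed
  qed (use act_closed[OF Suc.prems] in blast)
qed

text \<open>The rightmost factor of a tensor acts first, hence \<open>z\<close> acts before
  \<open>x\<close>.\<close>

lemma act_\<mu>:
  assumes "x \<in> carrier (T i)" "z \<in> carrier (T j)" "y \<in> carrier Y"
  shows "act (i + j) (\<mu> i j x z) y = act i x (act j z y)"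
  using assms(1)
proof (induction i arbitrary: x)
  case 0
  then obtain r where "r \<in> carrier R" "x = Scal r" unfolding T_0_simps(1) by blast
  then show ?case using assms by (simp add: tensor_mult.simps act_smult)
next
  case (Suc i)
  from Suc.prems show ?case
  proof (induction x rule: T_induct)
    case (cons m t)
    then show ?case using Suc.IH[of t] assms by (simp add: \<mu>_Suc \<mu>_closed act_Suc act_closed)
  next
    case (diff u v)
    have "\<mu> (Suc i) j (u \<ominus>\<^bsub>T (Suc i)\<^esub> v) z = \<mu> (Suc i) j u z \<ominus>\<^bsub>T (Suc i + j)\<^esub> \<mu> (Suc i) j v z"
      by (rule additive_diff[OF T_group T_group \<mu>_additive[OF assms(2)] diff(1,2)])
    then show ?case
      using diff assms \<mu>_closed[OF diff(1) assms(2)] \<mu>_closed[OF diff(2) assms(2)]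
      by (simp add: act_diff_l act_closed del: add_Suc)
  qed
qed

lemma foldl_g_additive: "set ms \<subseteq> carrier M \<Longrightarrow> additive Y Y (\<lambda>y. foldl g y ms)"
proof (induction ms)
  case (Cons m ms)
  then have "additive Y Y (\<lambda>y. foldl g y ms)" "m \<in> carrier M" by auto
  then show ?case using g_additive[of m] by (simp add: additive_def)
qed (simp add: additive_def)

text \<open>The condition on a pair speaks of lists of \<open>n + 1\<close> elements, whereas
  \<open>act\<close> uses tensors. Since \<open>act (m \<otimes> t) y = g (act t y) m\<close>, the
  leading factor can be moved to the front of the list; this trades tensor degree for list length
  until only a list longer than \<open>n\<close> is left.\<close>

lemma foldl_act_zero:
  assumes "t \<in> carrier (T i)" "y \<in> carrier Y" "set ms \<subseteq> carrier M" "n < i + length ms"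
  shows "foldl g (act i t y) ms = \<zero>\<^bsub>Y\<^esub>"
  using assms(1,3,4)
proof (induction i arbitrary: t ms)
  case 0
  then obtain r where "r \<in> carrier R" "t = Scal r" unfolding T_0_simps(1) by blast
  then have ry: "act 0 t y \<in> carrier Y" using assms(2) by (simp add: Y.smult_closed)
  \<comment> \<open>The first \<open>n + 1\<close> entries already give zero, and the remaining ones
    preserve it.\<close>
  have "foldl g (act 0 t y) (take (n + 1) ms) = \<zero>\<^bsub>Y\<^esub>"
    using pair ry 0 set_take_subset[of "n + 1" ms] unfolding extension_pair_def by force
  then have "foldl g (act 0 t y) (take (n + 1) ms @ drop (n + 1) ms) = foldl g \<zero>\<^bsub>Y\<^esub> (drop (n + 1) ms)"
    by (simp only: foldl_append)
  moreover have "set (drop (n + 1) ms) \<subseteq> carrier M" using 0 set_drop_subset[of "n + 1" ms] by blast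
  ultimately show ?case using additive_zero[OF Y_group Y_group foldl_g_additive] by simp
next
  case (Suc i)
  from Suc.prems(1) show ?case
  proof (induction t rule: T_induct)
    case (cons m t)
    then show ?case using Suc.IH[of t "m # ms"] Suc.prems assms(2) by (simp add: act_Suc)
  next
    case (diff u v)
    then show ?case
      using additive_diff[OF Y_group Y_group foldl_g_additive[OF Suc.prems(2)]] assms(2)
      by (simp add: act_diff_l act_closed Y.X.diff_eq_zero_iff)
  qed
qed

lemma act_zero: "\<lbrakk>t \<in> carrier (T i); y \<in> carrier Y; n < i\<rbrakk> \<Longrightarrow> act i t y = \<zero>\<^bsub>Y\<^esub>"
  using foldl_act_zero[of t i y "[]"] by simp

section \<open>The action of the trivial extension\<close>

abbreviation P where "P \<equiv> pair_module n Y g"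

lemma P_simps [simp]: "carrier P = carrier Y" "\<zero>\<^bsub>P\<^esub> = \<zero>\<^bsub>Y\<^esub>" "y \<oplus>\<^bsub>P\<^esub> y' = y \<oplus>\<^bsub>Y\<^esub> y'"
  "x \<odot>\<^bsub>P\<^esub> y = (\<Oplus>\<^bsub>Y\<^esub>i\<in>{..n}. act i (x i) y)"
  by (simp_all add: pair_module_def)

lemma act_term: "\<lbrakk>x \<in> carrier (S n); y \<in> carrier Y; i \<le> n\<rbrakk> \<Longrightarrow> act i (x i) y \<in> carrier Y"
  by (simp add: act_closed S_mem)

lemma S_act_closed: "\<lbrakk>x \<in> carrier (S n); y \<in> carrier Y\<rbrakk> \<Longrightarrow> (\<Oplus>\<^bsub>Y\<^esub>i\<in>{..n}. act i (x i) y) \<in> carrier Y"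
  by (intro Y.X.finsum_closed) (auto intro: act_term)

lemma S_act_assoc:
  assumes x: "x \<in> carrier (S n)" and z: "z \<in> carrier (S n)" and y: "y \<in> carrier Y"
  shows "(\<Oplus>\<^bsub>Y\<^esub>k\<in>{..n}. act k ((x \<otimes>\<^bsub>S n\<^esub> z) k) y) =
    (\<Oplus>\<^bsub>Y\<^esub>i\<in>{..n}. act i (x i) (\<Oplus>\<^bsub>Y\<^esub>j\<in>{..n}. act j (z j) y))"
proof -
  let ?F = "\<lambda>i j. act i (x i) (act j (z j) y)"
  have F: "?F i j \<in> carrier Y" if "i \<le> n" "j \<le> n" for i j
    using that assms by (intro act_closed S_mem act_term)
  have "(\<Oplus>\<^bsub>Y\<^esub>k\<in>{..n}. act k ((x \<otimes>\<^bsub>S n\<^esub> z) k) y) = (\<Oplus>\<^bsub>Y\<^esub>k\<in>{..n}. \<Oplus>\<^bsub>Y\<^esub>i\<in>{..k}. ?F i (k - i))"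
  proof (rule Y.X.finsum_cong'[OF refl])
    show "(\<lambda>k. \<Oplus>\<^bsub>Y\<^esub>i\<in>{..k}. ?F i (k - i)) \<in> {..n} \<rightarrow> carrier Y"
      using F by (auto intro!: Y.X.finsum_closed)
    fix k assume k: "k \<in> {..n}"
    have "(x \<otimes>\<^bsub>S n\<^esub> z) k = (\<Oplus>\<^bsub>T k\<^esub>i\<in>{..k}. \<mu> i (k - i) (x i) (z (k - i)))" using k by (simp add: S_mult_simp)
    then have "act k ((x \<otimes>\<^bsub>S n\<^esub> z) k) y = (\<Oplus>\<^bsub>Y\<^esub>i\<in>{..k}. act k (\<mu> i (k - i) (x i) (z (k - i))) y)"
      by (simp only:) (rule additive_finsum[OF T_group Y_group act_additive[OF y]], simp, rule \<mu>_term,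
        use k x z in auto)
    also have "\<dots> = (\<Oplus>\<^bsub>Y\<^esub>i\<in>{..k}. ?F i (k - i))"
    proof (rule Y.X.finsum_cong'[OF refl])
      fix i assume i: "i \<in> {..k}"
      show "act k (\<mu> i (k - i) (x i) (z (k - i))) y = ?F i (k - i)"
        using act_\<mu>[OF S_mem[OF x] S_mem[OF z] y, of i "k - i"] i k by simp
    qed (use k F in auto)
    finally show "act k ((x \<otimes>\<^bsub>S n\<^esub> z) k) y = (\<Oplus>\<^bsub>Y\<^esub>i\<in>{..k}. ?F i (k - i))" .
  qed
  also have "\<dots> = (\<Oplus>\<^bsub>Y\<^esub>i\<in>{..n}. \<Oplus>\<^bsub>Y\<^esub>j\<in>{..n - i}. ?F i j)"
    by (rule Y.X.finsum_triangle) (use F in auto)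
  also have "\<dots> = (\<Oplus>\<^bsub>Y\<^esub>i\<in>{..n}. act i (x i) (\<Oplus>\<^bsub>Y\<^esub>j\<in>{..n}. act j (z j) y))"
  proof (rule Y.X.finsum_cong'[OF refl])
    show "(\<lambda>i. act i (x i) (\<Oplus>\<^bsub>Y\<^esub>j\<in>{..n}. act j (z j) y)) \<in> {..n} \<rightarrow> carrier Y"
      using x z y by (auto intro!: act_term S_act_closed)
    fix i assume i: "i \<in> {..n}"
    \<comment> \<open>The product of the trivial extension drops the degrees above \<open>n\<close>.
      In the iterated action these terms are present, but they act by zero because of the condition
      on \<open>g\<close>.\<close>
    have "?F i j = \<zero>\<^bsub>Y\<^esub>" if "j \<in> {..n} - {..n - i}" for j
    proof -
      have ij: "j \<le> n" "i \<le> n" "n < i + j" using that i by auto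
      show ?thesis using act_\<mu>[OF S_mem[OF x ij(2)] S_mem[OF z ij(1)] y]
          act_zero[OF \<mu>_closed[OF S_mem[OF x ij(2)] S_mem[OF z ij(1)]] y ij(3)] by simp
    qed
    then have "(\<Oplus>\<^bsub>Y\<^esub>j\<in>{..n - i}. ?F i j) = (\<Oplus>\<^bsub>Y\<^esub>j\<in>{..n}. ?F i j)"
      using F i by (intro Y.X.add.finprod_mono_neutral_cong_left) auto
    also have "\<dots> = act i (x i) (\<Oplus>\<^bsub>Y\<^esub>j\<in>{..n}. act j (z j) y)"
      using i z y by (intro additive_finsum[OF Y_group Y_group act_additive_r[OF S_mem[OF x]], symmetric])
        (auto intro: act_term)
    finally show "(\<Oplus>\<^bsub>Y\<^esub>j\<in>{..n - i}. ?F i j) = act i (x i) (\<Oplus>\<^bsub>Y\<^esub>j\<in>{..n}. act j (z j) y)" .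
  qed
  finally show ?thesis .
qed

lemma left_module_P: "left_module (S n) P"
proof (rule left_moduleI[OF ring_S])
  fix y assume y: "y \<in> carrier P"
  show "\<exists>y'\<in>carrier P. y' \<oplus>\<^bsub>P\<^esub> y = \<zero>\<^bsub>P\<^esub>"
    using y by (intro bexI[of _ "\<ominus>\<^bsub>Y\<^esub> y"]) (auto simp: Y.X.l_neg)
  have "(\<Oplus>\<^bsub>Y\<^esub>i\<in>{..n}. act i (\<one>\<^bsub>S n\<^esub> i) y) = (\<Oplus>\<^bsub>Y\<^esub>i\<in>{..n}. if i = 0 then y else \<zero>\<^bsub>Y\<^esub>)"
    using y by (intro Y.X.finsum_cong') (auto simp: S_one_simp Y.smult_one act_zero_l)
  also have "\<dots> = y" using y Y.X.finsum_singleton[of 0 "{..n}" "\<lambda>_. y"] by simp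
  finally show "\<one>\<^bsub>S n\<^esub> \<odot>\<^bsub>P\<^esub> y = y" by simp
next
  fix x y y' assume x: "x \<in> carrier (S n)" and y: "y \<in> carrier P" "y' \<in> carrier P"
  have "(\<Oplus>\<^bsub>Y\<^esub>i\<in>{..n}. act i (x i) (y \<oplus>\<^bsub>Y\<^esub> y')) = (\<Oplus>\<^bsub>Y\<^esub>i\<in>{..n}. act i (x i) y \<oplus>\<^bsub>Y\<^esub> act i (x i) y')"
    using x y by (intro Y.X.finsum_cong') (auto intro!: act_term additive_add[OF act_additive_r[OF S_mem[OF x]]])
  also have "\<dots> = (\<Oplus>\<^bsub>Y\<^esub>i\<in>{..n}. act i (x i) y) \<oplus>\<^bsub>Y\<^esub> (\<Oplus>\<^bsub>Y\<^esub>i\<in>{..n}. act i (x i) y')"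
    using x y by (intro Y.X.finsum_addf) (auto intro!: act_term)
  finally show "x \<odot>\<^bsub>P\<^esub> (y \<oplus>\<^bsub>P\<^esub> y') = x \<odot>\<^bsub>P\<^esub> y \<oplus>\<^bsub>P\<^esub> x \<odot>\<^bsub>P\<^esub> y'" by simp
next
  fix x z y assume x: "x \<in> carrier (S n)" and z: "z \<in> carrier (S n)" and y: "y \<in> carrier P"
  have "(\<Oplus>\<^bsub>Y\<^esub>i\<in>{..n}. act i ((x \<oplus>\<^bsub>S n\<^esub> z) i) y) = (\<Oplus>\<^bsub>Y\<^esub>i\<in>{..n}. act i (x i) y \<oplus>\<^bsub>Y\<^esub> act i (z i) y)"
    using x y z by (intro Y.X.finsum_cong')
      (auto intro!: act_term additive_add[OF act_additive] S_mem simp: S_add_simp)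
  also have "\<dots> = (\<Oplus>\<^bsub>Y\<^esub>i\<in>{..n}. act i (x i) y) \<oplus>\<^bsub>Y\<^esub> (\<Oplus>\<^bsub>Y\<^esub>i\<in>{..n}. act i (z i) y)"
    using x y z by (intro Y.X.finsum_addf) (auto intro!: act_term)
  finally show "(x \<oplus>\<^bsub>S n\<^esub> z) \<odot>\<^bsub>P\<^esub> y = x \<odot>\<^bsub>P\<^esub> y \<oplus>\<^bsub>P\<^esub> z \<odot>\<^bsub>P\<^esub> y" by simp
  show "(x \<otimes>\<^bsub>S n\<^esub> z) \<odot>\<^bsub>P\<^esub> y = x \<odot>\<^bsub>P\<^esub> (z \<odot>\<^bsub>P\<^esub> y)"
    using S_act_assoc[OF x z] y by simp
next
  fix x y assume "x \<in> carrier (S n)" "y \<in> carrier P"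
  then show "x \<odot>\<^bsub>P\<^esub> y \<in> carrier P" by (simp add: S_act_closed)
qed (auto simp: Y.X.a_ac)

text \<open>The rightmost factor acts first and kills \<open>y\<close>; in degree 1 a scalar is
  absorbed by \<open>g (r y) m = g y (m r)\<close>.\<close>

lemma act_ker:
  assumes y: "y \<in> carrier Y" and 0: "\<And>m. m \<in> carrier M \<Longrightarrow> g y m = \<zero>\<^bsub>Y\<^esub>"
  shows "t \<in> carrier (T (Suc i)) \<Longrightarrow> act (Suc i) t y = \<zero>\<^bsub>Y\<^esub>"
proof (induction i arbitrary: t)
  case 0
  then show ?case
  proof (induction t rule: T_induct)
    case (cons m t)
    then obtain r where "r \<in> carrier R" "t = Scal r" unfolding T_0_simps(1) by blast
    then show ?case using cons y assms(2) by (simp add: act_Suc g_simps rsmult_closed)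
  next
    case (diff u v)
    then show ?case using y by (simp add: act_diff_l Y.X.diff_eq_zero_iff)
  qed
next
  case (Suc i)
  from Suc.prems show ?case
  proof (induction t rule: T_induct)
    case (cons m t)
    then show ?case using Suc.IH[of t] y additive_zero[OF Y_group Y_group g_additive] by (simp add: act_Suc)
  next
    case (diff u v)
    then show ?case using y by (simp add: act_diff_l Y.X.diff_eq_zero_iff)
  qed
qed

lemma S_act_ker:
  assumes y: "y \<in> carrier Y" and 0: "\<And>m. m \<in> carrier M \<Longrightarrow> g y m = \<zero>\<^bsub>Y\<^esub>" and x: "x \<in> carrier (S n)"
  shows "x \<odot>\<^bsub>P\<^esub> y = the_Scal (x 0) \<odot>\<^bsub>Y\<^esub> y"
proof -
  have "act 0 (x 0) y \<in> carrier Y" using act_term[OF x y, of 0] by simp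
  then have c: "the_Scal (x 0) \<odot>\<^bsub>Y\<^esub> y \<in> carrier Y" by simp
  have "(\<Oplus>\<^bsub>Y\<^esub>i\<in>{..n}. act i (x i) y) = (\<Oplus>\<^bsub>Y\<^esub>i\<in>{..n}. if i = 0 then the_Scal (x 0) \<odot>\<^bsub>Y\<^esub> y else \<zero>\<^bsub>Y\<^esub>)"
  proof (rule Y.X.finsum_cong'[OF refl])
    fix i assume i: "i \<in> {..n}"
    show "act i (x i) y = (if i = 0 then the_Scal (x 0) \<odot>\<^bsub>Y\<^esub> y else \<zero>\<^bsub>Y\<^esub>)"
      using act_ker[OF y 0, of "x i" "i - 1"] S_mem[OF x, of i] i by (cases i) auto
  qed (use c in auto)
  also have "\<dots> = the_Scal (x 0) \<odot>\<^bsub>Y\<^esub> y"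
    using c Y.X.finsum_singleton[of 0 "{..n}" "\<lambda>_. the_Scal (x 0) \<odot>\<^bsub>Y\<^esub> y"] by simp
  finally show ?thesis by simp
qed

end

section \<open>Injective dimension over the trivial extension\<close>

text \<open>In a trivial quotient the coset of \<open>a\<close> is \<open>N\<close>, and it contains
  \<open>a\<close>. Asking for the unit law at \<open>a\<close> alone spares a proof that the
  cocycles form a group.\<close>

lemma trivial_Mod_mem:
  assumes "trivial_group (G Mod N)" and "a \<in> carrier G" and "\<one>\<^bsub>G\<^esub> \<in> N" and "\<one>\<^bsub>G\<^esub> \<otimes>\<^bsub>G\<^esub> a = a"
  shows "a \<in> N"
proof -
  have "N #>\<^bsub>G\<^esub> a \<in> carrier (G Mod N)" using assms(2) by (auto simp: FactGroup_def RCOSETS_def)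
  then have "N #>\<^bsub>G\<^esub> a = N" using assms(1) by (simp add: trivial_group_def FactGroup_def)
  moreover have "a \<in> N #>\<^bsub>G\<^esub> a" unfolding r_coset_def using assms(3,4) by force
  ultimately show ?thesis by simp
qed

context tensor_algebra begin

lemma Scal_the_Scal: "x \<in> carrier (T 0) \<Longrightarrow> Scal (the_Scal x) = x \<and> the_Scal x \<in> carrier R"
  unfolding T_0_simps(1) by auto

abbreviation augmentation :: "(nat \<Rightarrow> ('a, 'm) tensor) \<Rightarrow> 'a" where
  "augmentation x \<equiv> the_Scal (x 0)"

abbreviation augmentation_section :: "nat \<Rightarrow> 'a \<Rightarrow> nat \<Rightarrow> ('a, 'm) tensor" where
  "augmentation_section n r \<equiv> \<lambda>i\<in>{..n}. if i = 0 then Scal r else \<zero>\<^bsub>T i\<^esub>"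

text \<open>The elements without components below degree \<open>p\<close>. Left multiplication by
  the kernel of the augmentation raises the degree, and beyond degree \<open>n\<close> only zero is
  left, so the filtration ends at \<open>n + 1\<close>.\<close>

abbreviation degree_filtration :: "nat \<Rightarrow> nat \<Rightarrow> (nat \<Rightarrow> ('a, 'm) tensor) set" where
  "degree_filtration n p \<equiv> {x \<in> carrier (S n). \<forall>i\<le>n. i < p \<longrightarrow> x i = \<zero>\<^bsub>T i\<^esub>}"

lemma nilpotent_extension_S:
  "nilpotent_extension (S n) R augmentation (augmentation_section n) (degree_filtration n) (Suc n)"
proof (intro nilpotent_extension.intro nilpotent_extension_axioms.intro)
  show "ring (S n)" by (rule ring_S)
  show "ring R" by (rule R.ring_axioms)
  have x0: "Scal (the_Scal (x 0)) = x 0" "the_Scal (x 0) \<in> carrier R" if "x \<in> carrier (S n)" for x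
    using Scal_the_Scal[OF S_mem[OF that, of 0]] by auto
  show "augmentation \<in> ring_hom (S n) R"
  proof (rule ring_hom_memI)
    fix x y assume x: "x \<in> carrier (S n)" and y: "y \<in> carrier (S n)"
    obtain r s where r: "r \<in> carrier R" "x 0 = Scal r" and s: "s \<in> carrier R" "y 0 = Scal s"
      using x0[OF x] x0[OF y] by metis
    have "Scal (r \<otimes>\<^bsub>R\<^esub> s) \<in> carrier (T 0)" using r s unfolding T_0_simps(1) by simp
    then have "(x \<otimes>\<^bsub>S n\<^esub> y) 0 = Scal (r \<otimes>\<^bsub>R\<^esub> s)"
      using r s abelian_monoid.finsum_0[OF abelian_group.axioms(1)[OF T_group[of 0]]]
      by (simp add: S_mult_simp tensor_mult.simps T_0_simps)
    then show "the_Scal ((x \<otimes>\<^bsub>S n\<^esub> y) 0) = the_Scal (x 0) \<otimes>\<^bsub>R\<^esub> the_Scal (y 0)" using r s by simp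
    show "the_Scal ((x \<oplus>\<^bsub>S n\<^esub> y) 0) = the_Scal (x 0) \<oplus>\<^bsub>R\<^esub> the_Scal (y 0)"
      using r s by (simp add: S_add_simp T_0_simps)
  qed (use x0 in \<open>auto simp: S_one_simp\<close>)
next
  fix r assume r: "r \<in> carrier R"
  let ?x = "augmentation_section n r"
  have "Scal r \<in> carrier (T 0)" using r unfolding T_0_simps(1) by simp
  then have "?x \<in> (\<Pi>\<^sub>E i\<in>{..n}. carrier (T i))" using abelian_groupE(2)[OF T_group] by auto
  then show "?x \<in> carrier (S n)" by (simp add: S_simps)
  show "the_Scal (?x 0) = r" by simp
next
  show "{x \<in> carrier (S n). \<forall>i\<le>n. i < Suc n \<longrightarrow> x i = \<zero>\<^bsub>T i\<^esub>} = {\<zero>\<^bsub>S n\<^esub>}"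
    using S_closed(2) by (auto simp: S_zero_simp intro!: S_ext)
next
  fix x b p assume x: "x \<in> carrier (S n)" "the_Scal (x 0) = \<zero>\<^bsub>R\<^esub>"
    and "b \<in> {x \<in> carrier (S n). \<forall>i\<le>n. i < p \<longrightarrow> x i = \<zero>\<^bsub>T i\<^esub>}"
  then have b: "b \<in> carrier (S n)" "\<And>i. i \<le> n \<Longrightarrow> i < p \<Longrightarrow> b i = \<zero>\<^bsub>T i\<^esub>" by auto
  have "(x \<otimes>\<^bsub>S n\<^esub> b) k = \<zero>\<^bsub>T k\<^esub>" if k: "k \<le> n" "k < Suc p" for k
  proof -
    interpret Tk: left_module R "T k" by (rule left_module_T)
    \<comment> \<open>For \<open>i = 0\<close> the left factor is zero; for \<open>i > 0\<close> the
      right factor is in degree \<open>k - i < p\<close> and is zero.\<close>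
    have "\<mu> i (k - i) (x i) (b (k - i)) = \<zero>\<^bsub>T k\<^esub>" if i: "i \<le> k" for i
    proof (cases "i = 0")
      case True
      then show ?thesis using x(2) S_mem[OF b(1) k(1)] by (simp add: tensor_mult.simps)
    next
      case False
      then have "b (k - i) = \<zero>\<^bsub>T (k - i)\<^esub>" using b(2)[of "k - i"] i k by auto
      then show ?thesis using \<mu>_zero_r[OF S_mem[OF x(1)], of i "k - i"] i k by simp
    qed
    then have "(x \<otimes>\<^bsub>S n\<^esub> b) k = (\<Oplus>\<^bsub>T k\<^esub>i\<in>{..k}. \<zero>\<^bsub>T k\<^esub>)"
      unfolding S_mult_simp[OF k(1)] by (intro Tk.X.finsum_cong') auto
    then show ?thesis by (simp add: Tk.X.finsum_zero)
  qed
  then show "x \<otimes>\<^bsub>S n\<^esub> b \<in> {x \<in> carrier (S n). \<forall>i\<le>n. i < Suc p \<longrightarrow> x i = \<zero>\<^bsub>T i\<^esub>}"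
    using S_closed(4)[OF x(1) b(1)] by simp
qed auto

end

text \<open>The witness is \<open>(0, m, 0, ...)\<close>, for which \<open>n \<ge> 1\<close> is
  needed. It shows that whatever the kernel of the augmentation annihilates lies in the kernel of
  \<open>g\<close>.\<close>

lemma (in extension_module) exists_smult_Vec:
  assumes n: "n \<ge> 1" and m: "m \<in> carrier M" and y: "y \<in> carrier Y"
  shows "\<exists>x\<in>carrier (S n). the_Scal (x 0) = \<zero>\<^bsub>R\<^esub> \<and> x \<odot>\<^bsub>P\<^esub> y = g y m"
proof -
  interpret Y: left_module R Y by (rule left_module_Y)
  let ?x = "\<lambda>i\<in>{..n}. if i = 1 then Vec m else \<zero>\<^bsub>T i\<^esub>"
  have "Vec m \<in> carrier (T (Suc 0))" using m unfolding T_1_simps(1) by simp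
  then have "?x \<in> (\<Pi>\<^sub>E i\<in>{..n}. carrier (T i))" using abelian_groupE(2)[OF T_group] by auto
  then have x: "?x \<in> carrier (S n)" by (simp add: S_simps)
  have "(\<Oplus>\<^bsub>Y\<^esub>i\<in>{..n}. act i (?x i) y) = (\<Oplus>\<^bsub>Y\<^esub>i\<in>{..n}. if 1 = i then g y m else \<zero>\<^bsub>Y\<^esub>)"
    using y m g_closed by (intro Y.X.finsum_cong') (auto simp: act_zero_l tensor_act.simps)
  also have "\<dots> = g y m"
    using y m g_closed n Y.X.finsum_singleton[of 1 "{..n}" "\<lambda>_. g y m"] by simp
  finally have "?x \<odot>\<^bsub>P\<^esub> y = g y m" by simp
  moreover have "the_Scal (?x 0) = \<zero>\<^bsub>R\<^esub>" by (simp add: T_0_simps)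
  ultimately show ?thesis using x by blast
qed

theorem corollary4p9:
  fixes R :: "'a ring" and M :: "('a, 'm) bimodule" and n :: nat
    and Y :: "('a, 'y) module" and g :: "'y \<Rightarrow> 'm \<Rightarrow> 'y"
  assumes "ring R" and "\<one>\<^bsub>R\<^esub> \<noteq> \<zero>\<^bsub>R\<^esub>"
    and "bimodule R M"
    and "n \<ge> 1"
    and "extension_pair R M n Y g"
    and "\<And>i. i \<ge> 1 \<Longrightarrow> trivial_group (Ext (trivial_extension R M n) i (Z_module R) (pair_module n Y g))"
  shows "inj_dim (trivial_extension R M n) (pair_module n Y g) = inj_dim R (ker_module R M Y g)"
proof -
  interpret extension_module R M n Y g
    by (intro extension_module.intro tensor_algebra.intro extension_module_axioms.intro assms)
  let ?Z = "Z_module R :: (nat \<Rightarrow> ('a, 'm) tensor, 'a) module"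
  interpret N: nilpotent_extension "S n" R augmentation "augmentation_section n" "degree_filtration n" "Suc n"
    by (rule nilpotent_extension_S)
  \<comment> \<open>\<open>Ext\<close> is computed from the resolution that this choice picks, so
    the argument has to run on this very resolution.\<close>
  define W where "W = (SOME (E, \<epsilon>, d). injective_resolution (S n) P
    (E :: nat \<Rightarrow> (nat \<Rightarrow> ('a, 'm) tensor, (nat \<Rightarrow> ('a, 'm) tensor, 'y) universe) module) \<epsilon> d)"
  obtain E \<epsilon> d where some: "W = (E, \<epsilon>, d)" by (cases W)
  have "case W of (E, \<epsilon>, d) \<Rightarrow> injective_resolution (S n) P E \<epsilon> d"
    unfolding W_def by (rule someI_ex) (use exists_injective_resolution[OF left_module_P] in auto)
  then have res: "injective_resolution (S n) P E \<epsilon> d" by (simp add: some)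
  interpret res: injective_res "S n" P E \<epsilon> d by (rule injective_res.intro[OF left_module_P res])
  have Ext: "trivial_group (cocycles (S n) ?Z E d i Mod coboundaries (S n) ?Z E d i)" if "i \<ge> 1" for i
    using assms(6)[OF that] by (simp add: Ext_def some flip: W_def)
  have Z_simps: "carrier ?Z = carrier R" "x \<oplus>\<^bsub>?Z\<^esub> y = x \<oplus>\<^bsub>R\<^esub> y" "s \<odot>\<^bsub>?Z\<^esub> x = the_Scal (s 0) \<otimes>\<^bsub>R\<^esub> x" for s x y
    by (simp_all add: Z_module_def)
  interpret ann_exact "S n" R augmentation "augmentation_section n" "degree_filtration n" "Suc n" P E \<epsilon> d
  proof (intro ann_exact.intro ann_exact_axioms.intro)
    fix e i assume e: "e \<in> carrier (N.ann (E (Suc i)))" and de: "d (Suc i) e = \<zero>\<^bsub>E (Suc (Suc i))\<^esub>"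
    let ?A = "N.ann (E (Suc i))"
    interpret A: left_module R ?A by (rule N.left_module_ann[OF res.E])
    interpret E1: left_module "S n" "E (Suc i)" by (rule res.E)
    interpret E2: left_module "S n" "E (Suc (Suc i))" by (rule res.E)
    \<comment> \<open>A cocycle \<open>e\<close> annihilated by the kernel of the augmentation is
      turned into the homomorphism \<open>r \<mapsto> r e\<close> on \<open>Z(R)\<close>. In degree
      \<open>i + 1\<close> it is a coboundary \<open>d i \<circ> \<psi>\<close> by hypothesis, and
      \<open>\<psi> 1\<close> is the required preimage of \<open>e\<close>.\<close>
    define \<phi> where "\<phi> = (\<lambda>r\<in>carrier R. r \<odot>\<^bsub>?A\<^esub> e)"
    have rA: "r \<odot>\<^bsub>?A\<^esub> e \<in> carrier ?A" if "r \<in> carrier R" for r using A.smult_closed[OF that e] .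
    have "lin_map (S n) ?Z (E (Suc i)) \<phi>"
      unfolding lin_map_def Z_simps
    proof (intro conjI ballI)
      fix r assume r: "r \<in> carrier R"
      show "\<phi> r \<in> carrier (E (Suc i))" using rA[OF r] r by (simp add: \<phi>_def N.ann_carrier)
      show "\<phi> (r \<oplus>\<^bsub>R\<^esub> s) = \<phi> r \<oplus>\<^bsub>E (Suc i)\<^esub> \<phi> s" if "s \<in> carrier R" for s
        using A.smult_l_distr[OF r that e] r that by (simp add: \<phi>_def)
      show "\<phi> (the_Scal (x 0) \<otimes>\<^bsub>R\<^esub> r) = x \<odot>\<^bsub>E (Suc i)\<^esub> \<phi> r" if x: "x \<in> carrier (S n)" for x
        using A.smult_assoc[OF N.\<pi>_simps(1)[OF x] r e] N.smult_ann[OF res.E rA[OF r] x] N.\<pi>_simps(1)[OF x] r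
        by (simp add: \<phi>_def)
    qed
    then have \<phi>: "\<phi> \<in> module_hom (S n) ?Z (E (Suc i))" by (simp add: module_hom_iff \<phi>_def Z_simps)
    have d\<phi>: "d (Suc i) (\<phi> r) = \<zero>\<^bsub>E (Suc (Suc i))\<^esub>" if r: "r \<in> carrier R" for r
    proof -
      obtain x where x: "x \<in> carrier (S n)" "the_Scal (x 0) = r" using N.sec[OF r] by blast
      have "d (Suc i) (\<phi> r) = d (Suc i) (x \<odot>\<^bsub>E (Suc i)\<^esub> e)" using N.smult_ann[OF res.E e x(1)] x r by (simp add: \<phi>_def)
      also have "\<dots> = \<zero>\<^bsub>E (Suc (Suc i))\<^esub>" using lin_smult[OF res.E res.E res.d x(1) N.ann_carrier[OF e]] de x by simp
      finally show ?thesis .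
    qed
    let ?G = "cocycles (S n) ?Z E d (Suc i)"
    have \<phi>G: "\<phi> \<in> carrier ?G"
      using \<phi> d\<phi> by (auto simp: cocycles_def kernel_def hom_group_def compose_def Z_simps)
    \<comment> \<open>\<open>trivial_Mod_mem\<close> asks for the unit among the coboundaries; it is
      the differential of the zero map.\<close>
    have 0: "(\<lambda>r\<in>carrier R. \<zero>\<^bsub>E (Suc i)\<^esub>) \<in> coboundaries (S n) ?Z E d (Suc i)"
    proof -
      have "restrict (\<lambda>_. \<zero>\<^bsub>E i\<^esub>) (carrier ?Z) \<in> module_hom (S n) ?Z (E i)"
      proof -
        interpret Ei: left_module "S n" "E i" by (rule res.E)
        show ?thesis using N.\<pi>_simps(1) by (auto simp: module_hom_iff lin_map_def Z_simps)
      qed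
      moreover have "compose (carrier ?Z) (d i) (restrict (\<lambda>_. \<zero>\<^bsub>E i\<^esub>) (carrier ?Z)) = (\<lambda>r\<in>carrier R. \<zero>\<^bsub>E (Suc i)\<^esub>)"
        using lin_zero[OF res.E res.E res.d] by (auto simp: compose_def Z_simps)
      ultimately show ?thesis by (metis coboundaries.simps(2) image_eqI)
    qed
    have \<phi>0: "(\<lambda>r\<in>carrier R. \<zero>\<^bsub>E (Suc i)\<^esub> \<oplus>\<^bsub>E (Suc i)\<^esub> \<phi> r) = \<phi>"
      using \<phi> by (auto simp: module_hom_def Z_simps PiE_iff extensional_def fun_eq_iff)
    have one: "\<one>\<^bsub>?G\<^esub> = (\<lambda>r\<in>carrier R. \<zero>\<^bsub>E (Suc i)\<^esub>)"
      by (simp add: cocycles_def hom_group_def Z_simps)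
    have mult: "\<one>\<^bsub>?G\<^esub> \<otimes>\<^bsub>?G\<^esub> \<phi> = (\<lambda>r\<in>carrier R. \<zero>\<^bsub>E (Suc i)\<^esub> \<oplus>\<^bsub>E (Suc i)\<^esub> \<phi> r)"
      by (auto simp: cocycles_def hom_group_def Z_simps)
    have "trivial_group (?G Mod coboundaries (S n) ?Z E d (Suc i))" by (rule Ext) simp
    then have "\<phi> \<in> coboundaries (S n) ?Z E d (Suc i)"
      by (rule trivial_Mod_mem[OF _ \<phi>G]) (unfold mult \<phi>0, unfold one, rule 0, rule refl)
    then obtain \<psi> where \<psi>: "\<psi> \<in> module_hom (S n) ?Z (E i)" "\<phi> = compose (carrier ?Z) (d i) \<psi>" by auto
    have l\<psi>: "lin_map (S n) ?Z (E i) \<psi>" using \<psi> by (simp add: module_hom_iff)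
    have "\<psi> \<one>\<^bsub>R\<^esub> \<in> carrier (N.ann (E i))"
    proof -
      interpret Ei: left_module "S n" "E i" by (rule res.E)
      have \<psi>1: "\<psi> \<one>\<^bsub>R\<^esub> \<in> carrier (E i)" using l\<psi> by (simp add: lin_map_def Z_simps)
      have sm: "x \<odot>\<^bsub>E i\<^esub> \<psi> \<one>\<^bsub>R\<^esub> = \<psi> (the_Scal (x 0) \<otimes>\<^bsub>R\<^esub> \<one>\<^bsub>R\<^esub>)" if "x \<in> carrier (S n)" for x
      proof -
        have "\<forall>r\<in>carrier (S n). \<forall>s\<in>carrier R. \<psi> (the_Scal (r 0) \<otimes>\<^bsub>R\<^esub> s) = r \<odot>\<^bsub>E i\<^esub> \<psi> s"
          using l\<psi> by (simp add: lin_map_def Z_simps)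
        from bspec[OF bspec[OF this that] R.one_closed] show ?thesis by (rule sym)
      qed
      \<comment> \<open>\<open>x\<close> and the zero of \<open>S n\<close> have the same
        augmentation, so they act alike on \<open>\<psi> 1\<close>.\<close>
      have "x \<odot>\<^bsub>E i\<^esub> \<psi> \<one>\<^bsub>R\<^esub> = \<zero>\<^bsub>E i\<^esub>" if "x \<in> carrier (S n)" "the_Scal (x 0) = \<zero>\<^bsub>R\<^esub>" for x
        using sm[OF that(1)] sm[of "\<zero>\<^bsub>S n\<^esub>"] that(2) N.\<pi>_zero \<psi>1 S_closed(2) by simp
      then show ?thesis using \<psi>1 by (simp add: N.ann_iff)
    qed
    moreover have "d i (\<psi> \<one>\<^bsub>R\<^esub>) = e"
    proof -
      have "\<phi> \<one>\<^bsub>R\<^esub> = d i (\<psi> \<one>\<^bsub>R\<^esub>)" using \<psi> by (simp add: compose_def Z_simps)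
      then show ?thesis using A.smult_one[OF e] by (simp add: \<phi>_def)
    qed
    ultimately show "\<exists>e'\<in>carrier (N.ann (E i)). d i e' = e" by blast
  qed (rule N.nilpotent_extension_axioms res.injective_res_axioms)+
  \<comment> \<open>The zero of \<open>Hom(M, Y)\<close> is a restricted function; extensionality of
    \<open>g y\<close> makes equality with it pointwise on \<open>carrier M\<close>.\<close>
  have g_zero: "g y = \<zero>\<^bsub>hom_module R M Y\<^esub> \<longleftrightarrow> (\<forall>m\<in>carrier M. g y m = \<zero>\<^bsub>Y\<^esub>)" if "y \<in> carrier Y" for y
    using g_hom[OF that] by (auto simp: hom_module_def module_hom_def PiE_iff extensional_def fun_eq_iff)
  let ?K = "ker_module R M Y g"
  have K: "y \<in> carrier ?K \<longleftrightarrow> y \<in> carrier Y \<and> (\<forall>m\<in>carrier M. g y m = \<zero>\<^bsub>Y\<^esub>)" for y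
    using g_zero by (auto simp: ker_module_def)
  show ?thesis
  proof (rule inj_dim_ann)
    show "left_module R ?K"
    proof -
      interpret Y: left_module R Y by (rule left_module_Y)
      have "submod R Y (carrier ?K)"
        using additive_zero[OF Y_group Y_group g_additive]
        by (auto simp: submod_def K g_simps Y.smult_closed rsmult_closed)
      from Y.left_module_submod[OF this] show ?thesis by (simp add: ker_module_def)
    qed
    \<comment> \<open>Elements of \<open>ker g\<close> are annihilated because the trivial extension
      acts on them through the augmentation; conversely the elements \<open>(0, m, 0, ...)\<close>
      detect \<open>g y m\<close>.\<close>
    show "carrier ?K = carrier (N.ann P)"
    proof (intro equalityI subsetI)
      fix y assume "y \<in> carrier ?K"
      then show "y \<in> carrier (N.ann P)"
        using left_module.smult_zero_l[OF left_module_Y] by (auto simp: K N.ann_iff S_act_ker simp del: P_simps(4))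
    next
      fix y assume "y \<in> carrier (N.ann P)"
      then show "y \<in> carrier ?K"
        using exists_smult_Vec[OF assms(4)] by (force simp: K N.ann_iff simp del: P_simps(4))
    qed
  next
    fix x y assume "x \<in> carrier (S n)" "y \<in> carrier ?K"
    then show "the_Scal (x 0) \<odot>\<^bsub>?K\<^esub> y = x \<odot>\<^bsub>P\<^esub> y"
      using S_act_ker[of y x] K[of y] by (simp add: ker_module_def)
  qed (simp add: ker_module_def)
qed

end
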